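(* Let $n\ge1$, let $\mathcal{Q}\subseteq H^2(\mathbb{T}^n)$ be a quotient module, let $X\in\mathcal{B}_1(\mathcal{Q})$ be a module map, and let $\psi=X(P_{\mathcal{Q}}1)$. Let $\tilde{\mathcal{M}}_{\mathcal{Q},X}=(\mathcal{Q}^{conj}\ominus\{\bar\psi\})+\mathcal{M}_n+H^2_0(\mathbb{T}^n)$, regarded as a subspace of $L^1(\mathbb{T}^n)$. Then $X$ is liftable if and only if \[ \operatorname{dist}_{L^1(\mathbb{T}^n)}\Big(\frac{\bar\psi}{\|\psi\|_2^2},\ \tilde{\mathcal{M}}_{\mathcal{Q},X}\Big)\ge 1. \]
   Context: $\mathbb{D}$ is the open unit disc, $\mathbb{T}$ the unit circle, $\mu$ the normalized Lebesgue measure on $\mathbb{T}^n$. $H^2(\mathbb{T}^n)$ is the closed subspace of $L^2(\mathbb{T}^n)$ of functions whose Fourier coefficients vanish off $\mathbb{Z}_+^n$; $\|\cdot\|_p$ is the $L^p(\mathbb{T}^n,\mu)$ norm. $\mathcal{S}(\mathbb{D}^n)$ is the closed unit ball of $H^\infty(\mathbb{D}^n)$. $T_\varphi f=\varphi f$ on $H^2(\mathbb{T}^n)$. A closed subspace $\mathcal{Q}\subseteq H^2(\mathbb{T}^n)$ is a quotient module if $T_{z_i}^*\mathcal{Q}\subseteq\mathcal{Q}$ for all $i$; $P_{\mathcal{Q}}$ is the orthogonal projection onto $\mathcal{Q}$ and $S_\varphi=P_{\mathcal{Q}}T_\varphi|_{\mathcal{Q}}$. $\mathcal{B}_1(\mathcal{Q})$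 denotes the contractions on $\mathcal{Q}$; a module map is $X\in\mathcal{B}(\mathcal{Q})$ with $XS_{z_i}=S_{z_i}X$ for all $i$; a contractive module map is liftable if $X=S_\varphi$ for some $\varphi\in\mathcal{S}(\mathbb{D}^n)$. $S^{conj}=\{\bar f:f\in S\}$; $\mathcal{Q}^{conj}\ominus\{\bar\psi\}$ is the orthogonal complement of $\bar\psi$ in $\mathcal{Q}^{conj}$ (in $L^2$); $H^2_0(\mathbb{T}^n)=\{f\in H^2:f(0)=0\}$; $\mathcal{M}_n=L^2(\mathbb{T}^n)\ominus(H^2(\mathbb{T}^n)^{conj}+H^2(\mathbb{T}^n))$. $\operatorname{dist}_{L^1}(g,M)=\inf_{h\in M}\|g-h\|_1$.
   Formalization: The formal theorem additionally assumes ψ ≠ 0 (equivalently X ≠ 0), since the quotient of ψ̄ by ‖ψ‖₂² is undefined when ψ = 0. *)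

theory Defs
  imports "HOL-Analysis.Analysis" "HOL-Probability.Probability"
begin

definition circle_measure :: "complex measure" where
  "circle_measure = distr (uniform_measure lborel {0..2*pi}) borel cis"

definition torus_measure :: "nat \<Rightarrow> (nat \<Rightarrow> complex) measure" where
  "torus_measure n = PiM {..<n} (\<lambda>_. circle_measure)"

type_synonym tfun = "(nat \<Rightarrow> complex) \<Rightarrow> complex"

definition ae_eq :: "nat \<Rightarrow> tfun \<Rightarrow> tfun \<Rightarrow> bool" where
  "ae_eq n f g \<longleftrightarrow> (AE z in torus_measure n. f z = g z)"

definition L2 :: "nat \<Rightarrow> tfun set" where
  "L2 n = {f \<in> borel_measurable (torus_measure n).
             integrable (torus_measure n) (\<lambda>z. (cmod (f z))\<^sup>2)}"

definition norm2 :: "nat \<Rightarrow> tfun \<Rightarrow> real" where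
  "norm2 n f = sqrt (\<integral>z. (cmod (f z))\<^sup>2 \<partial>torus_measure n)"

definition norm1 :: "nat \<Rightarrow> tfun \<Rightarrow> real" where
  "norm1 n f = (\<integral>z. cmod (f z) \<partial>torus_measure n)"

definition inner2 :: "nat \<Rightarrow> tfun \<Rightarrow> tfun \<Rightarrow> complex" where
  "inner2 n f g = (\<integral>z. f z * cnj (g z) \<partial>torus_measure n)"

definition fourier :: "nat \<Rightarrow> tfun \<Rightarrow> (nat \<Rightarrow> int) \<Rightarrow> complex" where
  "fourier n f k = (\<integral>z. f z * (\<Prod>j<n. cnj (z j) powi k j) \<partial>torus_measure n)"

definition H2 :: "nat \<Rightarrow> tfun set" where
  "H2 n = {f \<in> L2 n. \<forall>k. (\<exists>j<n. k j < 0) \<longrightarrow> fourier n f k = 0}"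

text \<open>H^2_0: functions in H^2 vanishing at the origin, i.e. zeroth Fourier coefficient 0.\<close>
definition H2_0 :: "nat \<Rightarrow> tfun set" where
  "H2_0 n = {f \<in> H2 n. fourier n f (\<lambda>_. 0) = 0}"

definition conj_set :: "tfun set \<Rightarrow> tfun set" where
  "conj_set S = {(\<lambda>z. cnj (f z)) | f. f \<in> S}"

definition M_space :: "nat \<Rightarrow> tfun set" where
  "M_space n = {f \<in> L2 n. \<forall>g \<in> H2 n \<union> conj_set (H2 n). inner2 n f g = 0}"

text \<open>Closed linear subspace of L^2 (as a set of representatives, saturated
  under a.e. equality).\<close>
definition L2_closed_subspace :: "nat \<Rightarrow> tfun set \<Rightarrow> bool" where
  "L2_closed_subspace n Q \<longleftrightarrow>
     Q \<subseteq> L2 n \<and> (\<lambda>z. 0) \<in> Q \<and>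
     (\<forall>f\<in>Q. \<forall>g\<in>Q. (\<lambda>z. f z + g z) \<in> Q) \<and>
     (\<forall>c. \<forall>f\<in>Q. (\<lambda>z. c * f z) \<in> Q) \<and>
     (\<forall>f\<in>Q. \<forall>g\<in>L2 n. ae_eq n f g \<longrightarrow> g \<in> Q) \<and>
     (\<forall>F g. (\<forall>k. F k \<in> Q) \<longrightarrow> g \<in> L2 n \<longrightarrow>
        (\<lambda>k. norm2 n (\<lambda>z. F k z - g z)) \<longlonglongrightarrow> 0 \<longrightarrow> g \<in> Q)"

text \<open>Quotient module: closed subspace of H^2 invariant under the adjoints of
  T_{z_i} (g below is T_{z_i}^* f).\<close>
definition quotient_module :: "nat \<Rightarrow> tfun set \<Rightarrow> bool" where
  "quotient_module n Q \<longleftrightarrow> L2_closed_subspace n Q \<and> Q \<subseteq> H2 n \<and>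
     (\<forall>i<n. \<forall>f\<in>Q. \<exists>g\<in>Q. \<forall>h\<in>H2 n. inner2 n (\<lambda>z. z i * h z) f = inner2 n h g)"

definition projQ :: "nat \<Rightarrow> tfun set \<Rightarrow> tfun \<Rightarrow> tfun" where
  "projQ n Q f = (SOME g. g \<in> Q \<and> (\<forall>h\<in>Q. inner2 n (\<lambda>z. f z - g z) h = 0))"

definition S_op :: "nat \<Rightarrow> tfun set \<Rightarrow> tfun \<Rightarrow> tfun \<Rightarrow> tfun" where
  "S_op n Q \<phi> f = projQ n Q (\<lambda>z. \<phi> z * f z)"

definition contraction_on :: "nat \<Rightarrow> tfun set \<Rightarrow> (tfun \<Rightarrow> tfun) \<Rightarrow> bool" where
  "contraction_on n Q X \<longleftrightarrow>
     (\<forall>f\<in>Q. X f \<in> Q) \<and>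
     (\<forall>f\<in>Q. \<forall>g\<in>Q. \<forall>a b. ae_eq n (X (\<lambda>z. a * f z + b * g z)) (\<lambda>z. a * X f z + b * X g z)) \<and>
     (\<forall>f\<in>Q. norm2 n (X f) \<le> norm2 n f)"

definition module_map :: "nat \<Rightarrow> tfun set \<Rightarrow> (tfun \<Rightarrow> tfun) \<Rightarrow> bool" where
  "module_map n Q X \<longleftrightarrow>
     (\<forall>i<n. \<forall>f\<in>Q. ae_eq n (X (S_op n Q (\<lambda>z. z i) f)) (S_op n Q (\<lambda>z. z i) (X f)))"

text \<open>Closed unit ball of H^infinity(D^n), via boundary values: H^2 functions
  essentially bounded by 1.\<close>
definition schur_ball :: "nat \<Rightarrow> tfun set" where
  "schur_ball n = {\<phi> \<in> H2 n. AE z in torus_measure n. cmod (\<phi> z) \<le> 1}"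

definition liftable :: "nat \<Rightarrow> tfun set \<Rightarrow> (tfun \<Rightarrow> tfun) \<Rightarrow> bool" where
  "liftable n Q X \<longleftrightarrow> (\<exists>\<phi>\<in>schur_ball n. \<forall>f\<in>Q. ae_eq n (X f) (S_op n Q \<phi> f))"

definition dist_L1 :: "nat \<Rightarrow> tfun \<Rightarrow> tfun set \<Rightarrow> real" where
  "dist_L1 n g M = (INF h\<in>M. norm1 n (\<lambda>z. g z - h z))"

definition M_tilde :: "nat \<Rightarrow> tfun set \<Rightarrow> tfun \<Rightarrow> tfun set" where
  "M_tilde n Q \<psi> = {(\<lambda>z. a z + b z + c z) | a b c.
      a \<in> conj_set Q \<and> inner2 n a (\<lambda>z. cnj (\<psi> z)) = 0 \<and>
      b \<in> M_space n \<and> c \<in> H2_0 n}"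

end

theory Submission
  imports Defs
begin

text \<open>A symbol \<open>\<phi>\<close> in the Schur ball lifts \<open>X\<close> iff \<open>P\<^sub>Q \<phi> = \<psi>\<close>: this uses that
  \<open>H\<^sup>2 \<ominus> Q\<close> is invariant under multiplication by \<open>H\<^sup>\<infinity>\<close>, that \<open>X\<close> commutes with the
  compressed shifts, and that analytic polynomials are dense in \<open>H\<^sup>2\<close>.
  Integration against such a \<open>\<phi>\<close> is a functional of norm at most \<open>1\<close> on \<open>L\<^sup>1\<close> that kills the
  space \<open>M_tilde\<close> and takes the value \<open>1\<close> at \<open>cnj \<psi> / \<parallel>\<psi>\<parallel>\<^sup>2\<close>, so the distance is at least \<open>1\<close>.
  Conversely, if the distance is at least \<open>1\<close>, integration against \<open>\<psi>\<close> itself is bounded by the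
  \<open>L\<^sup>1\<close> norm on the span of \<open>M_tilde\<close> and \<open>cnj \<psi>\<close>; it is therefore represented there by some
  \<open>\<phi>\<close> with \<open>|\<phi>| \<le> 1\<close>, and annihilating \<open>M_tilde\<close> forces \<open>\<phi> \<in> H\<^sup>2\<close> and \<open>P\<^sub>Q \<phi> = \<psi>\<close>.\<close>

section \<open>The torus and its monomials\<close>

text \<open>The delicate point of the first direction is that a symbol is merely bounded. Invariance
  of the complement of \<open>Q\<close> under the coordinates gives invariance under polynomials,
  but approximating the symbol in the norm of \<open>L2\<close> does not control its products with
  an \<open>L2\<close> function, and its partial Fourier sums need not stay bounded. Rotating the
  other two functions in the pairing avoids approximating the symbol at all. In the converse,
  \<open>\<psi>\<close> may be unbounded and so cannot serve as symbol itself. The distance bounds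
  its functional on a subspace only, and a bounded function has to be produced from that. All
  functions involved lie in \<open>L2\<close>, so minimal-norm arguments suffice and
  \<open>L1\<close> enters through its norm alone. The conjugates in \<open>M_tilde\<close> turn the
  inner product into a bilinear integral, and the divisor is the value of the functional of
  \<open>\<psi>\<close> at \<open>cnj \<psi>\<close>. The summands \<open>M_space\<close> and
  \<open>H2_0\<close> contain the conjugate of every monomial with a negative exponent and so force
  analyticity; the summand from \<open>Q\<close> fixes the projection.\<close>

definition monom_T :: "nat \<Rightarrow> (nat \<Rightarrow> int) \<Rightarrow> tfun" where
  "monom_T n k z = (\<Prod>j<n. z j powi k j)"

text \<open>Exponents are functions on all of \<open>nat\<close>, but only the entries below
  \<open>n\<close> matter. Distinct exponents can thus name the same monomial, which is why later
  statements compare them entrywise below \<open>n\<close>.\<close>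

definition nonneg_exp :: "nat \<Rightarrow> (nat \<Rightarrow> int) set" where
  "nonneg_exp n = {k. \<forall>j<n. 0 \<le> k j}"

lemma measurable_cis [measurable]: "cis \<in> borel_measurable borel"
  by (intro borel_measurable_continuous_onI continuous_intros)

lemma prob_space_circle: "prob_space circle_measure"
  unfolding circle_measure_def
  by (intro prob_space.prob_space_distr prob_space_uniform_measure)
     (auto simp: uniform_measure_def)

lemma product_sigma_finite_circle: "product_sigma_finite (\<lambda>_::nat. circle_measure)"
  by unfold_locales (rule sigma_finite_measure.sigma_finite_countable,
    intro finite_measure.sigma_finite_measure prob_space.finite_measure prob_space_circle)

lemma prob_space_torus: "prob_space (torus_measure n)"
  unfolding torus_measure_def by (intro prob_space_PiM prob_space_circle)

interpretation torus: prob_space "torus_measure n" for n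
  by (rule prob_space_torus)

lemma sets_circle [measurable_cong, simp]: "sets circle_measure = sets borel"
  by (simp add: circle_measure_def)

lemma sets_torus [measurable_cong]: "sets (torus_measure n) = sets (PiM {..<n} (\<lambda>_. borel))"
  unfolding torus_measure_def by (intro sets_PiM_cong) auto

lemma space_torus: "space (torus_measure n) = PiE {..<n} (\<lambda>_. UNIV)"
  using sets_eq_imp_space_eq[OF sets_torus, of n] by (simp add: space_PiM)

lemma measurable_component_torus:
  "i < n \<Longrightarrow> (\<lambda>z. z i) \<in> borel_measurable (torus_measure n)"
  unfolding measurable_cong_sets[OF sets_torus refl] by measurable

lemma measurable_cnj [measurable]: "cnj \<in> borel_measurable borel"
  by (intro borel_measurable_continuous_onI continuous_intros)

lemma measurable_powi [measurable]:
  "(\<lambda>z::complex. z powi k) \<in> borel_measurable borel"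
  by (cases "0 \<le> k") (simp_all add: power_int_def)

lemma measurable_monom_T [measurable]: "monom_T n k \<in> borel_measurable (torus_measure n)"
  unfolding monom_T_def[abs_def]
  by (auto intro!: borel_measurable_prod measurable_compose[OF measurable_component_torus measurable_powi])

lemma AE_circle: "AE z in circle_measure. cmod z = 1"
  unfolding circle_measure_def by (subst AE_distr_iff) auto

lemma AE_torus: "AE z in torus_measure n. \<forall>j<n. cmod (z j) = 1"
proof -
  have "AE z in torus_measure n. cmod (z j) = 1" if "j < n" for j
    unfolding torus_measure_def
    by (rule AE_PiM_component[of "{..<n}" "\<lambda>_. circle_measure"])
       (use that prob_space_circle AE_circle in auto)
  then show ?thesis
    by (subst AE_all_countable) auto
qed

lemma cmod_monom_T: "\<forall>j<n. cmod (z j) = 1 \<Longrightarrow> cmod (monom_T n k z) = 1"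
  by (auto simp: monom_T_def norm_power_int prod_norm[symmetric])

lemma AE_cmod_monom_T: "AE z in torus_measure n. cmod (monom_T n k z) = 1"
  using AE_torus by eventually_elim (rule cmod_monom_T)

lemma AE_cmod_monom_T_le: "AE z in torus_measure n. cmod (monom_T n k z) \<le> 1"
  using AE_cmod_monom_T[of n k] by eventually_elim simp

lemma cnj_powi_circle:
  assumes "cmod z = 1" shows "cnj z powi k = z powi (- k)"
proof -
  have "cnj z = inverse z"
    using assms by (metis complex_cnj_cnj complex_cnj_inverse divide_complex_def inverse_eq_divide
        complex_div_cnj div_by_1 mult.left_neutral of_real_1 power_one)
  then show ?thesis by (simp add: power_int_minus power_int_inverse)
qed

lemma cnj_monom_T:
  "\<forall>j<n. cmod (z j) = 1 \<Longrightarrow> cnj (monom_T n k z) = monom_T n (\<lambda>j. - k j) z"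
  by (auto simp: monom_T_def cnj_powi_circle complex_cnj_power_int intro!: prod.cong)

lemma monom_T_mult:
  "\<forall>j<n. cmod (z j) = 1 \<Longrightarrow> monom_T n k z * monom_T n l z = monom_T n (\<lambda>j. k j + l j) z"
  unfolding monom_T_def prod.distrib[symmetric]
  by (intro prod.cong refl) (subst power_int_add; force)

lemma monom_T_scale: "monom_T n k (\<lambda>j. w j * z j) = monom_T n k w * monom_T n k z"
  by (simp add: monom_T_def power_int_mult_distrib prod.distrib)

lemma monom_T_0: "\<forall>j<n. k j = 0 \<Longrightarrow> monom_T n k z = 1"
  by (auto simp: monom_T_def)

lemma monom_T_cong: "\<forall>j<n. k j = l j \<Longrightarrow> monom_T n k = monom_T n l"
  by (auto simp: monom_T_def fun_eq_iff)

lemma fourier_monom: "fourier n f k = (\<integral>z. f z * cnj (monom_T n k z) \<partial>torus_measure n)"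
  by (simp add: fourier_def monom_T_def complex_cnj_power_int)

lemma fourier_monom_neg:
  "(\<integral>z. f z * monom_T n k z \<partial>torus_measure n) = fourier n f (\<lambda>j. - k j)"
  if [measurable]: "f \<in> borel_measurable (torus_measure n)"
  unfolding fourier_monom
proof (rule integral_cong_AE)
  show "AE z in torus_measure n. f z * monom_T n k z = f z * cnj (monom_T n (\<lambda>j. - k j) z)"
    using AE_torus by eventually_elim (simp add: cnj_monom_T)
qed measurable

text \<open>The antiderivative, \<open>- \<i> / k\<close> times \<open>cis (k * x)\<close>, takes
  equal values at both ends of a full period.\<close>

lemma integral_cis_period:
  assumes "k \<noteq> 0"
  shows "(LINT x|lborel. indicator {0..2*pi} x *\<^sub>R cis (of_int k * x)) = 0"
proof -
  have "((\<lambda>x. cis (of_int k * x)) has_integral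
     (- \<i> / of_int k) * cis (of_int k * (2*pi)) - (- \<i> / of_int k) * cis (of_int k * 0)) {0..2*pi}"
  proof (rule fundamental_theorem_of_calculus)
    fix x :: real
    \<comment> \<open>The derivative is computed for the entire function of a complex variable and
      then restricted to the real line.\<close>
    have "((\<lambda>z. (- \<i> / of_int k) * exp (\<i> * of_int k * z)) has_field_derivative
        exp (\<i> * of_int k * of_real x)) (at (of_real x))"
      using assms by (auto intro!: derivative_eq_intros)
    from has_vector_derivative_real_field[OF this, of "{0..2*pi}"]
    show "((\<lambda>x. (- \<i> / of_int k) * cis (of_int k * x)) has_vector_derivative cis (of_int k * x))
        (at x within {0..2*pi})"
      by (simp add: cis_conv_exp mult_ac)
  qed simp
  moreover have "cis (of_int k * (2*pi)) = 1"
    using cis_multiple_2pi[of "of_int k"] by (simp add: mult_ac)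
  ultimately have "((\<lambda>x. cis (of_int k * x)) has_integral 0) {0..2*pi}" by simp
  moreover have "set_integrable lborel {0..2*pi} (\<lambda>x. cis (of_int k * x))"
    by (rule borel_integrable_atLeastAtMost') (intro continuous_intros)
  ultimately show ?thesis
    using set_borel_integral_eq_integral(2)[of "{0..2*pi}" "\<lambda>x. cis (of_int k * x)"]
    by (simp add: set_lebesgue_integral_def integral_unique)
qed

lemma integral_powi_circle:
  "(\<integral>z. z powi k \<partial>circle_measure) = (if k = 0 then 1 else 0)"
proof -
  have "(\<integral>z. z powi k \<partial>circle_measure) = (\<integral>x. cis x powi k \<partial>uniform_measure lborel {0..2*pi})"
    unfolding circle_measure_def by (rule integral_distr) auto
  also have "\<dots> = (\<integral>x. cis (of_int k * x) \<partial>uniform_measure lborel {0..2*pi})"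
    by (simp add: cis_power_int)
  also have "\<dots> = (LINT x|lborel. (indicator {0..2*pi} x / (2*pi)) *\<^sub>R cis (of_int k * x))"
  proof -
    have *: "(\<lambda>x. indicator {0..2*pi} x / emeasure lborel {0..2*pi::real})
       = (\<lambda>x. ennreal (indicator {0..2*pi} x / (2*pi)))"
      by (auto simp: fun_eq_iff indicator_def divide_ennreal ennreal_1[symmetric] simp del: ennreal_1)
    show ?thesis
      unfolding uniform_measure_def *
      by (subst integral_density) auto
  qed
  also have "\<dots> = (1/(2*pi)) *\<^sub>R (LINT x|lborel. indicator {0..2*pi} x *\<^sub>R cis (of_int k * x))"
    by (subst integral_scaleR_right[symmetric]) (auto intro!: Bochner_Integration.integral_cong)
  also have "\<dots> = (if k = 0 then 1 else 0)"
    using integral_cis_period[of k] by (auto simp: scaleR_conv_of_real)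
  finally show ?thesis .
qed

lemma integral_monom_T:
  "(\<integral>z. monom_T n k z \<partial>torus_measure n) = (if \<forall>j<n. k j = 0 then 1 else 0)"
proof -
  interpret product_sigma_finite "\<lambda>_::nat. circle_measure"
    by (rule product_sigma_finite_circle)
  interpret c: prob_space circle_measure by (rule prob_space_circle)
  have "integrable circle_measure (\<lambda>z. z powi k i)" for i
  proof (rule c.integrable_const_bound[where B=1])
    show "AE z in circle_measure. cmod (z powi k i) \<le> 1"
      using AE_circle by eventually_elim (simp add: norm_power_int)
  qed measurable
  then have "(\<integral>z. (\<Prod>j<n. z j powi k j) \<partial>torus_measure n) = (\<Prod>j<n. \<integral>z. z powi k j \<partial>circle_measure)"
    unfolding torus_measure_def by (intro product_integral_prod) auto
  also have "\<dots> = (if \<forall>j<n. k j = 0 then 1 else 0)"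
    by (auto simp: integral_powi_circle)
  finally show ?thesis by (simp add: monom_T_def[abs_def])
qed

section \<open>The space \<open>L\<^sup>2\<close> of the torus\<close>

lemma L2_measurable [measurable_dest]: "f \<in> L2 n \<Longrightarrow> f \<in> borel_measurable (torus_measure n)"
  by (simp add: L2_def)

lemma L2_integrable_sq: "f \<in> L2 n \<Longrightarrow> integrable (torus_measure n) (\<lambda>z. (cmod (f z))\<^sup>2)"
  by (simp add: L2_def)

lemma L2_mult_integrable:
  assumes "f \<in> L2 n" "g \<in> L2 n" shows "integrable (torus_measure n) (\<lambda>z. f z * g z)"
proof (rule Bochner_Integration.integrable_bound)
  show "integrable (torus_measure n) (\<lambda>z. (cmod (f z))\<^sup>2 + (cmod (g z))\<^sup>2)"
    using assms by (intro Bochner_Integration.integrable_add L2_integrable_sq)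
  have "cmod (f z * g z) \<le> (cmod (f z))\<^sup>2 + (cmod (g z))\<^sup>2" for z
    using sum_squares_bound[of "cmod (f z)" "cmod (g z)"]
      mult_nonneg_nonneg[OF norm_ge_zero[of "f z"] norm_ge_zero[of "g z"]]
    unfolding norm_mult by linarith
  then show "AE z in torus_measure n. norm (f z * g z) \<le> norm ((cmod (f z))\<^sup>2 + (cmod (g z))\<^sup>2)"
    by (auto intro: order_trans)
qed (use assms in measurable)

lemma L2_cnj: "f \<in> L2 n \<Longrightarrow> (\<lambda>z. cnj (f z)) \<in> L2 n"
  using measurable_compose[OF L2_measurable measurable_cnj] by (simp add: L2_def)

lemma L2_zero: "(\<lambda>z. 0) \<in> L2 n"
  by (simp add: L2_def)

lemma L2_cmult: "f \<in> L2 n \<Longrightarrow> (\<lambda>z. c * f z) \<in> L2 n"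
  by (auto simp: L2_def norm_mult power_mult_distrib intro!: borel_measurable_times)

lemma L2_add:
  assumes "f \<in> L2 n" "g \<in> L2 n" shows "(\<lambda>z. f z + g z) \<in> L2 n"
proof -
  have "integrable (torus_measure n) (\<lambda>z. (cmod (f z + g z))\<^sup>2)"
  proof (rule Bochner_Integration.integrable_bound)
    show "integrable (torus_measure n) (\<lambda>z. 2 * (cmod (f z))\<^sup>2 + 2 * (cmod (g z))\<^sup>2)"
      using assms by (intro Bochner_Integration.integrable_add integrable_mult_right L2_integrable_sq)
    have "(cmod (f z + g z))\<^sup>2 \<le> 2 * (cmod (f z))\<^sup>2 + 2 * (cmod (g z))\<^sup>2" for z
    proof -
      have "(cmod (f z + g z))\<^sup>2 \<le> (cmod (f z) + cmod (g z))\<^sup>2"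
        by (intro power_mono norm_triangle_ineq) auto
      also have "\<dots> \<le> 2 * (cmod (f z))\<^sup>2 + 2 * (cmod (g z))\<^sup>2"
        using sum_squares_bound[of "cmod (f z)" "cmod (g z)"] by (simp add: power2_sum)
      finally show ?thesis .
    qed
    then show "AE z in torus_measure n. norm ((cmod (f z + g z))\<^sup>2)
        \<le> norm (2 * (cmod (f z))\<^sup>2 + 2 * (cmod (g z))\<^sup>2)"
      by auto
  qed (use assms in measurable)
  then show ?thesis using assms by (auto simp: L2_def intro!: borel_measurable_add)
qed

lemma L2_diff:
  assumes "f \<in> L2 n" "g \<in> L2 n" shows "(\<lambda>z. f z - g z) \<in> L2 n"
  using L2_add[OF assms(1) L2_cmult[OF assms(2), of "-1"]] by simp

lemma L2_bounded:
  assumes "f \<in> borel_measurable (torus_measure n)" "AE z in torus_measure n. cmod (f z) \<le> B"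
  shows "f \<in> L2 n"
proof -
  have "integrable (torus_measure n) (\<lambda>z. (cmod (f z))\<^sup>2)"
  proof (rule torus.integrable_const_bound[where B="B\<^sup>2"])
    show "AE z in torus_measure n. norm ((cmod (f z))\<^sup>2) \<le> B\<^sup>2"
      using assms(2) by eventually_elim (auto intro: power_mono)
  qed (use assms in measurable)
  with assms show ?thesis by (simp add: L2_def)
qed

lemma L2_mult_bounded:
  assumes "\<phi> \<in> borel_measurable (torus_measure n)" "AE z in torus_measure n. cmod (\<phi> z) \<le> 1" "f \<in> L2 n"
  shows "(\<lambda>z. \<phi> z * f z) \<in> L2 n"
proof -
  have "integrable (torus_measure n) (\<lambda>z. (cmod (\<phi> z * f z))\<^sup>2)"
  proof (rule Bochner_Integration.integrable_bound[OF L2_integrable_sq[OF assms(3)]])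
    show "AE z in torus_measure n. norm ((cmod (\<phi> z * f z))\<^sup>2) \<le> norm ((cmod (f z))\<^sup>2)"
      using assms(2) by eventually_elim (simp add: norm_mult power_mult_distrib mult_left_le_one_le power_le_one)
  qed (use assms in measurable)
  with assms show ?thesis by (auto simp: L2_def intro!: borel_measurable_times)
qed

lemma L2_monom_T: "monom_T n k \<in> L2 n"
  by (rule L2_bounded[OF measurable_monom_T AE_cmod_monom_T_le])

lemma L2_const: "(\<lambda>z. c) \<in> L2 n"
  by (rule L2_bounded[where B="cmod c"]) auto

lemma L2_integrable: "f \<in> L2 n \<Longrightarrow> integrable (torus_measure n) f"
  using L2_mult_integrable[OF _ L2_const[of 1]] by simp

section \<open>Norm and inner product: Cauchy-Schwarz, parallelogram law, triangle
  inequality\<close>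

lemma norm2_nonneg [simp]: "0 \<le> norm2 n f"
  by (simp add: norm2_def)

lemma norm2_sq: "(norm2 n f)\<^sup>2 = (\<integral>z. (cmod (f z))\<^sup>2 \<partial>torus_measure n)"
  by (simp add: norm2_def)

lemma norm2_cong_AE:
  assumes "f \<in> L2 n" "g \<in> L2 n" "AE z in torus_measure n. f z = g z"
  shows "norm2 n f = norm2 n g"
  unfolding norm2_def
  by (intro arg_cong[where f=sqrt] integral_cong_AE) (use assms in auto)

lemma norm2_eq_0_iff:
  assumes "f \<in> L2 n" shows "norm2 n f = 0 \<longleftrightarrow> (AE z in torus_measure n. f z = 0)"
  using integral_nonneg_eq_0_iff_AE[OF L2_integrable_sq[OF assms]] by (simp add: norm2_def)

lemma norm2_cmult: "norm2 n (\<lambda>z. c * f z) = cmod c * norm2 n f"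
  by (simp add: norm2_def norm_mult power_mult_distrib real_sqrt_mult)

lemma norm2_cnj: "norm2 n (\<lambda>z. cnj (f z)) = norm2 n f"
  by (simp add: norm2_def)

lemma norm2_minus_commute: "norm2 n (\<lambda>z. f z - g z) = norm2 n (\<lambda>z. g z - f z)"
  by (simp add: norm2_def norm_minus_commute)

lemma integral_mult_le_norm2:
  assumes f: "f \<in> L2 n" and g: "g \<in> L2 n"
  shows "(\<integral>z. cmod (f z * g z) \<partial>torus_measure n) \<le> norm2 n f * norm2 n g"
proof -
  have [measurable]: "f \<in> borel_measurable (torus_measure n)" "g \<in> borel_measurable (torus_measure n)"
    using f g by auto
  show ?thesis
  proof (cases "norm2 n f = 0 \<or> norm2 n g = 0")
    case True
    then have "AE z in torus_measure n. cmod (f z * g z) = 0"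
      using f g by (auto simp: norm2_eq_0_iff)
    then have "(\<integral>z. cmod (f z * g z) \<partial>torus_measure n) = 0"
      by (subst integral_cong_AE[where g="\<lambda>_. 0"]) auto
    then show ?thesis by simp
  next
    case False
    \<comment> \<open>For each positive \<open>t\<close> the product \<open>|f| * |g|\<close> is
      pointwise at most \<open>t/2 * |f|^2 + |g|^2 / (2*t)\<close>. This ratio of the norms
      minimises the integral of the right-hand side.\<close>
    define t where "t = norm2 n g / norm2 n f"
    have pos: "0 < norm2 n f" "0 < norm2 n g" "0 < t"
      using False norm2_nonneg[of n f] norm2_nonneg[of n g]
      by (auto simp: t_def order_le_less)
    have "(\<integral>z. cmod (f z * g z) \<partial>torus_measure n)
        \<le> (\<integral>z. t/2 * (cmod (f z))\<^sup>2 + (1/(2*t)) * (cmod (g z))\<^sup>2 \<partial>torus_measure n)"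
    proof (rule integral_mono)
      show "integrable (torus_measure n) (\<lambda>z. cmod (f z * g z))"
        using L2_mult_integrable[OF f g] by (rule integrable_norm)
      show "integrable (torus_measure n) (\<lambda>z. t/2 * (cmod (f z))\<^sup>2 + (1/(2*t)) * (cmod (g z))\<^sup>2)"
        by (intro Bochner_Integration.integrable_add integrable_mult_right L2_integrable_sq f g)
      fix z
      have "0 \<le> (t * cmod (f z) - cmod (g z))\<^sup>2 / (2*t)" using pos by simp
      also have "\<dots> = t/2 * (cmod (f z))\<^sup>2 + (1/(2*t)) * (cmod (g z))\<^sup>2 - cmod (f z * g z)"
        using pos by (simp add: norm_mult power2_diff field_simps power2_eq_square)
      finally show "cmod (f z * g z) \<le> t/2 * (cmod (f z))\<^sup>2 + (1/(2*t)) * (cmod (g z))\<^sup>2" by simp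
    qed
    also have "\<dots> = t/2 * (norm2 n f)\<^sup>2 + (1/(2*t)) * (norm2 n g)\<^sup>2"
      unfolding norm2_sq
      by (subst Bochner_Integration.integral_add)
         (auto intro!: integrable_mult_right L2_integrable_sq f g)
    also have "\<dots> = norm2 n f * norm2 n g"
      using pos by (simp add: t_def field_simps power2_eq_square)
    finally show ?thesis .
  qed
qed

lemma cmod_integral_mult_le:
  assumes "f \<in> L2 n" "g \<in> L2 n"
  shows "cmod (\<integral>z. f z * g z \<partial>torus_measure n) \<le> norm2 n f * norm2 n g"
  using order_trans[OF integral_norm_bound[of "torus_measure n" "\<lambda>z. f z * g z"]
    integral_mult_le_norm2[OF assms]] .

lemma cmod_inner2_le:
  assumes "f \<in> L2 n" "g \<in> L2 n"
  shows "cmod (inner2 n f g) \<le> norm2 n f * norm2 n g"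
  using cmod_integral_mult_le[OF assms(1) L2_cnj[OF assms(2)]] by (simp add: inner2_def norm2_cnj)

text \<open>Cauchy-Schwarz against the constant \<open>1\<close>, whose norm is \<open>1\<close>
  because the measure is normalised.\<close>

lemma norm1_le_norm2: "f \<in> L2 n \<Longrightarrow> norm1 n f \<le> norm2 n f"
  using integral_mult_le_norm2[of f n "\<lambda>_. 1"]
  by (simp add: norm1_def L2_const norm2_def torus.prob_space)

lemma inner2_add_left:
  "f \<in> L2 n \<Longrightarrow> g \<in> L2 n \<Longrightarrow> h \<in> L2 n \<Longrightarrow> inner2 n (\<lambda>z. f z + g z) h = inner2 n f h + inner2 n g h"
  unfolding inner2_def
  by (subst Bochner_Integration.integral_add[symmetric])
     (auto intro!: L2_mult_integrable L2_cnj simp: algebra_simps)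

lemma inner2_diff_left:
  "f \<in> L2 n \<Longrightarrow> g \<in> L2 n \<Longrightarrow> h \<in> L2 n \<Longrightarrow> inner2 n (\<lambda>z. f z - g z) h = inner2 n f h - inner2 n g h"
  unfolding inner2_def
  by (subst Bochner_Integration.integral_diff[symmetric])
     (auto intro!: L2_mult_integrable L2_cnj simp: algebra_simps)

lemma inner2_cmult_left: "inner2 n (\<lambda>z. c * f z) h = c * inner2 n f h"
  by (simp add: inner2_def mult.assoc)

lemma inner2_commute: "inner2 n f g = cnj (inner2 n g f)"
  unfolding inner2_def Bochner_Integration.integral_cnj[symmetric] by (simp add: mult.commute)

lemma inner2_add_right:
  "f \<in> L2 n \<Longrightarrow> g \<in> L2 n \<Longrightarrow> h \<in> L2 n \<Longrightarrow> inner2 n h (\<lambda>z. f z + g z) = inner2 n h f + inner2 n h g"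
  using inner2_add_left[of f n g h] by (metis complex_cnj_add inner2_commute)

lemma inner2_diff_right:
  "f \<in> L2 n \<Longrightarrow> g \<in> L2 n \<Longrightarrow> h \<in> L2 n \<Longrightarrow> inner2 n h (\<lambda>z. f z - g z) = inner2 n h f - inner2 n h g"
  using inner2_diff_left[of f n g h] by (metis complex_cnj_diff inner2_commute)

lemma inner2_cmult_right: "inner2 n h (\<lambda>z. c * f z) = cnj c * inner2 n h f"
  using inner2_cmult_left[of n c f h] by (metis complex_cnj_mult inner2_commute)

lemma inner2_self: "inner2 n f f = complex_of_real ((norm2 n f)\<^sup>2)"
  by (simp add: inner2_def norm2_sq complex_norm_square[symmetric] del: of_real_power)

lemma inner2_cong_AE:
  assumes "f \<in> L2 n" "g \<in> L2 n" "f' \<in> L2 n" "g' \<in> L2 n"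
    "AE z in torus_measure n. f z = f' z" "AE z in torus_measure n. g z = g' z"
  shows "inner2 n f g = inner2 n f' g'"
  unfolding inner2_def by (intro integral_cong_AE) (use assms in auto)

lemma norm2_add_sq:
  assumes "f \<in> L2 n" "g \<in> L2 n"
  shows "(norm2 n (\<lambda>z. f z + g z))\<^sup>2 = (norm2 n f)\<^sup>2 + 2 * Re (inner2 n f g) + (norm2 n g)\<^sup>2"
proof -
  have "complex_of_real ((norm2 n (\<lambda>z. f z + g z))\<^sup>2) =
      inner2 n f f + inner2 n f g + (inner2 n g f + inner2 n g g)"
    unfolding inner2_self[symmetric]
    using assms by (simp add: inner2_add_left inner2_add_right L2_add)
  also have "inner2 n g f = cnj (inner2 n f g)"
    by (rule inner2_commute)
  finally have "Re (complex_of_real ((norm2 n (\<lambda>z. f z + g z))\<^sup>2)) =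
      Re (inner2 n f f) + Re (inner2 n f g) + (Re (inner2 n f g) + Re (inner2 n g g))"
    by (simp only: plus_complex.sel cnj.sel)
  then show ?thesis unfolding inner2_self Re_complex_of_real by simp
qed

lemma norm2_diff_sq:
  assumes "f \<in> L2 n" "g \<in> L2 n"
  shows "(norm2 n (\<lambda>z. f z - g z))\<^sup>2 = (norm2 n f)\<^sup>2 - 2 * Re (inner2 n f g) + (norm2 n g)\<^sup>2"
  using norm2_add_sq[OF assms(1) L2_cmult[OF assms(2), of "-1"]]
    inner2_cmult_right[of n f "-1" g] norm2_cmult[of n "-1" g] by simp

text \<open>Phrased with the midpoint because the minimising arguments run in convex sets that need
  not be subspaces.\<close>

lemma norm2_parallelogram:
  assumes "f \<in> L2 n" "g \<in> L2 n"
  shows "(norm2 n (\<lambda>z. f z - g z))\<^sup>2 + 4 * (norm2 n (\<lambda>z. 1/2 * f z + 1/2 * g z))\<^sup>2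
    = 2 * (norm2 n f)\<^sup>2 + 2 * (norm2 n g)\<^sup>2"
proof -
  have "norm2 n (\<lambda>z. 1/2 * f z + 1/2 * g z) = 1/2 * norm2 n (\<lambda>z. f z + g z)"
    using norm2_cmult[of n "1/2" "\<lambda>z. f z + g z"] by (simp add: distrib_left)
  then have "4 * (norm2 n (\<lambda>z. 1/2 * f z + 1/2 * g z))\<^sup>2 = (norm2 n (\<lambda>z. f z + g z))\<^sup>2"
    by (simp only: power_mult_distrib) (simp add: power2_eq_square)
  then show ?thesis
    using norm2_add_sq[OF assms] norm2_diff_sq[OF assms] by linarith
qed

lemma norm2_triangle:
  assumes "f \<in> L2 n" "g \<in> L2 n"
  shows "norm2 n (\<lambda>z. f z + g z) \<le> norm2 n f + norm2 n g"
proof (rule power2_le_imp_le)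
  have "Re (inner2 n f g) \<le> norm2 n f * norm2 n g"
    using cmod_inner2_le[OF assms] complex_Re_le_cmod order_trans by blast
  then show "(norm2 n (\<lambda>z. f z + g z))\<^sup>2 \<le> (norm2 n f + norm2 n g)\<^sup>2"
    using norm2_add_sq[OF assms] by (simp add: power2_sum)
qed simp

lemma norm2_triangle_diff:
  assumes "f \<in> L2 n" "g \<in> L2 n" "h \<in> L2 n"
  shows "norm2 n (\<lambda>z. f z - h z) \<le> norm2 n (\<lambda>z. f z - g z) + norm2 n (\<lambda>z. g z - h z)"
  using norm2_triangle[OF L2_diff[OF assms(1,2)] L2_diff[OF assms(2,3)]] by simp

lemma norm2_mult_bounded_le:
  assumes "\<phi> \<in> borel_measurable (torus_measure n)" "AE z in torus_measure n. cmod (\<phi> z) \<le> 1" "f \<in> L2 n"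
  shows "norm2 n (\<lambda>z. \<phi> z * f z) \<le> norm2 n f"
  unfolding norm2_def
proof (intro real_sqrt_le_mono integral_mono_AE)
  show "AE z in torus_measure n. (cmod (\<phi> z * f z))\<^sup>2 \<le> (cmod (f z))\<^sup>2"
    using assms(2) by eventually_elim (simp add: norm_mult power_mult_distrib mult_left_le_one_le power_le_one)
qed (use assms L2_mult_bounded[OF assms] in \<open>auto intro: L2_integrable_sq\<close>)

section \<open>Limits, completeness, and minimal-norm points of convex sets\<close>

lemma tendsto_inner2:
  assumes F: "\<And>j. F j \<in> L2 n" "f \<in> L2 n" "(\<lambda>j. norm2 n (\<lambda>z. F j z - f z)) \<longlonglongrightarrow> 0"
    and g: "g \<in> L2 n"
  shows "(\<lambda>j. inner2 n (F j) g) \<longlonglongrightarrow> inner2 n f g"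
proof -
  have lim: "(\<lambda>j. norm2 n (\<lambda>z. F j z - f z) * norm2 n g) \<longlonglongrightarrow> 0"
    using tendsto_mult_left_zero[OF F(3)] .
  have le: "\<forall>j. norm (inner2 n (F j) g - inner2 n f g) \<le> norm2 n (\<lambda>z. F j z - f z) * norm2 n g"
    unfolding inner2_diff_left[OF F(1,2) g, symmetric]
    by (intro allI cmod_inner2_le L2_diff F(1,2) g)
  have "(\<lambda>j. inner2 n (F j) g - inner2 n f g) \<longlonglongrightarrow> 0"
    by (rule Lim_null_comparison[OF always_eventually[OF le] lim])
  then show ?thesis by (rule LIM_zero_cancel)
qed

lemma tendsto_norm2:
  assumes F: "\<And>j. F j \<in> L2 n" "f \<in> L2 n" "(\<lambda>j. norm2 n (\<lambda>z. F j z - f z)) \<longlonglongrightarrow> 0"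
  shows "(\<lambda>j. norm2 n (F j)) \<longlonglongrightarrow> norm2 n f"
proof -
  have 1: "norm2 n (F j) \<le> norm2 n (\<lambda>z. F j z - f z) + norm2 n f" for j
    using norm2_triangle[OF L2_diff[OF F(1) F(2), of j] F(2)] by simp
  have 2: "norm2 n f \<le> norm2 n (\<lambda>z. F j z - f z) + norm2 n (F j)" for j
    using norm2_triangle[OF L2_diff[OF F(2) F(1), of j] F(1)[of j]]
    unfolding norm2_minus_commute[of n f "F j"] by simp
  have "norm (norm2 n (F j) - norm2 n f) \<le> norm2 n (\<lambda>z. F j z - f z)" for j
    unfolding real_norm_def abs_le_iff using 1[of j] 2[of j] by linarith
  then have "(\<lambda>j. norm2 n (F j) - norm2 n f) \<longlonglongrightarrow> 0"
    by (intro Lim_null_comparison[OF always_eventually F(3)] allI)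
  then show ?thesis by (rule LIM_zero_cancel)
qed

text \<open>Riesz-Fischer. A subsequence whose \<open>i\<close>-th increment has norm at most
  \<open>(1/2)^i\<close> has summable increments in \<open>L1\<close>, hence converges almost
  everywhere. Fatou's lemma turns the pointwise limit into a limit in norm of the whole
  sequence.\<close>

lemma L2_complete:
  assumes F: "\<And>j. F j \<in> L2 n"
    and Cauchy: "\<And>e. e > 0 \<Longrightarrow> \<exists>N. \<forall>i\<ge>N. \<forall>j\<ge>N. norm2 n (\<lambda>z. F i z - F j z) < e"
  shows "\<exists>g\<in>L2 n. (\<lambda>j. norm2 n (\<lambda>z. F j z - g z)) \<longlonglongrightarrow> 0"
proof -
  have [measurable]: "F j \<in> borel_measurable (torus_measure n)" for j using F by auto
  have "\<forall>m. \<exists>N. \<forall>i\<ge>N. \<forall>j\<ge>N. norm2 n (\<lambda>z. F i z - F j z) < (1/2)^m"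
    using Cauchy by simp
  then obtain N where N: "\<And>m i j. i \<ge> N m \<Longrightarrow> j \<ge> N m \<Longrightarrow> norm2 n (\<lambda>z. F i z - F j z) < (1/2)^m"
    by metis
  \<comment> \<open>Partial sums make \<open>r i\<close> at least \<open>N m\<close> for every
    \<open>m \<le> i\<close> without first choosing \<open>N\<close> monotone.\<close>
  define r where "r i = (\<Sum>l\<le>i. N l)" for i
  have r_ge: "N m \<le> r i" if "m \<le> i" for m i
    unfolding r_def using that by (intro member_le_sum) auto
  define d where "d i z = F (r (Suc i)) z - F (r i) z" for i z
  have d_meas [measurable]: "d i \<in> borel_measurable (torus_measure n)" for i
    unfolding d_def by measurable
  have d_L2: "d i \<in> L2 n" for i unfolding d_def using F by (intro L2_diff)
  have d_int: "(\<integral>\<^sup>+z. ennreal (cmod (d i z)) \<partial>torus_measure n) \<le> ennreal ((1/2)^i)" for i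
  proof -
    have "(\<integral>\<^sup>+z. ennreal (cmod (d i z)) \<partial>torus_measure n) = ennreal (norm1 n (d i))"
      unfolding norm1_def by (intro nn_integral_eq_integral integrable_norm L2_integrable d_L2) auto
    also have "norm1 n (d i) \<le> norm2 n (d i)" by (rule norm1_le_norm2[OF d_L2])
    also have "norm2 n (d i) \<le> (1/2)^i"
      unfolding d_def using N[of i "r (Suc i)" "r i"] r_ge[of i "Suc i"] r_ge[of i i] by simp
    finally show ?thesis by (simp add: ennreal_leI)
  qed
  have "(\<integral>\<^sup>+z. (\<Sum>i. ennreal (cmod (d i z))) \<partial>torus_measure n)
      = (\<Sum>i. \<integral>\<^sup>+z. ennreal (cmod (d i z)) \<partial>torus_measure n)"
    by (rule nn_integral_suminf) measurable
  also have "\<dots> \<le> (\<Sum>i. ennreal ((1/2)^i))"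
    by (intro suminf_le d_int) auto
  also have "\<dots> = ennreal (\<Sum>i. (1/2)^i)"
    by (intro suminf_ennreal2) (auto intro!: summable_geometric)
  finally have "(\<integral>\<^sup>+z. (\<Sum>i. ennreal (cmod (d i z))) \<partial>torus_measure n) \<noteq> \<infinity>"
    by (auto simp: top_unique)
  then have "AE z in torus_measure n. (\<Sum>i. ennreal (cmod (d i z))) \<noteq> \<infinity>"
    by (intro nn_integral_PInf_AE) measurable
  then have conv: "AE z in torus_measure n. convergent (\<lambda>i. F (r i) z)"
  proof eventually_elim
    case (elim z)
    then have "summable (\<lambda>i. cmod (d i z))"
      by (intro summable_suminf_not_top) auto
    then have "summable (\<lambda>i. d i z)" by (rule summable_norm_cancel)
    then have "convergent (\<lambda>m. \<Sum>i<m. d i z)" by (simp add: summable_iff_convergent)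
    moreover have "(\<Sum>i<m. d i z) = F (r m) z - F (r 0) z" for m
      unfolding d_def by (rule sum_lessThan_telescope)
    ultimately have "convergent (\<lambda>m. F (r m) z - F (r 0) z)" by simp
    from convergent_add[OF this convergent_const[of "F (r 0) z"]] show ?case by simp
  qed
  define g where "g z = lim (\<lambda>i. F (r i) z)" for z
  have g_meas [measurable]: "g \<in> borel_measurable (torus_measure n)"
    unfolding g_def by (intro borel_measurable_lim_metric) measurable
  have lim: "AE z in torus_measure n. (\<lambda>i. F (r i) z) \<longlonglongrightarrow> g z"
    using conv unfolding g_def by eventually_elim (simp add: convergent_LIMSEQ_iff)
  \<comment> \<open>Fatou is applied to the differences \<open>F a - F (r i)\<close> with
    \<open>a\<close> fixed. That \<open>g\<close> itself is square integrable comes out only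
    afterwards.\<close>
  have bound: "(\<lambda>z. F a z - g z) \<in> L2 n \<and> norm2 n (\<lambda>z. F a z - g z) \<le> (1/2)^m" if a: "a \<ge> N m" for a m
  proof -
    have "(\<integral>\<^sup>+z. ennreal ((cmod (F a z - g z))\<^sup>2) \<partial>torus_measure n)
        = (\<integral>\<^sup>+z. liminf (\<lambda>i. ennreal ((cmod (F a z - F (r i) z))\<^sup>2)) \<partial>torus_measure n)"
    proof (rule nn_integral_cong_AE)
      show "AE z in torus_measure n. ennreal ((cmod (F a z - g z))\<^sup>2)
          = liminf (\<lambda>i. ennreal ((cmod (F a z - F (r i) z))\<^sup>2))"
        using lim
      proof eventually_elim
        case (elim z)
        then have "(\<lambda>i. ennreal ((cmod (F a z - F (r i) z))\<^sup>2)) \<longlonglongrightarrow> ennreal ((cmod (F a z - g z))\<^sup>2)"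
          by (intro tendsto_intros tendsto_ennrealI)
        then show ?case by (intro lim_imp_Liminf[symmetric]) auto
      qed
    qed
    also have "\<dots> \<le> liminf (\<lambda>i. \<integral>\<^sup>+z. ennreal ((cmod (F a z - F (r i) z))\<^sup>2) \<partial>torus_measure n)"
      by (rule nn_integral_liminf) measurable
    also have "\<dots> \<le> ennreal (((1/2)^m)\<^sup>2)"
    proof (rule Liminf_le)
      show "\<forall>\<^sub>F i in sequentially. (\<integral>\<^sup>+z. ennreal ((cmod (F a z - F (r i) z))\<^sup>2) \<partial>torus_measure n)
          \<le> ennreal (((1/2)^m)\<^sup>2)"
      proof (rule eventually_sequentiallyI[of m])
        fix i assume "m \<le> i"
        then have "norm2 n (\<lambda>z. F a z - F (r i) z) \<le> (1/2)^m"
          using N[OF a r_ge] by fastforce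
        moreover have "(\<integral>\<^sup>+z. ennreal ((cmod (F a z - F (r i) z))\<^sup>2) \<partial>torus_measure n)
            = ennreal ((norm2 n (\<lambda>z. F a z - F (r i) z))\<^sup>2)"
          unfolding norm2_sq by (intro nn_integral_eq_integral L2_integrable_sq L2_diff F) auto
        ultimately show "(\<integral>\<^sup>+z. ennreal ((cmod (F a z - F (r i) z))\<^sup>2) \<partial>torus_measure n)
            \<le> ennreal (((1/2)^m)\<^sup>2)"
          by (simp add: ennreal_leI power_mono del: power_divide)
      qed
    qed simp
    finally have le: "(\<integral>\<^sup>+z. ennreal ((cmod (F a z - g z))\<^sup>2) \<partial>torus_measure n) \<le> ennreal (((1/2)^m)\<^sup>2)" .
    then have int: "integrable (torus_measure n) (\<lambda>z. (cmod (F a z - g z))\<^sup>2)"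
      by (intro integrableI_bounded) (auto simp: order_le_less_trans)
    then have L: "(\<lambda>z. F a z - g z) \<in> L2 n" by (simp add: L2_def)
    have "(\<integral>\<^sup>+z. ennreal ((cmod (F a z - g z))\<^sup>2) \<partial>torus_measure n) = ennreal ((norm2 n (\<lambda>z. F a z - g z))\<^sup>2)"
      unfolding norm2_sq by (intro nn_integral_eq_integral int) auto
    with le have "(norm2 n (\<lambda>z. F a z - g z))\<^sup>2 \<le> ((1/2)^m)\<^sup>2"
      by (simp del: power_divide)
    then have "norm2 n (\<lambda>z. F a z - g z) \<le> (1/2)^m"
      by (rule power2_le_imp_le) simp
    with L show ?thesis by simp
  qed
  have "g \<in> L2 n"
    using L2_diff[OF F conjunct1[OF bound[OF order_refl]], of "N 0" 0] by simp
  moreover have "(\<lambda>j. norm2 n (\<lambda>z. F j z - g z)) \<longlonglongrightarrow> 0"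
  proof (rule LIMSEQ_I)
    fix e :: real assume "e > 0"
    then obtain m where m: "(1/2)^m < e" using real_arch_pow_inv[of e "1/2"] by auto
    have "norm (norm2 n (\<lambda>z. F j z - g z) - 0) < e" if "j \<ge> N m" for j
      using bound[OF that] m by simp
    then show "\<exists>no. \<forall>j\<ge>no. norm (norm2 n (\<lambda>z. F j z - g z) - 0) < e" by blast
  qed
  ultimately show ?thesis by blast
qed

text \<open>The infima \<open>m j\<close> of the norms increase and stay below \<open>B\<close>,
  hence converge; the parallelogram law then makes nearly minimal elements a Cauchy sequence.
  Nothing is assumed closed, so the limit may lie in none of the sets. For a constant sequence this
  gives a minimal-norm point of a closure; for shrinking sets of approximate solutions it takes the
  place of a compactness argument.\<close>

lemma nested_convex_converge:
  assumes C: "\<And>j. C j \<subseteq> L2 n" and dec: "\<And>i j. i \<le> j \<Longrightarrow> C j \<subseteq> C i"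
    and mid: "\<And>j f g. f \<in> C j \<Longrightarrow> g \<in> C j \<Longrightarrow> (\<lambda>z. 1/2 * f z + 1/2 * g z) \<in> C j"
    and bdd: "\<And>j. \<exists>f\<in>C j. norm2 n f \<le> B"
  shows "\<exists>k g. (\<forall>j. k j \<in> C j) \<and> g \<in> L2 n \<and> (\<lambda>j. norm2 n (\<lambda>z. k j z - g z)) \<longlonglongrightarrow> 0
     \<and> (\<forall>x. (\<forall>j. x \<in> C j) \<longrightarrow> norm2 n g \<le> norm2 n x)"
proof -
  define m where "m j = (INF f\<in>C j. norm2 n f)" for j
  have bb: "bdd_below (norm2 n ` C j)" for j by (auto intro: bdd_belowI[of _ 0])
  have ne: "C j \<noteq> {}" for j using bdd by blast
  have m_le: "m j \<le> norm2 n f" if "f \<in> C j" for f j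
    unfolding m_def using that bb by (intro cINF_lower)
  have m_nonneg: "0 \<le> m j" for j unfolding m_def using ne by (intro cINF_greatest) auto
  have "incseq m"
    unfolding m_def by (intro incseq_SucI cINF_superset_mono ne bb dec) auto
  moreover have "m j \<le> B" for j using bdd[of j] m_le order_trans by blast
  ultimately obtain L where L: "m \<longlonglongrightarrow> L" using incseq_convergent by blast
  have "\<exists>f\<in>C j. norm2 n f < m j + inverse (real (Suc j))" for j
    using cINF_less_iff[OF ne bb, of j "m j + inverse (real (Suc j))"] unfolding m_def[symmetric] by auto
  then obtain k where k: "\<And>j. k j \<in> C j" "\<And>j. norm2 n (k j) < m j + inverse (real (Suc j))"
    by metis
  have kL2: "k j \<in> L2 n" for j using k(1) C by blast
  define s where "s j = (m j + inverse (real (Suc j)))\<^sup>2" for j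
  have s: "s \<longlonglongrightarrow> L\<^sup>2"
    unfolding s_def using tendsto_power[OF tendsto_add[OF L LIMSEQ_inverse_real_of_nat], of 2] by simp
  have m2: "(\<lambda>j. (m j)\<^sup>2) \<longlonglongrightarrow> L\<^sup>2" by (intro tendsto_intros L)
  \<comment> \<open>For \<open>j \<le> i\<close> both elements lie in \<open>C j\<close>, so their
    midpoint has norm at least \<open>m j\<close>.\<close>
  have est: "(norm2 n (\<lambda>z. k i z - k j z))\<^sup>2 \<le> 2 * s i + 2 * s j - 4 * (m j)\<^sup>2" if "j \<le> i" for i j
  proof -
    have "k i \<in> C j" using k(1) dec that by blast
    then have "m j \<le> norm2 n (\<lambda>z. 1/2 * k i z + 1/2 * k j z)" by (intro m_le mid k(1))
    then have "(m j)\<^sup>2 \<le> (norm2 n (\<lambda>z. 1/2 * k i z + 1/2 * k j z))\<^sup>2"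
      using m_nonneg by (intro power_mono)
    moreover have "(norm2 n (k l))\<^sup>2 \<le> s l" for l
      unfolding s_def using k(2)[of l] by (intro power_mono) auto
    ultimately show ?thesis
      using norm2_parallelogram[OF kL2 kL2, of i j] by (smt (verit))
  qed
  have "\<exists>g\<in>L2 n. (\<lambda>j. norm2 n (\<lambda>z. k j z - g z)) \<longlonglongrightarrow> 0"
  proof (rule L2_complete[OF kL2])
    fix e :: real assume e: "e > 0"
    \<comment> \<open>In \<open>est\<close> the quantities \<open>s i\<close>, \<open>s j\<close>
      and \<open>(m j)\<^sup>2\<close> carry the weights \<open>2\<close>, \<open>2\<close> and
      \<open>4\<close>, which add up to \<open>8\<close>, and their limits cancel.\<close>
    define e' where "e' = e\<^sup>2 / 8"
    have "e' > 0" using e by (simp add: e'_def)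
    with s m2 obtain N1 N2 where N: "\<And>j. j \<ge> N1 \<Longrightarrow> \<bar>s j - L\<^sup>2\<bar> < e'" "\<And>j. j \<ge> N2 \<Longrightarrow> \<bar>(m j)\<^sup>2 - L\<^sup>2\<bar> < e'"
      by (metis LIMSEQ_D real_norm_def)
    have *: "norm2 n (\<lambda>z. k i z - k j z) < e" if ij: "max N1 N2 \<le> j" "j \<le> i" for i j
    proof (rule power2_less_imp_less)
      have "(norm2 n (\<lambda>z. k i z - k j z))\<^sup>2 < 8 * e'"
        using est[OF ij(2)] N(1)[of i] N(1)[of j] N(2)[of j] ij by auto
      then show "(norm2 n (\<lambda>z. k i z - k j z))\<^sup>2 < e\<^sup>2" by (simp add: e'_def)
    qed (use e in simp)
    have "norm2 n (\<lambda>z. k i z - k j z) < e" if "max N1 N2 \<le> i" "max N1 N2 \<le> j" for i j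
      using *[of i j] *[of j i] that norm2_minus_commute[of n "k i" "k j"] by (cases "i \<le> j") auto
    then show "\<exists>N. \<forall>i\<ge>N. \<forall>j\<ge>N. norm2 n (\<lambda>z. k i z - k j z) < e" by blast
  qed
  then obtain g where g: "g \<in> L2 n" "(\<lambda>j. norm2 n (\<lambda>z. k j z - g z)) \<longlonglongrightarrow> 0" by blast
  have "norm2 n g \<le> norm2 n x" if x: "\<forall>j. x \<in> C j" for x
  proof (rule LIMSEQ_le[OF tendsto_norm2[OF kL2 g]])
    show "(\<lambda>j. norm2 n x + inverse (real (Suc j))) \<longlonglongrightarrow> norm2 n x"
      using tendsto_add[OF tendsto_const LIMSEQ_inverse_real_of_nat, of "norm2 n x"] by simp
    show "\<exists>N. \<forall>j\<ge>N. norm2 n (k j) \<le> norm2 n x + inverse (real (Suc j))"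
      using k(2) m_le x by (meson add_mono_thms_linordered_semiring(3) less_eq_real_def order_trans)
  qed
  with k(1) g show ?thesis by blast
qed

text \<open>The inequality is the first-order condition for \<open>e\<close> to be the point of the
  closure of \<open>D\<close> nearest to the origin. As \<open>e\<close> need not belong to
  \<open>D\<close>, the sequence \<open>k\<close> is carried along and perturbations are made on
  \<open>k\<close>. Directions along which \<open>D\<close> is invariant under translation turn out
  orthogonal to \<open>e\<close>.\<close>

lemma min_norm_variational:
  assumes D: "D \<subseteq> L2 n" "D \<noteq> {}"
    and conv: "\<And>f g t. f \<in> D \<Longrightarrow> g \<in> D \<Longrightarrow> 0 \<le> t \<Longrightarrow> t \<le> 1 \<Longrightarrow>
      (\<lambda>z. complex_of_real (1 - t) * f z + complex_of_real t * g z) \<in> D"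
  obtains k e where "\<forall>j::nat. k j \<in> D" "e \<in> L2 n" "(\<lambda>j. norm2 n (\<lambda>z. k j z - e z)) \<longlonglongrightarrow> 0"
    "\<forall>x\<in>D. (norm2 n e)\<^sup>2 \<le> Re (inner2 n x e)"
    "\<forall>v\<in>L2 n. (\<forall>x\<in>D. \<forall>c. (\<lambda>z. x z + c * v z) \<in> D) \<longrightarrow> inner2 n v e = 0"
proof -
  obtain f0 where f0: "f0 \<in> D" using D by blast
  have "\<exists>k g. (\<forall>j::nat. k j \<in> D) \<and> g \<in> L2 n \<and> (\<lambda>j. norm2 n (\<lambda>z. k j z - g z)) \<longlonglongrightarrow> 0
     \<and> (\<forall>x. (\<forall>j::nat. x \<in> D) \<longrightarrow> norm2 n g \<le> norm2 n x)"
    by (rule nested_convex_converge[where B="norm2 n f0"]) (use D f0 conv[where t="1/2"] in auto)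
  then obtain k e where k: "\<And>j::nat. k j \<in> D" and e: "e \<in> L2 n"
    and lim: "(\<lambda>j. norm2 n (\<lambda>z. k j z - e z)) \<longlonglongrightarrow> 0"
    and min: "\<And>x. x \<in> D \<Longrightarrow> norm2 n e \<le> norm2 n x" by blast
  have kL2: "k j \<in> L2 n" for j using k D by blast
  have var: "(norm2 n e)\<^sup>2 \<le> Re (inner2 n x e)" if x: "x \<in> D" for x
  proof -
    have xL2: "x \<in> L2 n" using x D by blast
    define y where "y z = x z - e z" for z
    have y: "y \<in> L2 n" unfolding y_def by (intro L2_diff xL2 e)
    have ineq: "0 \<le> 2 * Re (inner2 n y e) + t * (norm2 n y)\<^sup>2" if t: "0 < t" "t \<le> 1" for t
    proof -
      \<comment> \<open>\<open>F j\<close> stays in the convex set \<open>D\<close>, while its limit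
        \<open>G\<close>, a point of the segment from \<open>e\<close> to \<open>x\<close>, need
        not. Minimality of \<open>e\<close> is compared with \<open>F j\<close> and passes to
        \<open>G\<close>.\<close>
      define F where "F j z = complex_of_real (1 - t) * k j z + complex_of_real t * x z" for j z
      define G where "G z = e z + complex_of_real t * y z" for z
      have F: "F j \<in> D" for j unfolding F_def using t by (intro conv k x) auto
      have GL2: "G \<in> L2 n" unfolding G_def by (intro L2_add L2_cmult e y)
      have "norm2 n (\<lambda>z. F j z - G z) = (1 - t) * norm2 n (\<lambda>z. k j z - e z)" for j
      proof -
        have "(\<lambda>z. F j z - G z) = (\<lambda>z. complex_of_real (1 - t) * (k j z - e z))"
          by (auto simp: F_def G_def y_def algebra_simps)
        then show ?thesis using t by (simp only: norm2_cmult norm_of_real)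
      qed
      then have "(\<lambda>j. norm2 n (\<lambda>z. F j z - G z)) \<longlonglongrightarrow> 0"
        using tendsto_mult_right_zero[OF lim, of "1 - t"] by simp
      from tendsto_norm2[OF _ GL2 this] F D have "(\<lambda>j. norm2 n (F j)) \<longlonglongrightarrow> norm2 n G" by blast
      then have "norm2 n e \<le> norm2 n G"
        by (rule LIMSEQ_le_const) (use min F in blast)
      then have "(norm2 n e)\<^sup>2 \<le> (norm2 n G)\<^sup>2" by (intro power_mono) auto
      also have "\<dots> = (norm2 n e)\<^sup>2 + 2 * (t * Re (inner2 n e y)) + t\<^sup>2 * (norm2 n y)\<^sup>2"
        unfolding G_def using norm2_add_sq[OF e L2_cmult[OF y, of "complex_of_real t"]]
        by (simp only: inner2_cmult_right norm2_cmult norm_of_real power_mult_distrib power2_abs) simp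
      finally have "0 \<le> t * (2 * Re (inner2 n e y) + t * (norm2 n y)\<^sup>2)"
        by (simp add: power2_eq_square algebra_simps)
      then have "0 \<le> 2 * Re (inner2 n e y) + t * (norm2 n y)\<^sup>2"
        using t by (simp add: zero_le_mult_iff)
      moreover have "Re (inner2 n y e) = Re (inner2 n e y)"
        by (subst inner2_commute) simp
      ultimately show ?thesis by simp
    qed
    \<comment> \<open>Letting \<open>t\<close> tend to \<open>0\<close> removes the quadratic
      term.\<close>
    have "((\<lambda>t. 2 * Re (inner2 n y e) + t * (norm2 n y)\<^sup>2) \<longlongrightarrow> 2 * Re (inner2 n y e) + 0 * (norm2 n y)\<^sup>2) (at_right 0)"
      by (intro tendsto_intros)
    then have "0 \<le> 2 * Re (inner2 n y e) + 0 * (norm2 n y)\<^sup>2"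
    proof (rule tendsto_lowerbound)
      show "\<forall>\<^sub>F t in at_right 0. 0 \<le> 2 * Re (inner2 n y e) + t * (norm2 n y)\<^sup>2"
        using ineq by (auto simp: eventually_at_right_field intro!: exI[of _ 1])
    qed simp
    then show ?thesis
      unfolding y_def inner2_diff_left[OF xL2 e e] by (simp add: inner2_self)
  qed
  have orth: "inner2 n v e = 0" if v: "v \<in> L2 n" and inv: "\<And>x c. x \<in> D \<Longrightarrow> (\<lambda>z. x z + c * v z) \<in> D" for v
  proof -
    define a where "a = inner2 n v e"
    have le: "(norm2 n e)\<^sup>2 \<le> Re (inner2 n (k j) e) - (cmod a)\<^sup>2" for j
    proof -
      \<comment> \<open>The multiple \<open>- cnj a\<close> is chosen so that the pairing with
        \<open>e\<close> drops by exactly \<open>(cmod a)\<^sup>2\<close>. In the limit the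
        variational inequality forbids this unless \<open>a = 0\<close>.\<close>
      have "(norm2 n e)\<^sup>2 \<le> Re (inner2 n (\<lambda>z. k j z + (- cnj a) * v z) e)"
        by (intro var inv k)
      also have "inner2 n (\<lambda>z. k j z + (- cnj a) * v z) e = inner2 n (k j) e - cnj a * a"
        unfolding inner2_add_left[OF kL2 L2_cmult[OF v] e] inner2_cmult_left a_def by simp
      also have "Re \<dots> = Re (inner2 n (k j) e) - (cmod a)\<^sup>2"
        unfolding cmod_power2 by (simp add: power2_eq_square)
      finally show ?thesis .
    qed
    have "(\<lambda>j. Re (inner2 n (k j) e) - (cmod a)\<^sup>2) \<longlonglongrightarrow> Re (inner2 n e e) - (cmod a)\<^sup>2"
      by (intro tendsto_diff tendsto_Re tendsto_const tendsto_inner2[OF kL2 e lim e])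
    then have "(norm2 n e)\<^sup>2 \<le> Re (inner2 n e e) - (cmod a)\<^sup>2"
      by (rule LIMSEQ_le_const) (use le in blast)
    then show ?thesis by (simp add: inner2_self a_def)
  qed
  show thesis
  proof (rule that[of k e])
    show "\<forall>v\<in>L2 n. (\<forall>x\<in>D. \<forall>c. (\<lambda>z. x z + c * v z) \<in> D) \<longrightarrow> inner2 n v e = 0"
      by (intro ballI impI orth) auto
  qed (use k e lim var in auto)
qed

text \<open>Closedness is not demanded because the notion is applied to spaces of trigonometric
  polynomials and to an algebraic span. Closures appear through explicit sequences.\<close>

definition L2_subspace :: "nat \<Rightarrow> tfun set \<Rightarrow> bool" where
  "L2_subspace n V \<longleftrightarrow> V \<subseteq> L2 n \<and> (\<lambda>z. 0) \<in> V \<and> (\<forall>f\<in>V. \<forall>g\<in>V. (\<lambda>z. f z + g z) \<in> V) \<and>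
     (\<forall>c. \<forall>f\<in>V. (\<lambda>z. c * f z) \<in> V)"

lemma L2_subspaceD:
  assumes "L2_subspace n V"
  shows "f \<in> V \<Longrightarrow> f \<in> L2 n" "(\<lambda>z. 0) \<in> V" "f \<in> V \<Longrightarrow> g \<in> V \<Longrightarrow> (\<lambda>z. f z + g z) \<in> V"
    "f \<in> V \<Longrightarrow> (\<lambda>z. c * f z) \<in> V" "f \<in> V \<Longrightarrow> g \<in> V \<Longrightarrow> (\<lambda>z. f z - g z) \<in> V"
proof -
  have V: "V \<subseteq> L2 n" "(\<lambda>z. 0) \<in> V" "\<forall>f\<in>V. \<forall>g\<in>V. (\<lambda>z. f z + g z) \<in> V"
    "\<forall>c. \<forall>f\<in>V. (\<lambda>z. c * f z) \<in> V"
    using assms unfolding L2_subspace_def by - (elim conjE; assumption)+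
  show "f \<in> V \<Longrightarrow> f \<in> L2 n" using V(1) by (rule subsetD)
  show "(\<lambda>z. 0) \<in> V" by (rule V(2))
  show add: "f \<in> V \<Longrightarrow> g \<in> V \<Longrightarrow> (\<lambda>z. f z + g z) \<in> V" for f g by (rule bspec[OF bspec[OF V(3)]])
  show mult: "f \<in> V \<Longrightarrow> (\<lambda>z. c * f z) \<in> V" for f c by (rule bspec[OF spec[OF V(4)]])
  show "(\<lambda>z. f z - g z) \<in> V" if "f \<in> V" "g \<in> V"
    using add[OF that(1) mult[OF that(2), of "-1"]] by simp
qed

text \<open>The residual \<open>f - p\<close> is the minimal-norm point for the affine set
  \<open>f - V\<close>. That set is invariant under translation by \<open>V\<close>, which yields
  the orthogonality. The sequence \<open>h\<close> records that \<open>p\<close> lies in the closure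
  of \<open>V\<close>.\<close>

lemma projection_closure:
  assumes V: "L2_subspace n V" and f: "f \<in> L2 n"
  obtains h p where "\<forall>j::nat. h j \<in> V" "p \<in> L2 n" "(\<lambda>j. norm2 n (\<lambda>z. h j z - p z)) \<longlonglongrightarrow> 0"
    "\<forall>v\<in>V. inner2 n (\<lambda>z. f z - p z) v = 0"
proof -
  define D where "D = {(\<lambda>z. f z - v z) | v. v \<in> V}"
  have D: "D \<subseteq> L2 n" using V f by (auto simp: D_def intro!: L2_diff dest: L2_subspaceD(1))
  have D_I: "x \<in> D" if "v \<in> V" "x = (\<lambda>z. f z - v z)" for x v
    using that by (auto simp: D_def)
  have ne: "D \<noteq> {}" using L2_subspaceD(2)[OF V] by (auto simp: D_def)
  have conv: "(\<lambda>z. complex_of_real (1 - t) * x z + complex_of_real t * y z) \<in> D"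
    if xy: "x \<in> D" "y \<in> D" and "0 \<le> t" "t \<le> 1" for x y t
  proof -
    from xy obtain v w where v: "v \<in> V" "x = (\<lambda>z. f z - v z)" and w: "w \<in> V" "y = (\<lambda>z. f z - w z)"
      by (auto simp: D_def)
    have "(\<lambda>z. complex_of_real (1 - t) * v z + complex_of_real t * w z) \<in> V"
      by (intro L2_subspaceD(3,4)[OF V] v w)
    moreover have "(\<lambda>z. complex_of_real (1 - t) * x z + complex_of_real t * y z)
        = (\<lambda>z. f z - (complex_of_real (1 - t) * v z + complex_of_real t * w z))"
      by (auto simp: v w algebra_simps)
    ultimately show ?thesis by (rule D_I)
  qed
  have inv: "(\<lambda>z. x z + c * v z) \<in> D" if "x \<in> D" "v \<in> V" for x v c
  proof -
    from that obtain w where w: "w \<in> V" "x = (\<lambda>z. f z - w z)" by (auto simp: D_def)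
    have "(\<lambda>z. w z - c * v z) \<in> V" by (intro L2_subspaceD(4,5)[OF V] w that)
    moreover have "(\<lambda>z. x z + c * v z) = (\<lambda>z. f z - (w z - c * v z))" by (auto simp: w)
    ultimately show ?thesis by (rule D_I)
  qed
  obtain k :: "nat \<Rightarrow> tfun" and e where k: "\<forall>j. k j \<in> D" and e: "e \<in> L2 n"
    and lim: "(\<lambda>j. norm2 n (\<lambda>z. k j z - e z)) \<longlonglongrightarrow> 0"
    and "\<forall>x\<in>D. (norm2 n e)\<^sup>2 \<le> Re (inner2 n x e)"
    and orth: "\<forall>v\<in>L2 n. (\<forall>x\<in>D. \<forall>c. (\<lambda>z. x z + c * v z) \<in> D) \<longrightarrow> inner2 n v e = 0"
  proof -
    show thesis by (rule min_norm_variational[OF D ne conv]; (rule that; assumption)?)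
  qed
  define h where "h j z = f z - k j z" for j z
  define p where "p z = f z - e z" for z
  show thesis
  proof (rule that[of h p])
    show "\<forall>j. h j \<in> V"
    proof
      fix j
      obtain v where "v \<in> V" "k j = (\<lambda>z. f z - v z)" using spec[OF k, of j] by (auto simp: D_def)
      then show "h j \<in> V" by (simp add: h_def[abs_def])
    qed
    show "p \<in> L2 n" unfolding p_def by (intro L2_diff f e)
    have "norm2 n (\<lambda>z. h j z - p z) = norm2 n (\<lambda>z. k j z - e z)" for j
      unfolding h_def p_def by (subst norm2_minus_commute) simp
    then show "(\<lambda>j. norm2 n (\<lambda>z. h j z - p z)) \<longlonglongrightarrow> 0" using lim by simp
    show "\<forall>v\<in>V. inner2 n (\<lambda>z. f z - p z) v = 0"
    proof
      fix v assume v: "v \<in> V"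
      have "inner2 n v e = 0" using bspec[OF orth L2_subspaceD(1)[OF V v]] inv[OF _ v] by blast
      then have "inner2 n e v = 0" by (subst inner2_commute) simp
      then show "inner2 n (\<lambda>z. f z - p z) v = 0" by (simp add: p_def)
    qed
  qed
qed

section \<open>Uniqueness of Fourier coefficients\<close>

text \<open>Pairing with \<open>monom_T\<close> instead of its conjugate only replaces
  \<open>k\<close> by \<open>- k\<close>, and saves conjugations when monomials are
  multiplied.\<close>

definition fourier_null :: "nat \<Rightarrow> tfun \<Rightarrow> bool" where
  "fourier_null n v \<longleftrightarrow> integrable (torus_measure n) v \<and>
     (\<forall>k. (\<integral>z. v z * monom_T n k z \<partial>torus_measure n) = 0)"

text \<open>The bounded functions that preserve \<^const>\<open>fourier_null\<close> form an algebra closed under bounded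
  pointwise limits; it contains the coordinates, hence all indicator functions.\<close>

definition null_multiplier :: "nat \<Rightarrow> tfun \<Rightarrow> bool" where
  "null_multiplier n g \<longleftrightarrow> g \<in> borel_measurable (torus_measure n) \<and>
     (\<exists>B. AE z in torus_measure n. cmod (g z) \<le> B) \<and>
     (\<forall>v. fourier_null n v \<longrightarrow> fourier_null n (\<lambda>z. v z * g z))"

lemma integrable_mult_bounded:
  fixes v g :: tfun
  assumes "integrable (torus_measure n) v" "g \<in> borel_measurable (torus_measure n)"
    "AE z in torus_measure n. cmod (g z) \<le> B"
  shows "integrable (torus_measure n) (\<lambda>z. v z * g z)"
proof (rule Bochner_Integration.integrable_bound)
  show "integrable (torus_measure n) (\<lambda>z. B * cmod (v z))" using assms by auto
  show "AE z in torus_measure n. norm (v z * g z) \<le> norm (B * cmod (v z))"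
    using assms(3)
  proof eventually_elim
    case (elim z)
    then have "cmod (v z) * cmod (g z) \<le> cmod (v z) * \<bar>B\<bar>" by (intro mult_left_mono) auto
    then show ?case by (simp add: norm_mult abs_mult mult.commute)
  qed
qed (use assms in measurable)

lemma integrable_mult_monom_T:
  "integrable (torus_measure n) v \<Longrightarrow> integrable (torus_measure n) (\<lambda>z. v z * monom_T n k z)"
  by (rule integrable_mult_bounded[OF _ measurable_monom_T AE_cmod_monom_T_le])

text \<open>Dominated convergence with dominating function \<open>B * |v|\<close>, which is why the
  bound has to be uniform in \<open>m\<close>. Applied to a constant sequence, it becomes a
  congruence rule for almost everywhere equality.\<close>

lemma null_multiplier_limit:
  assumes g: "\<And>m::nat. null_multiplier n (g m)" and h: "h \<in> borel_measurable (torus_measure n)"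
    and bd: "\<And>m. AE z in torus_measure n. cmod (g m z) \<le> B"
    and lim: "AE z in torus_measure n. (\<lambda>m. g m z) \<longlonglongrightarrow> h z"
  shows "null_multiplier n h"
proof -
  have [measurable]: "h \<in> borel_measurable (torus_measure n)" "g m \<in> borel_measurable (torus_measure n)" for m
    using g h by (auto simp: null_multiplier_def)
  have "AE z in torus_measure n. \<forall>m. cmod (g m z) \<le> B" using bd by (simp add: AE_all_countable)
  with lim have hB: "AE z in torus_measure n. cmod (h z) \<le> B"
    by eventually_elim (auto intro: LIMSEQ_le_const2[OF tendsto_norm])
  have "fourier_null n (\<lambda>z. v z * h z)" if v: "fourier_null n v" for v
  proof -
    have vi: "integrable (torus_measure n) v" using v by (simp add: fourier_null_def)
    then have [measurable]: "v \<in> borel_measurable (torus_measure n)" by auto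
    have "(\<integral>z. v z * h z * monom_T n k z \<partial>torus_measure n) = 0" for k
    proof -
      have "(\<lambda>m. \<integral>z. v z * g m z * monom_T n k z \<partial>torus_measure n)
          \<longlonglongrightarrow> (\<integral>z. v z * h z * monom_T n k z \<partial>torus_measure n)"
      proof (rule integral_dominated_convergence)
        show "integrable (torus_measure n) (\<lambda>z. cmod (v z) * B)" using vi by auto
        show "AE z in torus_measure n. (\<lambda>m. v z * g m z * monom_T n k z) \<longlonglongrightarrow> v z * h z * monom_T n k z"
          using lim by eventually_elim (intro tendsto_intros)
        show "AE z in torus_measure n. norm (v z * g m z * monom_T n k z) \<le> cmod (v z) * B" for m
          using bd[of m] AE_cmod_monom_T[of n k]
          by eventually_elim (simp add: norm_mult mult_left_mono)
      qed measurable
      moreover have "(\<integral>z. v z * g m z * monom_T n k z \<partial>torus_measure n) = 0" for m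
        using g[of m] v by (simp add: null_multiplier_def fourier_null_def)
      ultimately show ?thesis by (simp add: LIMSEQ_const_iff)
    qed
    with integrable_mult_bounded[OF vi h hB] show ?thesis by (simp add: fourier_null_def)
  qed
  with h hB show ?thesis by (auto simp: null_multiplier_def)
qed

lemma null_multiplier_cong_AE:
  assumes "null_multiplier n g" "h \<in> borel_measurable (torus_measure n)"
    "AE z in torus_measure n. g z = h z"
  shows "null_multiplier n h"
proof -
  obtain B where B: "AE z in torus_measure n. cmod (g z) \<le> B"
    using assms(1) by (auto simp: null_multiplier_def)
  show ?thesis
    by (rule null_multiplier_limit[where g="\<lambda>_. g"])
      (use assms B in \<open>auto elim: eventually_mono\<close>)
qed

lemma null_multiplier_mult:
  assumes "null_multiplier n f" "null_multiplier n g"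
  shows "null_multiplier n (\<lambda>z. f z * g z)"
proof -
  obtain A B where A: "AE z in torus_measure n. cmod (f z) \<le> A" and B: "AE z in torus_measure n. cmod (g z) \<le> B"
    using assms by (auto simp: null_multiplier_def)
  have "AE z in torus_measure n. cmod (f z * g z) \<le> \<bar>A\<bar> * \<bar>B\<bar>"
    using A B by eventually_elim (auto simp: norm_mult intro!: mult_mono)
  moreover have "fourier_null n (\<lambda>z. v z * (f z * g z))" if "fourier_null n v" for v
  proof -
    have "fourier_null n (\<lambda>z. v z * f z * g z)"
      using assms that unfolding null_multiplier_def by metis
    then show ?thesis by (simp add: mult.assoc)
  qed
  ultimately show ?thesis using assms by (auto simp: null_multiplier_def intro!: borel_measurable_times)
qed

lemma null_multiplier_add:
  assumes "null_multiplier n f" "null_multiplier n g"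
  shows "null_multiplier n (\<lambda>z. f z + g z)"
proof -
  obtain A B where A: "AE z in torus_measure n. cmod (f z) \<le> A" and B: "AE z in torus_measure n. cmod (g z) \<le> B"
    using assms by (auto simp: null_multiplier_def)
  have "AE z in torus_measure n. cmod (f z + g z) \<le> A + B"
    using A B by eventually_elim (meson add_mono norm_triangle_ineq order_trans)
  moreover have "fourier_null n (\<lambda>z. v z * (f z + g z))" if "fourier_null n v" for v
  proof -
    have *: "fourier_null n (\<lambda>z. v z * f z)" "fourier_null n (\<lambda>z. v z * g z)"
      using assms that by (auto simp: null_multiplier_def)
    then have "(\<integral>z. v z * f z * monom_T n k z + v z * g z * monom_T n k z \<partial>torus_measure n) = 0" for k
      by (subst Bochner_Integration.integral_add)
         (auto simp: fourier_null_def intro!: integrable_mult_monom_T)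
    with * show ?thesis
      by (auto simp: fourier_null_def algebra_simps)
  qed
  ultimately show ?thesis using assms by (auto simp: null_multiplier_def intro!: borel_measurable_add)
qed

lemma null_multiplier_const: "null_multiplier n (\<lambda>_. c)"
proof -
  have "(\<integral>z. v z * c * monom_T n k z \<partial>torus_measure n) = c * (\<integral>z. v z * monom_T n k z \<partial>torus_measure n)" for v k
    by (subst integral_mult_right_zero[symmetric]) (simp add: mult_ac)
  then show ?thesis
    by (auto simp: null_multiplier_def fourier_null_def intro!: exI[of _ "cmod c"])
qed

text \<open>Multiplication by a monomial shifts exponents, so the vanishing integrals are merely
  permuted.\<close>

lemma null_multiplier_monom_T: "null_multiplier n (monom_T n k)"
proof -
  have "fourier_null n (\<lambda>z. v z * monom_T n k z)" if v: "fourier_null n v" for v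
  proof -
    have vi: "integrable (torus_measure n) v" using v by (simp add: fourier_null_def)
    then have [measurable]: "v \<in> borel_measurable (torus_measure n)" by auto
    have "(\<integral>z. v z * monom_T n k z * monom_T n l z \<partial>torus_measure n)
        = (\<integral>z. v z * monom_T n (\<lambda>j. k j + l j) z \<partial>torus_measure n)" for l
    proof (rule integral_cong_AE)
      show "AE z in torus_measure n. v z * monom_T n k z * monom_T n l z = v z * monom_T n (\<lambda>j. k j + l j) z"
        using AE_torus[of n] by eventually_elim (simp add: monom_T_mult[symmetric])
    qed measurable
    with v integrable_mult_monom_T[OF vi] show ?thesis by (simp add: fourier_null_def)
  qed
  then show ?thesis using AE_cmod_monom_T_le[of n k] by (auto simp: null_multiplier_def)
qed

lemma monom_T_single: "i < n \<Longrightarrow> monom_T n (\<lambda>j. if j = i then 1 else 0) z = z i"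
proof -
  assume "i < n"
  then have "(\<Prod>j<n. z j powi (if j = i then 1 else 0)) = (\<Prod>j<n. if j = i then z j else 1)"
    by (intro prod.cong) auto
  with \<open>i < n\<close> show ?thesis by (simp add: monom_T_def)
qed

section \<open>From coordinates to indicator functions\<close>

lemma null_multiplier_coord:
  assumes "i < n"
  shows "null_multiplier n (\<lambda>z. z i)" "null_multiplier n (\<lambda>z. cnj (z i))"
proof -
  let ?k = "\<lambda>j. if j = i then 1 else 0 :: int"
  show *: "null_multiplier n (\<lambda>z. z i)"
    using null_multiplier_monom_T[of n ?k] monom_T_single[OF assms]
    by (simp add: null_multiplier_cong_AE[OF _ measurable_component_torus[OF assms]])
  show "null_multiplier n (\<lambda>z. cnj (z i))"
  proof (rule null_multiplier_cong_AE[OF null_multiplier_monom_T[of n "\<lambda>j. - ?k j"]])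
    show "AE z in torus_measure n. monom_T n (\<lambda>j. - ?k j) z = cnj (z i)"
      using AE_torus[of n]
    proof eventually_elim
      case (elim z)
      from cnj_monom_T[OF this, of ?k] show ?case unfolding monom_T_single[OF assms] by simp
    qed
    show "(\<lambda>z. cnj (z i)) \<in> borel_measurable (torus_measure n)"
      by (rule measurable_compose[OF measurable_component_torus[OF assms] measurable_cnj])
  qed
qed

text \<open>Polynomials in the two real coordinates of \<open>w\<close> are polynomials in
  \<open>w\<close> and \<open>cnj w\<close>, and on the circle the conjugate is the monomial with
  exponent \<open>-1\<close>.\<close>

lemma null_multiplier_real_poly:
  assumes i: "i < n" and "real_polynomial_function p"
  shows "null_multiplier n (\<lambda>z. complex_of_real (p (z i)))"
  using assms(2)
proof induction
  case (linear f)
  interpret bounded_linear f by fact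
  have rep: "f w = Re w * f 1 + Im w * f \<i>" for w
  proof -
    have "w = Re w *\<^sub>R 1 + Im w *\<^sub>R \<i>" by (simp add: complex_eq_iff)
    then have "f w = f (Re w *\<^sub>R 1 + Im w *\<^sub>R \<i>)" by simp
    then show ?thesis by (simp only: add scaleR real_scaleR_def)
  qed
  \<comment> \<open>Insert \<open>Re w = (w + cnj w) / 2\<close> and
    \<open>Im w = - \<i> * (w - cnj w) / 2\<close> into \<open>rep\<close>.\<close>
  have "complex_of_real (f w) = (of_real (f 1) / 2 - \<i> * of_real (f \<i>) / 2) * w
      + (of_real (f 1) / 2 + \<i> * of_real (f \<i>) / 2) * cnj w" for w
    unfolding rep[of w] by (simp add: complex_eq_iff algebra_simps)
  then have eq: "(\<lambda>z. complex_of_real (f (z i))) = (\<lambda>z. (of_real (f 1) / 2 - \<i> * of_real (f \<i>) / 2) * z i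
      + (of_real (f 1) / 2 + \<i> * of_real (f \<i>) / 2) * cnj (z i))"
    by (intro ext)
  show ?case
    unfolding eq by (intro null_multiplier_add null_multiplier_mult null_multiplier_const
        null_multiplier_coord i)
next
  case (const c) show ?case by (rule null_multiplier_const)
next
  case (add f g) then show ?case unfolding of_real_add by (intro null_multiplier_add)
next
  case (mult f g) then show ?case unfolding of_real_mult by (intro null_multiplier_mult)
qed

text \<open>Stone-Weierstrass on the unit circle suffices, since almost every point of the torus has
  all its coordinates there. Away from the circle the approximating polynomials are not
  controlled.\<close>

lemma null_multiplier_continuous:
  fixes f :: "complex \<Rightarrow> real"
  assumes i: "i < n" and f: "continuous_on UNIV f"
  shows "null_multiplier n (\<lambda>z. complex_of_real (f (z i)))"
proof -
  have "\<exists>p. real_polynomial_function p \<and> (\<forall>x\<in>sphere 0 1. \<bar>f x - p x\<bar> < inverse (real (Suc m)))" for m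
    using Stone_Weierstrass_real_polynomial_function[of "sphere 0 1" f "inverse (real (Suc m))"]
      continuous_on_subset[OF f] by (metis compact_sphere inverse_positive_iff_positive of_nat_0_less_iff subset_UNIV zero_less_Suc)
  then obtain p where p: "\<And>m. real_polynomial_function (p m)"
    "\<And>m x. x \<in> sphere 0 1 \<Longrightarrow> \<bar>f x - p m x\<bar> < inverse (real (Suc m))" by metis
  have "compact (f ` sphere 0 1)"
    by (intro compact_continuous_image continuous_on_subset[OF f]) auto
  then obtain B where B: "\<And>x. x \<in> sphere 0 1 \<Longrightarrow> \<bar>f x\<bar> \<le> B"
    using compact_imp_bounded[THEN bounded_pos[THEN iffD1]] by fastforce
  have bd: "\<bar>p m x\<bar> \<le> B + 1" if "x \<in> sphere 0 1" for m x
  proof -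
    have "inverse (real (Suc m)) \<le> 1" by (simp add: field_simps)
    then show ?thesis using p(2)[OF that, of m] B[OF that] by linarith
  qed
  show ?thesis
  proof (rule null_multiplier_limit[where g="\<lambda>m z. complex_of_real (p m (z i))" and B="B + 1"])
    show "null_multiplier n (\<lambda>z. complex_of_real (p m (z i)))" for m
      by (rule null_multiplier_real_poly[OF i p(1)])
    have [measurable]: "(\<lambda>z. f (z i)) \<in> borel_measurable (torus_measure n)"
      by (rule measurable_compose[OF measurable_component_torus[OF i] borel_measurable_continuous_onI[OF f]])
    show "(\<lambda>z. complex_of_real (f (z i))) \<in> borel_measurable (torus_measure n)"
      by measurable
    show "AE z in torus_measure n. cmod (complex_of_real (p m (z i))) \<le> B + 1" for m
      using AE_torus[of n] by eventually_elim (use i bd in auto)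
    show "AE z in torus_measure n. (\<lambda>m. complex_of_real (p m (z i))) \<longlonglongrightarrow> complex_of_real (f (z i))"
      using AE_torus[of n]
    proof eventually_elim
      case (elim z)
      then have *: "z i \<in> sphere 0 1" using i by auto
      have "(\<lambda>m. p m (z i) - f (z i)) \<longlonglongrightarrow> 0"
        by (rule Lim_null_comparison[OF always_eventually LIMSEQ_inverse_real_of_nat])
           (use p(2)[OF *] in \<open>auto simp: abs_minus_commute less_imp_le\<close>)
      then show ?case by (intro tendsto_of_real) (rule LIM_zero_cancel)
    qed
  qed
qed

text \<open>The tent functions \<open>max 0 (1 - m * infdist w C)\<close> are continuous and
  decrease to the indicator of a nonempty closed set. The empty set is treated apart because
  \<open>infdist\<close> to it is \<open>0\<close> by convention, which would give the constant
  \<open>1\<close>.\<close>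

lemma null_multiplier_closed:
  assumes i: "i < n" and C: "closed C"
  shows "null_multiplier n (\<lambda>z. indicator C (z i))"
proof (cases "C = {}")
  case True then show ?thesis using null_multiplier_const[of n 0] by simp
next
  case False
  show ?thesis
  proof (rule null_multiplier_limit[where B=1 and
        g="\<lambda>m z. complex_of_real (max 0 (1 - real m * infdist (z i) C))"])
    show "null_multiplier n (\<lambda>z. complex_of_real (max 0 (1 - real m * infdist (z i) C)))" for m
      by (rule null_multiplier_continuous[OF i]) (intro continuous_intros)
    have [measurable]: "C \<in> sets borel" using C by auto
    show "(\<lambda>z. indicator C (z i)) \<in> borel_measurable (torus_measure n)"
      by (intro measurable_compose[OF measurable_component_torus[OF i]]) measurable
    have "max 0 (1 - real m * infdist w C) \<le> 1" for m w by (simp add: infdist_nonneg)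
    then show "AE z in torus_measure n. cmod (complex_of_real (max 0 (1 - real m * infdist (z i) C))) \<le> 1" for m
      by simp
    have "(\<lambda>m. complex_of_real (max 0 (1 - real m * infdist w C))) \<longlonglongrightarrow> indicator C w" for w
    proof (cases "w \<in> C")
      case True then show ?thesis by simp
    next
      case w: False
      then have "infdist w C > 0" using C False by (simp add: infdist_pos_not_in_closed)
      then obtain M :: nat where M: "1 < real M * infdist w C" using reals_Archimedean3 by blast
      have "max 0 (1 - real m * infdist w C) = 0" if "m \<ge> M" for m
      proof -
        have "real M * infdist w C \<le> real m * infdist w C"
          using that by (intro mult_right_mono infdist_nonneg) simp
        with M show ?thesis by simp
      qed
      then show ?thesis using w
        by (intro tendsto_eventually) (auto simp: eventually_sequentially intro!: exI[of _ M])
    qed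
    then show "AE z in torus_measure n. (\<lambda>m. complex_of_real (max 0 (1 - real m * infdist (z i) C)))
        \<longlonglongrightarrow> indicator C (z i)" by simp
  qed
qed

lemma null_multiplier_diff:
  assumes "null_multiplier n f" "null_multiplier n g"
  shows "null_multiplier n (\<lambda>z. f z - g z)"
  using null_multiplier_add[OF assms(1) null_multiplier_mult[OF null_multiplier_const[of n "-1"] assms(2)]]
  by simp

lemma null_multiplier_compl:
  assumes "null_multiplier n (indicator A)" "A \<in> sets (torus_measure n)"
  shows "null_multiplier n (indicator (space (torus_measure n) - A))"
proof (rule null_multiplier_cong_AE[OF null_multiplier_diff[OF null_multiplier_const[of n 1] assms(1)]])
  show "indicator (space (torus_measure n) - A) \<in> borel_measurable (torus_measure n)"
    using assms(2) by measurable
  show "AE z in torus_measure n. 1 - indicator A z = (indicator (space (torus_measure n) - A) z :: complex)"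
    by (rule AE_I2) (auto simp: indicator_def)
qed

text \<open>The sets need not be disjoint: inclusion-exclusion expresses indicators of finite unions
  by sums and products, and the countable union is a bounded pointwise limit.\<close>

lemma null_multiplier_UN:
  fixes A :: "nat \<Rightarrow> _"
  assumes A: "\<And>i. null_multiplier n (indicator (A i))" "\<And>i. A i \<in> sets (torus_measure n)"
  shows "null_multiplier n (indicator (\<Union>i. A i))"
proof (rule null_multiplier_limit[where g="\<lambda>m. indicator (\<Union>i<m. A i)" and B=1])
  show "null_multiplier n (indicator (\<Union>i<m. A i))" for m
  proof (induction m)
    case 0 then show ?case using null_multiplier_const[of n 0] by simp
  next
    case (Suc m)
    have "(indicator (\<Union>i<Suc m. A i) :: tfun) = (\<lambda>z. indicator (\<Union>i<m. A i) z + indicator (A m) z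
        - indicator (\<Union>i<m. A i) z * indicator (A m) z)"
      by (auto simp: indicator_def fun_eq_iff less_Suc_eq)
    then show ?case
      by (simp only:) (intro null_multiplier_diff null_multiplier_add null_multiplier_mult Suc A)
  qed
  show "indicator (\<Union>i. A i) \<in> borel_measurable (torus_measure n)"
    using A(2) by measurable
  show "AE z in torus_measure n. (\<lambda>m. indicator (\<Union>i<m. A i) z) \<longlonglongrightarrow> (indicator (\<Union>i. A i) z :: complex)"
    by (rule AE_I2) (rule LIMSEQ_indicator_UN)
qed (auto simp: indicator_def)

text \<open>Two inductions over generated sigma-algebras: closed sets generate the Borel sets of one
  coordinate, and one-coordinate preimages generate the product. Since multipliers are closed under
  products, unions that are not disjoint cause no trouble and the generators need not be stable
  under intersection.\<close>

lemma null_multiplier_indicator: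
  assumes A: "A \<in> sets (torus_measure n)"
  shows "null_multiplier n (indicator A)"
proof -
  let ?pre = "\<lambda>i A. {z \<in> space (torus_measure n). z i \<in> A}"
  have pre_sets: "?pre i A \<in> sets (torus_measure n)" if "i < n" "A \<in> sets borel" for i A
    using measurable_sets[OF measurable_component_torus[OF that(1)] that(2)]
    by (simp add: vimage_def Int_def conj_commute)
  have pre: "null_multiplier n (indicator (?pre i A))" if i: "i < n" and A: "A \<in> sets borel" for i A
  proof -
    have "A \<in> sigma_sets UNIV {C::complex set. closed C}"
      using A by (subst (asm) borel_eq_closed) simp
    then show ?thesis
    proof (induction rule: sigma_sets.induct)
      case (Basic C)
      then have C: "closed C" by simp
      show ?case
      proof (rule null_multiplier_cong_AE[OF null_multiplier_closed[OF i C]])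
        show "indicator (?pre i C) \<in> borel_measurable (torus_measure n)"
          using pre_sets[OF i borel_closed[OF C]] by (rule borel_measurable_indicator)
      qed (rule AE_I2, simp add: indicator_def)
    next
      case Empty then show ?case using null_multiplier_const[of n 0] by simp
    next
      case (Compl C)
      then have "C \<in> sets borel" by (subst borel_eq_closed) simp
      moreover have "?pre i (UNIV - C) = space (torus_measure n) - ?pre i C" by auto
      ultimately show ?case
        using null_multiplier_compl[OF Compl.IH pre_sets[OF i]] by metis
    next
      case (Union a)
      then have a: "a j \<in> sets borel" for j by (subst borel_eq_closed) simp
      have "?pre i (\<Union>j. a j) = (\<Union>j. ?pre i (a j))" by auto
      then show ?case
        using null_multiplier_UN[of n "\<lambda>j. ?pre i (a j)", OF Union.IH pre_sets[OF i a]] by (simp only:)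
    qed
  qed
  let ?gen = "{{f \<in> \<Pi>\<^sub>E i\<in>{..<n}. space (borel :: complex measure). f i \<in> A} | i A. i \<in> {..<n} \<and> A \<in> sets (borel :: complex measure)}"
  have gen: "sets (torus_measure n) = sigma_sets (\<Pi>\<^sub>E i\<in>{..<n}. space borel) ?gen"
    unfolding sets_torus by (rule sets_PiM_single)
  have sp: "space (torus_measure n) = (\<Pi>\<^sub>E i\<in>{..<n}. space borel)"
    by (simp add: space_torus)
  have "A \<in> sigma_sets (\<Pi>\<^sub>E i\<in>{..<n}. space borel) ?gen" using A gen by simp
  then show ?thesis
  proof (induction rule: sigma_sets.induct)
    case (Basic C)
    then obtain i B where "i < n" "B \<in> sets borel" "C = ?pre i B" unfolding sp by auto
    then show ?case using pre by simp
  next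
    case Empty then show ?case using null_multiplier_const[of n 0] by simp
  next
    case (Compl C)
    then show ?case using null_multiplier_compl[OF Compl.IH] gen sp by simp
  next
    case (Union a)
    then show ?case by (intro null_multiplier_UN) (auto simp: gen)
  qed
qed

text \<open>The coefficient at exponent \<open>0\<close> of \<open>v\<close> times an indicator is
  the integral of \<open>v\<close> over that set, so \<open>v\<close> integrates to zero over every
  measurable set.\<close>

lemma fourier_null_AE_0:
  assumes "fourier_null n v" shows "AE z in torus_measure n. v z = 0"
proof (rule torus.density_zero)
  show "integrable (torus_measure n) v" using assms by (simp add: fourier_null_def)
  fix A assume "A \<in> sets (torus_measure n)"
  from null_multiplier_indicator[OF this] assms
  have "fourier_null n (\<lambda>z. v z * indicator A z)" by (simp add: null_multiplier_def)
  then have "(\<integral>z. v z * indicator A z * monom_T n (\<lambda>_. 0) z \<partial>torus_measure n) = 0"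
    by (simp add: fourier_null_def)
  moreover have "(\<lambda>z. v z * indicator A z * monom_T n (\<lambda>_. 0) z) = (\<lambda>z. indicator A z *\<^sub>R v z)"
    by (auto simp: monom_T_0 indicator_def)
  ultimately show "set_lebesgue_integral (torus_measure n) A v = 0"
    by (simp add: set_lebesgue_integral_def)
qed

theorem fourier_unique:
  assumes "integrable (torus_measure n) v" "\<And>k. fourier n v k = 0"
  shows "AE z in torus_measure n. v z = 0"
  by (rule fourier_null_AE_0)
     (use assms fourier_monom_neg[OF borel_measurable_integrable[OF assms(1)]] in \<open>auto simp: fourier_null_def\<close>)

section \<open>Trigonometric polynomials\<close>

text \<open>The sums run over an initial segment of \<open>nat\<close> and may repeat a monomial, so
  addition is concatenation and no normal form of the coefficients is needed.\<close>

definition trig_poly :: "nat \<Rightarrow> (nat \<Rightarrow> int) set \<Rightarrow> tfun set" where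
  "trig_poly n S = {p. \<exists>m c \<kappa>. (\<forall>i<m. \<kappa> i \<in> S) \<and> p = (\<lambda>z. \<Sum>i<(m::nat). c i * monom_T n (\<kappa> i) z)}"

lemma trig_polyE:
  assumes "p \<in> trig_poly n S"
  obtains m :: nat and c \<kappa> where "\<forall>i<m. \<kappa> i \<in> S" "p = (\<lambda>z. \<Sum>i<m. c i * monom_T n (\<kappa> i) z)"
  using assms unfolding trig_poly_def mem_Collect_eq by (elim exE conjE) (rule that)

lemma sum_lessThan_add:
  "(\<Sum>i<m + l. f i) = (\<Sum>i<m. f i) + (\<Sum>i<l. f (m + i))" for f :: "nat \<Rightarrow> complex"
  by (induction l) (auto simp: add.assoc)

lemma L2_sum:
  fixes m :: nat
  assumes "\<And>i. i < m \<Longrightarrow> f i \<in> L2 n" shows "(\<lambda>z. \<Sum>i<m. f i z) \<in> L2 n"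
  using assms
proof (induction m)
  case 0 then show ?case by (simp add: L2_zero)
next
  case (Suc m)
  have "(\<lambda>z. (\<Sum>i<m. f i z) + f m z) \<in> L2 n" by (intro L2_add Suc) auto
  then show ?case by simp
qed

lemma L2_subspace_trig_poly: "L2_subspace n (trig_poly n S)"
  unfolding L2_subspace_def
proof (intro conjI ballI allI)
  show "trig_poly n S \<subseteq> L2 n"
    by (auto simp: trig_poly_def intro!: L2_sum L2_cmult L2_monom_T)
  show "(\<lambda>z. 0) \<in> trig_poly n S"
    unfolding trig_poly_def mem_Collect_eq by (rule exI[of _ 0]) auto
next
  fix p q assume pq: "p \<in> trig_poly n S" "q \<in> trig_poly n S"
  from pq(1) obtain m :: nat and c \<kappa> where p: "\<forall>i<m. \<kappa> i \<in> S" "p = (\<lambda>z. \<Sum>i<m. c i * monom_T n (\<kappa> i) z)"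
    by (rule trig_polyE)
  from pq(2) obtain l :: nat and d \<kappa>' where q: "\<forall>i<l. \<kappa>' i \<in> S" "q = (\<lambda>z. \<Sum>i<l. d i * monom_T n (\<kappa>' i) z)"
    by (rule trig_polyE)
  let ?c = "\<lambda>i. if i < m then c i else d (i - m)" and ?k = "\<lambda>i. if i < m then \<kappa> i else \<kappa>' (i - m)"
  have "(\<lambda>z. p z + q z) = (\<lambda>z. \<Sum>i<m + l. ?c i * monom_T n (?k i) z)"
    unfolding p q sum_lessThan_add by simp
  moreover have "\<forall>i<m + l. ?k i \<in> S" using p q by auto
  ultimately show "(\<lambda>z. p z + q z) \<in> trig_poly n S"
    unfolding trig_poly_def mem_Collect_eq by (intro exI conjI)
next
  fix a p assume "p \<in> trig_poly n S"
  then obtain m :: nat and c \<kappa> where p: "\<forall>i<m. \<kappa> i \<in> S" "p = (\<lambda>z. \<Sum>i<m. c i * monom_T n (\<kappa> i) z)"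
    by (rule trig_polyE)
  have "(\<lambda>z. a * p z) = (\<lambda>z. \<Sum>i<m. (a * c i) * monom_T n (\<kappa> i) z)"
    unfolding p by (simp add: sum_distrib_left mult.assoc)
  with p(1) show "(\<lambda>z. a * p z) \<in> trig_poly n S"
    unfolding trig_poly_def mem_Collect_eq by (intro exI conjI)
qed

lemma monom_T_in_trig_poly: "k \<in> S \<Longrightarrow> monom_T n k \<in> trig_poly n S"
  unfolding trig_poly_def mem_Collect_eq
  by (intro exI[of _ 1] exI[of _ "\<lambda>_. 1"] exI[of _ "\<lambda>_. k"]) auto

lemma inner2_monom_T:
  "inner2 n (monom_T n k) (monom_T n l) = (if \<forall>j<n. k j = l j then 1 else 0)"
proof -
  have "inner2 n (monom_T n k) (monom_T n l) = (\<integral>z. monom_T n (\<lambda>j. k j + - l j) z \<partial>torus_measure n)"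
    unfolding inner2_def
  proof (rule integral_cong_AE)
    show "AE z in torus_measure n. monom_T n k z * cnj (monom_T n l z) = monom_T n (\<lambda>j. k j + - l j) z"
      using AE_torus[of n] by eventually_elim (simp only: cnj_monom_T monom_T_mult)
  qed measurable
  then show ?thesis by (simp add: integral_monom_T)
qed

lemma inner2_sum_left:
  fixes m :: nat
  assumes "\<And>i. i < m \<Longrightarrow> f i \<in> L2 n" "g \<in> L2 n"
  shows "inner2 n (\<lambda>z. \<Sum>i<m. c i * f i z) g = (\<Sum>i<m. c i * inner2 n (f i) g)"
  using assms(1)
proof (induction m)
  case 0 then show ?case by (simp add: inner2_def)
next
  case (Suc m)
  have "inner2 n (\<lambda>z. (\<Sum>i<m. c i * f i z) + c m * f m z) g
      = inner2 n (\<lambda>z. \<Sum>i<m. c i * f i z) g + c m * inner2 n (f m) g"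
    by (subst inner2_add_left) (auto intro!: L2_sum L2_cmult Suc assms(2) simp: inner2_cmult_left)
  with Suc show ?case by simp
qed

lemma fourier_inner2: "fourier n f k = inner2 n f (monom_T n k)"
  by (simp add: fourier_monom inner2_def)

lemma tendsto_inner2_right:
  assumes F: "\<And>j. F j \<in> L2 n" "f \<in> L2 n" "(\<lambda>j. norm2 n (\<lambda>z. F j z - f z)) \<longlonglongrightarrow> 0"
    and g: "g \<in> L2 n"
  shows "(\<lambda>j. inner2 n g (F j)) \<longlonglongrightarrow> inner2 n g f"
  unfolding inner2_commute[of n g] by (intro tendsto_cnj tendsto_inner2 F g)

text \<open>Project \<open>f\<close> onto the closure of the polynomials with exponents in
  \<open>S\<close>. The residual has no coefficient in \<open>S\<close> by orthogonality, and none
  outside \<open>S\<close> because neither \<open>f\<close> nor the approximants have any;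
  uniqueness makes it zero. The saturation of \<open>S\<close> keeps an exponent outside
  \<open>S\<close> from naming a monomial that occurs inside.\<close>

lemma trig_poly_dense:
  assumes f: "f \<in> L2 n" and S: "\<And>k l. \<forall>j<n. k j = l j \<Longrightarrow> k \<in> S \<Longrightarrow> l \<in> S"
    and supp: "\<And>k. k \<notin> S \<Longrightarrow> fourier n f k = 0"
  obtains h where "\<forall>j::nat. h j \<in> trig_poly n S" "(\<lambda>j. norm2 n (\<lambda>z. h j z - f z)) \<longlonglongrightarrow> 0"
proof -
  obtain h p where h: "\<forall>j::nat. h j \<in> trig_poly n S" and p: "p \<in> L2 n"
    and lim: "(\<lambda>j. norm2 n (\<lambda>z. h j z - p z)) \<longlonglongrightarrow> 0"
    and orth: "\<forall>v\<in>trig_poly n S. inner2 n (\<lambda>z. f z - p z) v = 0"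
  proof -
    show thesis by (rule projection_closure[OF L2_subspace_trig_poly[of n S] f]) (rule that)
  qed
  have hL2: "h j \<in> L2 n" for j using L2_subspaceD(1)[OF L2_subspace_trig_poly spec[OF h]] .
  have "fourier n (\<lambda>z. f z - p z) k = 0" for k
  proof (cases "k \<in> S")
    case True
    then show ?thesis unfolding fourier_inner2 by (intro bspec[OF orth] monom_T_in_trig_poly)
  next
    case False
    have "inner2 n (h j) (monom_T n k) = 0" for j
    proof -
      obtain m :: nat and c \<kappa> where hj: "\<forall>i<m. \<kappa> i \<in> S" "h j = (\<lambda>z. \<Sum>i<m. c i * monom_T n (\<kappa> i) z)"
        by (rule trig_polyE[OF spec[OF h, of j]])
      have "inner2 n (h j) (monom_T n k) = (\<Sum>i<m. c i * inner2 n (monom_T n (\<kappa> i)) (monom_T n k))"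
        unfolding hj(2) by (intro inner2_sum_left L2_monom_T)
      also have "\<dots> = 0"
      proof (rule sum.neutral, rule ballI)
        fix i assume i: "i \<in> {..<m}"
        then have "\<not> (\<forall>j<n. \<kappa> i j = k j)" using hj(1) S[of "\<kappa> i" k] False by blast
        then show "c i * inner2 n (monom_T n (\<kappa> i)) (monom_T n k) = 0"
          unfolding inner2_monom_T by (simp only: if_False mult_zero_right)
      qed
      finally show ?thesis .
    qed
    then have "inner2 n p (monom_T n k) = 0"
      using tendsto_inner2[OF hL2 p lim L2_monom_T[of n k]] by (simp add: LIMSEQ_const_iff)
    then show ?thesis
      using supp[OF False] unfolding fourier_inner2 by (simp add: inner2_diff_left[OF f p L2_monom_T])
  qed
  then have "AE z in torus_measure n. f z - p z = 0"
    by (intro fourier_unique L2_integrable L2_diff f p)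
  then have "AE z in torus_measure n. h j z - f z = h j z - p z" for j
    by eventually_elim simp
  then have "norm2 n (\<lambda>z. h j z - f z) = norm2 n (\<lambda>z. h j z - p z)" for j
    by (intro norm2_cong_AE L2_diff hL2 f p)
  with lim h show thesis by (intro that[of h]) simp_all
qed

section \<open>Extension of \<open>L\<^sup>1\<close>-bounded functionals\<close>

lemma norm1_triangle:
  assumes "f \<in> L2 n" "g \<in> L2 n"
  shows "norm1 n (\<lambda>z. f z + g z) \<le> norm1 n f + norm1 n g"
proof -
  have "norm1 n (\<lambda>z. f z + g z) \<le> (\<integral>z. cmod (f z) + cmod (g z) \<partial>torus_measure n)"
    unfolding norm1_def
    by (intro integral_mono integrable_norm Bochner_Integration.integrable_add L2_integrable assms norm_triangle_ineq)
  also have "\<dots> = norm1 n f + norm1 n g"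
    unfolding norm1_def by (intro Bochner_Integration.integral_add integrable_norm L2_integrable assms)
  finally show ?thesis .
qed

text \<open>The excess of \<open>|g|\<close> over \<open>1\<close> is pointwise at most
  \<open>|k j - g|\<close>, so its norm is bounded by quantities tending to
  \<open>0\<close>.\<close>

lemma AE_bounded_L2_limit:
  assumes k: "\<And>j. k j \<in> L2 n" "\<And>j. AE z in torus_measure n. cmod (k j z) \<le> 1"
    and g: "g \<in> L2 n" and lim: "(\<lambda>j. norm2 n (\<lambda>z. k j z - g z)) \<longlonglongrightarrow> 0"
  shows "AE z in torus_measure n. cmod (g z) \<le> 1"
proof -
  define u where "u z = complex_of_real (max 0 (cmod (g z) - 1))" for z
  have [measurable]: "g \<in> borel_measurable (torus_measure n)" using g by auto
  have u_meas: "u \<in> borel_measurable (torus_measure n)" unfolding u_def by measurable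
  have ug: "(cmod (u z))\<^sup>2 \<le> (cmod (g z))\<^sup>2" for z by (intro power_mono) (auto simp: u_def)
  have "integrable (torus_measure n) (\<lambda>z. (cmod (u z))\<^sup>2)"
    by (rule Bochner_Integration.integrable_bound[OF L2_integrable_sq[OF g]]) (use u_meas ug in auto)
  with u_meas have u: "u \<in> L2 n" by (simp add: L2_def)
  have "norm2 n u \<le> norm2 n (\<lambda>z. k j z - g z)" for j
    unfolding norm2_def
  proof (intro real_sqrt_le_mono integral_mono_AE L2_integrable_sq u L2_diff k(1) g)
    show "AE z in torus_measure n. (cmod (u z))\<^sup>2 \<le> (cmod (k j z - g z))\<^sup>2"
      using k(2)[of j]
    proof eventually_elim
      case (elim z)
      have "cmod (g z) \<le> cmod (k j z) + cmod (k j z - g z)"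
        by (metis add.commute norm_minus_commute norm_triangle_sub)
      with elim show ?case by (intro power_mono) (auto simp: u_def)
    qed
  qed
  then have "norm2 n u \<le> 0" by (intro LIMSEQ_le_const[OF lim]) blast
  then have "norm2 n u = 0" using norm2_nonneg[of n u] by linarith
  then have "AE z in torus_measure n. u z = 0" by (simp add: norm2_eq_0_iff[OF u])
  then show ?thesis by eventually_elim (simp add: u_def max_def split: if_splits)
qed

text \<open>Hahn--Banach together with \<open>(L\<^sup>1)\<^sup>* = L\<^sup>\<infinity>\<close>, carried out inside \<open>L\<^sup>2\<close>: the
  minimal-norm element \<open>e\<close> of the closure of \<open>K - \<psi> - V\<^sup>\<bottom>\<close>, where \<open>K\<close> is the unit ball of
  \<open>L\<^sup>\<infinity>\<close>, lies in the closure of \<open>V\<close>, and testing with \<open>-sgn e \<in> K\<close> gives \<open>e = 0\<close>.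
  Hence \<open>K\<close> comes arbitrarily close to \<open>\<psi> + V\<^sup>\<bottom>\<close>, and elements of smallest norm converge.\<close>

theorem L1_bounded_functional_representation:
  assumes V: "L2_subspace n V" and \<psi>: "\<psi> \<in> L2 n"
    and le: "\<And>h. h \<in> V \<Longrightarrow> cmod (inner2 n \<psi> h) \<le> norm1 n h"
  obtains \<phi> where "\<phi> \<in> L2 n" "AE z in torus_measure n. cmod (\<phi> z) \<le> 1"
    "\<forall>h\<in>V. inner2 n \<phi> h = inner2 n \<psi> h"
proof -
  define K where "K = {k \<in> L2 n. AE z in torus_measure n. cmod (k z) \<le> 1}"
  define P where "P = {v \<in> L2 n. \<forall>h\<in>V. inner2 n v h = 0}"
  \<comment> \<open>\<open>P\<close> is the annihilator of \<open>V\<close>. That \<open>0\<close>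
    lies in the closure of \<open>D\<close> therefore means that elements of \<open>K\<close> nearly
    solve \<open>inner2 n k h = inner2 n \<psi> h\<close> for all \<open>h\<close> in
    \<open>V\<close>.\<close>
  define D where "D = {(\<lambda>z. k z - \<psi> z - v z) | k v. k \<in> K \<and> v \<in> P}"
  have VL2: "h \<in> L2 n" if "h \<in> V" for h using L2_subspaceD(1)[OF V that] .
  have KL2: "k \<in> L2 n" if "k \<in> K" for k using that by (simp add: K_def)
  have PL2: "v \<in> L2 n" if "v \<in> P" for v using that by (simp add: P_def)
  have D_I: "x \<in> D" if "k \<in> K" "v \<in> P" "x = (\<lambda>z. k z - \<psi> z - v z)" for x k v
    using that by (auto simp: D_def)
  have D_L2: "D \<subseteq> L2 n"
  proof
    fix x assume "x \<in> D"
    then obtain k v where "k \<in> K" "v \<in> P" "x = (\<lambda>z. k z - \<psi> z - v z)" by (auto simp: D_def)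
    then show "x \<in> L2 n" by (simp only:) (intro L2_diff KL2 PL2 \<psi>)
  qed
  have K_conv: "(\<lambda>z. complex_of_real (1 - t) * f z + complex_of_real t * g z) \<in> K"
    if fg: "f \<in> K" "g \<in> K" and t: "0 \<le> t" "t \<le> 1" for f g t
  proof -
    have "AE z in torus_measure n. cmod (f z) \<le> 1" "AE z in torus_measure n. cmod (g z) \<le> 1"
      using fg by (auto simp: K_def)
    then have "AE z in torus_measure n. cmod (complex_of_real (1 - t) * f z + complex_of_real t * g z) \<le> 1"
    proof eventually_elim
      case (elim z)
      have "cmod (complex_of_real (1 - t) * f z + complex_of_real t * g z)
          \<le> cmod (complex_of_real (1 - t) * f z) + cmod (complex_of_real t * g z)" by (rule norm_triangle_ineq)
      also have "\<dots> = (1 - t) * cmod (f z) + t * cmod (g z)"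
        unfolding norm_mult norm_of_real using t by simp
      also have "\<dots> \<le> (1 - t) * 1 + t * 1" using elim t by (intro add_mono mult_left_mono) auto
      finally show ?case by simp
    qed
    moreover have "(\<lambda>z. complex_of_real (1 - t) * f z + complex_of_real t * g z) \<in> L2 n"
      by (intro L2_add L2_cmult KL2 fg)
    ultimately show ?thesis by (simp add: K_def)
  qed
  have P_add: "(\<lambda>z. a * v z + b * w z) \<in> P" if vw: "v \<in> P" "w \<in> P" for v w a b
  proof -
    have "inner2 n (\<lambda>z. a * v z + b * w z) h = 0" if "h \<in> V" for h
      using vw that by (simp add: inner2_add_left L2_cmult PL2 VL2 inner2_cmult_left) (simp add: P_def)
    moreover have "(\<lambda>z. a * v z + b * w z) \<in> L2 n" by (intro L2_add L2_cmult PL2 vw)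
    ultimately show ?thesis by (simp add: P_def)
  qed
  have K0: "(\<lambda>z. 0) \<in> K" by (simp add: K_def L2_zero)
  have P0: "(\<lambda>z. 0) \<in> P" by (simp add: P_def L2_zero inner2_def)
  have ne: "D \<noteq> {}" using D_I[OF K0 P0 refl] by blast
  have conv: "(\<lambda>z. complex_of_real (1 - t) * x z + complex_of_real t * y z) \<in> D"
    if xy: "x \<in> D" "y \<in> D" and t: "0 \<le> t" "t \<le> 1" for x y t
  proof -
    obtain k v where x: "k \<in> K" "v \<in> P" "x = (\<lambda>z. k z - \<psi> z - v z)" using xy(1) by (auto simp: D_def)
    obtain l w where y: "l \<in> K" "w \<in> P" "y = (\<lambda>z. l z - \<psi> z - w z)" using xy(2) by (auto simp: D_def)
    show ?thesis
      by (rule D_I[OF K_conv[OF x(1) y(1) t] P_add[OF x(2) y(2), of "complex_of_real (1 - t)" "complex_of_real t"]])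
         (auto simp: x(3) y(3) algebra_simps)
  qed
  obtain d :: "nat \<Rightarrow> tfun" and e where d: "\<forall>j. d j \<in> D" and e: "e \<in> L2 n"
    and lim: "(\<lambda>j. norm2 n (\<lambda>z. d j z - e z)) \<longlonglongrightarrow> 0"
    and var: "\<forall>x\<in>D. (norm2 n e)\<^sup>2 \<le> Re (inner2 n x e)"
    and orth: "\<forall>v\<in>L2 n. (\<forall>x\<in>D. \<forall>c. (\<lambda>z. x z + c * v z) \<in> D) \<longrightarrow> inner2 n v e = 0"
  proof -
    show thesis by (rule min_norm_variational[OF D_L2 ne conv]; (rule that; assumption)?)
  qed
  have orthP: "inner2 n v e = 0" if v: "v \<in> P" for v
  proof -
    have "(\<lambda>z. x z + c * v z) \<in> D" if x: "x \<in> D" for x c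
    proof -
      obtain k w where x: "k \<in> K" "w \<in> P" "x = (\<lambda>z. k z - \<psi> z - w z)" using x by (auto simp: D_def)
      show ?thesis by (rule D_I[OF x(1) P_add[OF x(2) v, of 1 "- c"]]) (auto simp: x(3))
    qed
    with bspec[OF orth PL2[OF v]] show ?thesis by blast
  qed
  obtain h p where h: "\<forall>j::nat. h j \<in> V" and p: "p \<in> L2 n"
    and hlim: "(\<lambda>j. norm2 n (\<lambda>z. h j z - p z)) \<longlonglongrightarrow> 0"
    and porth: "\<forall>v\<in>V. inner2 n (\<lambda>z. e z - p z) v = 0"
  proof -
    show thesis by (rule projection_closure[OF V e]) (rule that)
  qed
  note h = spec[OF h] and porth = bspec[OF porth]
  define r where "r z = e z - p z" for z
  have r: "r \<in> L2 n" unfolding r_def by (intro L2_diff e p)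
  have r_eq: "(\<lambda>z. e z - p z) = r" by (simp add: r_def[abs_def])
  note porth = porth[unfolded r_eq]
  \<comment> \<open>Both \<open>e\<close> and the limit \<open>p\<close> of elements of
    \<open>V\<close> are orthogonal to \<open>P\<close>. As \<open>r = e - p\<close> belongs to
    \<open>P\<close>, it is orthogonal to itself, so \<open>e\<close> is the limit of the
    \<open>h j\<close>.\<close>
  have "r \<in> P" using r porth unfolding P_def by blast
  then have "inner2 n r e = 0" by (rule orthP)
  moreover have "inner2 n r p = 0"
    using tendsto_inner2_right[OF VL2[OF h] p hlim r] porth[OF h] by (simp add: LIMSEQ_const_iff)
  moreover have "inner2 n r r = inner2 n r e - inner2 n r p"
    using inner2_diff_right[OF e p r] unfolding r_eq .
  ultimately have "norm2 n r = 0" by (simp add: inner2_self)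
  then have "AE z in torus_measure n. r z = 0" by (simp add: norm2_eq_0_iff[OF r])
  then have "AE z in torus_measure n. h j z - e z = h j z - p z" for j
    by eventually_elim (simp add: r_def)
  then have "norm2 n (\<lambda>z. h j z - e z) = norm2 n (\<lambda>z. h j z - p z)" for j
    by (intro norm2_cong_AE L2_diff VL2 h e p)
  with hlim have hlim: "(\<lambda>j. norm2 n (\<lambda>z. h j z - e z)) \<longlonglongrightarrow> 0" by simp
  \<comment> \<open>The assumed bound is available on \<open>V\<close> only. It passes to
    \<open>e\<close> because convergence in \<open>norm2\<close> controls
    \<open>norm1\<close>.\<close>
  have le_e: "cmod (inner2 n \<psi> e) \<le> norm1 n e"
  proof (rule LIMSEQ_le)
    show "(\<lambda>j. cmod (inner2 n \<psi> (h j))) \<longlonglongrightarrow> cmod (inner2 n \<psi> e)"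
      by (intro tendsto_norm tendsto_inner2_right VL2 h e hlim \<psi>)
    show "(\<lambda>j. norm2 n (\<lambda>z. h j z - e z) + norm1 n e) \<longlonglongrightarrow> norm1 n e"
      using tendsto_add[OF hlim tendsto_const[of "norm1 n e"]] by simp
    have "cmod (inner2 n \<psi> (h j)) \<le> norm2 n (\<lambda>z. h j z - e z) + norm1 n e" for j
      using le[OF h, of j] norm1_triangle[OF L2_diff[OF VL2[OF h] e] e, of j]
        norm1_le_norm2[OF L2_diff[OF VL2[OF h] e], of j] by simp
    then show "\<exists>N. \<forall>j\<ge>N. cmod (inner2 n \<psi> (h j)) \<le> norm2 n (\<lambda>z. h j z - e z) + norm1 n e" by blast
  qed
  define s where "s z = - sgn (e z)" for z
  have [measurable]: "e \<in> borel_measurable (torus_measure n)" using e by auto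
  have s_meas: "s \<in> borel_measurable (torus_measure n)" unfolding s_def sgn_div_norm by measurable
  have s1: "AE z in torus_measure n. cmod (s z) \<le> 1" by (simp add: s_def norm_sgn)
  have s: "s \<in> L2 n" by (rule L2_bounded[OF s_meas s1])
  have "s \<in> K" using s s1 by (simp add: K_def)
  have "(\<lambda>z. s z - \<psi> z) \<in> D" by (rule D_I[OF \<open>s \<in> K\<close> P0]) simp
  with var have "(norm2 n e)\<^sup>2 \<le> Re (inner2 n (\<lambda>z. s z - \<psi> z) e)" by blast
  also have "\<dots> = Re (inner2 n s e) - Re (inner2 n \<psi> e)"
    by (simp add: inner2_diff_left[OF s \<psi> e])
  also have "inner2 n s e = - complex_of_real (norm1 n e)"
  proof -
    have "s z * cnj (e z) = - complex_of_real (cmod (e z))" for z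
    proof (cases "e z = 0")
      case False
      have "s z * cnj (e z) = - (e z * cnj (e z)) / complex_of_real (cmod (e z))"
        by (simp add: s_def sgn_eq)
      also have "e z * cnj (e z) = complex_of_real (cmod (e z)) * complex_of_real (cmod (e z))"
        by (simp add: complex_norm_square[symmetric] power2_eq_square[symmetric])
      finally show ?thesis using False by simp
    qed (simp add: s_def)
    then show ?thesis unfolding inner2_def norm1_def by simp
  qed
  also have "Re (- complex_of_real (norm1 n e)) - Re (inner2 n \<psi> e) \<le> 0"
    using le_e abs_Re_le_cmod[of "inner2 n \<psi> e"] by simp
  finally have "norm2 n e = 0" by simp
  then have "AE z in torus_measure n. e z = 0" by (simp add: norm2_eq_0_iff[OF e])
  then have "AE z in torus_measure n. d j z - e z = d j z" for j by eventually_elim simp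
  then have "norm2 n (\<lambda>z. d j z - e z) = norm2 n (d j)" for j
    using d D_L2 by (intro norm2_cong_AE L2_diff e) auto
  with lim have dlim: "(\<lambda>j. norm2 n (d j)) \<longlonglongrightarrow> 0" by simp
  \<comment> \<open>The elements of \<open>K\<close> inside \<open>d\<close> need not converge; only
    the differences \<open>k - \<psi> - v\<close> do. \<open>C j\<close> keeps just the effect on
    \<open>V\<close>, with tolerance \<open>1 / (j + 1)\<close>. These sets are convex and
    decreasing, and all their elements have norm at most \<open>1\<close>.\<close>
  define C where "C j = {k \<in> K. \<forall>h\<in>V. cmod (inner2 n (\<lambda>z. k z - \<psi> z) h) \<le> inverse (real (Suc j)) * norm2 n h}" for j
  have K_norm: "norm2 n k \<le> 1" if "k \<in> K" for k
  proof -
    have "norm2 n k = norm2 n (\<lambda>z. k z * 1)" by simp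
    also have "\<dots> \<le> norm2 n (\<lambda>z. 1)"
      using that by (intro norm2_mult_bounded_le L2_const) (auto simp: K_def)
    finally show ?thesis by (simp add: norm2_def torus.prob_space)
  qed
  have C_ne: "\<exists>k\<in>C j. norm2 n k \<le> 1" for j
  proof -
    obtain i where i: "norm2 n (d i) < inverse (real (Suc j))"
      using LIMSEQ_D[OF dlim, of "inverse (real (Suc j))"] by force
    obtain k v where k: "k \<in> K" "v \<in> P" "d i = (\<lambda>z. k z - \<psi> z - v z)" using spec[OF d, of i] by (auto simp: D_def)
    have "cmod (inner2 n (\<lambda>z. k z - \<psi> z) g) \<le> inverse (real (Suc j)) * norm2 n g" if g: "g \<in> V" for g
    proof -
      have "inner2 n (d i) g = inner2 n (\<lambda>z. k z - \<psi> z) g - inner2 n v g"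
        unfolding k(3) by (intro inner2_diff_left L2_diff KL2 PL2 VL2 k \<psi> g)
      also have "inner2 n v g = 0" using k(2) g by (simp add: P_def)
      finally have "cmod (inner2 n (\<lambda>z. k z - \<psi> z) g) = cmod (inner2 n (d i) g)" by simp
      also have "\<dots> \<le> norm2 n (d i) * norm2 n g"
        by (rule cmod_inner2_le[OF subsetD[OF D_L2 spec[OF d]] VL2[OF g]])
      also have "\<dots> \<le> inverse (real (Suc j)) * norm2 n g"
        using i by (intro mult_right_mono) auto
      finally show ?thesis .
    qed
    then have "k \<in> C j" using k(1) by (simp add: C_def)
    with K_norm[OF k(1)] show ?thesis by blast
  qed
  have "\<exists>k g. (\<forall>j. k j \<in> C j) \<and> g \<in> L2 n \<and> (\<lambda>j. norm2 n (\<lambda>z. k j z - g z)) \<longlonglongrightarrow> 0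
     \<and> (\<forall>x. (\<forall>j. x \<in> C j) \<longrightarrow> norm2 n g \<le> norm2 n x)"
  proof (rule nested_convex_converge[OF _ _ _ C_ne])
    show "C j \<subseteq> L2 n" for j by (auto simp: C_def K_def)
    show "C j \<subseteq> C i" if "i \<le> j" for i j
    proof
      fix k assume k: "k \<in> C j"
      have "inverse (real (Suc j)) \<le> inverse (real (Suc i))" using that by (simp add: field_simps)
      then have "inverse (real (Suc j)) * norm2 n h \<le> inverse (real (Suc i)) * norm2 n h" for h
        by (intro mult_right_mono) auto
      with k show "k \<in> C i" unfolding C_def by (auto intro: order_trans)
    qed
    fix j f g assume f: "f \<in> C j" and g: "g \<in> C j"
    have fgK: "f \<in> K" "g \<in> K" using f g by (auto simp: C_def)
    have "cmod (inner2 n (\<lambda>z. (1/2 * f z + 1/2 * g z) - \<psi> z) h) \<le> inverse (real (Suc j)) * norm2 n h"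
      if hV: "h \<in> V" for h
    proof -
      have "(\<lambda>z. (1/2 * f z + 1/2 * g z) - \<psi> z) = (\<lambda>z. 1/2 * (f z - \<psi> z) + 1/2 * (g z - \<psi> z))"
        by (auto simp: field_simps)
      then have "inner2 n (\<lambda>z. (1/2 * f z + 1/2 * g z) - \<psi> z) h
          = 1/2 * inner2 n (\<lambda>z. f z - \<psi> z) h + 1/2 * inner2 n (\<lambda>z. g z - \<psi> z) h"
        by (simp only:) (subst inner2_add_left; (simp only: inner2_cmult_left)?; intro L2_cmult L2_diff KL2 VL2 fgK \<psi> hV)
      also have "cmod \<dots> \<le> 1/2 * cmod (inner2 n (\<lambda>z. f z - \<psi> z) h) + 1/2 * cmod (inner2 n (\<lambda>z. g z - \<psi> z) h)"
        by (rule norm_triangle_le) (simp add: norm_mult norm_divide)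
      also have "\<dots> \<le> 1/2 * (inverse (real (Suc j)) * norm2 n h) + 1/2 * (inverse (real (Suc j)) * norm2 n h)"
        using f g hV unfolding C_def by (intro add_mono mult_left_mono) auto
      finally show ?thesis by (simp add: mult.commute)
    qed
    moreover have "(\<lambda>z. 1/2 * f z + 1/2 * g z) \<in> K" using K_conv[OF fgK, of "1/2"] by simp
    ultimately show "(\<lambda>z. 1/2 * f z + 1/2 * g z) \<in> C j" by (simp add: C_def)
  qed
  then obtain k \<phi> where k: "\<And>j. k j \<in> C j" and \<phi>: "\<phi> \<in> L2 n"
    and klim: "(\<lambda>j. norm2 n (\<lambda>z. k j z - \<phi> z)) \<longlonglongrightarrow> 0" by blast
  have kK: "k j \<in> K" for j using k[of j] by (simp add: C_def)
  show thesis
  proof (rule that[of \<phi>])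
    show "\<phi> \<in> L2 n" by (rule \<phi>)
    show "AE z in torus_measure n. cmod (\<phi> z) \<le> 1"
      by (rule AE_bounded_L2_limit[OF KL2[OF kK] _ \<phi> klim]) (use kK in \<open>simp add: K_def\<close>)
    show "\<forall>g\<in>V. inner2 n \<phi> g = inner2 n \<psi> g"
    proof
      fix g assume g: "g \<in> V"
      have "(\<lambda>j. inner2 n (k j) g - inner2 n \<psi> g) \<longlonglongrightarrow> inner2 n \<phi> g - inner2 n \<psi> g"
        by (intro tendsto_diff tendsto_const tendsto_inner2 KL2 kK \<phi> klim VL2 g)
      moreover have "(\<lambda>j. inner2 n (k j) g - inner2 n \<psi> g) \<longlonglongrightarrow> 0"
      proof (rule Lim_null_comparison[OF always_eventually])
        show "(\<lambda>j. inverse (real (Suc j)) * norm2 n g) \<longlonglongrightarrow> 0"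
          by (rule tendsto_mult_left_zero[OF LIMSEQ_inverse_real_of_nat])
        show "\<forall>j. norm (inner2 n (k j) g - inner2 n \<psi> g) \<le> inverse (real (Suc j)) * norm2 n g"
          using k g unfolding C_def by (simp add: inner2_diff_left[OF KL2[OF kK] \<psi> VL2[OF g], symmetric])
      qed
      ultimately show "inner2 n \<phi> g = inner2 n \<psi> g" using LIMSEQ_unique by fastforce
    qed
  qed
qed

section \<open>Integrals against bounded functions\<close>

lemma L2_monom_T_mult: "f \<in> L2 n \<Longrightarrow> (\<lambda>z. monom_T n k z * f z) \<in> L2 n"
  by (intro L2_mult_bounded measurable_monom_T AE_cmod_monom_T_le)

lemma tendsto_inner2_both:
  assumes F: "\<And>j. F j \<in> L2 n" "f \<in> L2 n" "(\<lambda>j. norm2 n (\<lambda>z. F j z - f z)) \<longlonglongrightarrow> 0"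
    and G: "\<And>j. G j \<in> L2 n" "g \<in> L2 n" "(\<lambda>j. norm2 n (\<lambda>z. G j z - g z)) \<longlonglongrightarrow> 0"
  shows "(\<lambda>j. inner2 n (F j) (G j)) \<longlonglongrightarrow> inner2 n f g"
proof -
  have lim: "(\<lambda>j. norm2 n (\<lambda>z. F j z - f z) * norm2 n (G j)) \<longlonglongrightarrow> 0"
    using tendsto_mult[OF F(3) tendsto_norm2[OF G]] by simp
  have le: "\<forall>j. norm (inner2 n (F j) (G j) - inner2 n f (G j)) \<le> norm2 n (\<lambda>z. F j z - f z) * norm2 n (G j)"
    unfolding inner2_diff_left[OF F(1,2) G(1), symmetric]
    by (intro allI cmod_inner2_le L2_diff F(1,2) G)
  have "(\<lambda>j. inner2 n (F j) (G j) - inner2 n f (G j)) \<longlonglongrightarrow> 0"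
    by (rule Lim_null_comparison[OF always_eventually[OF le] lim])
  from tendsto_add[OF this tendsto_inner2_right[OF G F(2)]] show ?thesis by simp
qed

text \<open>By continuity of \<open>cis\<close> at \<open>0\<close> the ball contains the image of a
  short interval starting there. Its length \<open>b\<close> is cut off at \<open>2*pi\<close> to
  stay inside the interval that carries the uniform measure.\<close>

lemma circle_ball_pos:
  assumes "\<delta> > 0" shows "0 < emeasure circle_measure (ball 1 \<delta>)"
proof -
  have "continuous_on UNIV cis" by (intro continuous_intros)
  then have "isCont cis 0" by (simp add: continuous_on_eq_continuous_at)
  then obtain \<eta> where \<eta>: "\<eta> > 0" "\<And>x. \<bar>x\<bar> < \<eta> \<Longrightarrow> dist (cis x) 1 < \<delta>"
    using assms by (auto simp: continuous_at_eps_delta dist_norm)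
  define b where "b = min \<eta> (2*pi)"
  have b: "0 < b" using \<eta>(1) by (simp add: b_def)
  have sub: "{0<..<b} \<subseteq> {0..2*pi} \<inter> cis -` ball 1 \<delta>"
    using \<eta>(2) by (auto simp: b_def dist_commute)
  have m: "cis -` ball 1 \<delta> \<in> sets borel"
    using measurable_sets[OF measurable_cis, of "ball 1 \<delta>"] by simp
  have "0 < ennreal b" using b by simp
  also have "ennreal b = emeasure lborel {0<..<b}" using b by simp
  also have "\<dots> \<le> emeasure lborel ({0..2*pi} \<inter> cis -` ball 1 \<delta>)"
    using m by (intro emeasure_mono sub) auto
  finally have "0 < emeasure lborel ({0..2*pi} \<inter> cis -` ball 1 \<delta>) / emeasure lborel {0..2*pi}"
    by (simp add: ennreal_zero_less_divide)
  also have "\<dots> = emeasure circle_measure (ball 1 \<delta>)"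
    unfolding circle_measure_def using m
    by (subst emeasure_distr) (auto simp: uniform_measure_def[symmetric] emeasure_uniform_measure space_uniform_measure)
  finally show ?thesis .
qed

text \<open>A product of balls around \<open>1\<close> has positive measure, so an almost sure
  property cannot fail throughout it. Together with continuity this carries almost sure statements
  to the identity of the torus, a point that may itself be null.\<close>

lemma AE_torus_near_1:
  assumes "AE w in torus_measure n. Q w" and "\<delta> > 0"
  obtains w where "Q w" "\<forall>j<n. dist (w j) 1 < \<delta>"
proof -
  interpret product_sigma_finite "\<lambda>_::nat. circle_measure"
    by (rule product_sigma_finite_circle)
  let ?B = "PiE {..<n} (\<lambda>_. ball (1::complex) \<delta>)"
  have "emeasure (torus_measure n) ?B = (\<Prod>j<n. emeasure circle_measure (ball 1 \<delta>))"
    unfolding torus_measure_def by (rule emeasure_PiM) auto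
  also have "\<dots> \<noteq> 0" using circle_ball_pos[OF assms(2)] by simp
  finally have pos: "emeasure (torus_measure n) ?B \<noteq> 0" .
  have B: "?B \<in> sets (torus_measure n)"
    unfolding torus_measure_def by (intro sets_PiM_I_finite) auto
  have "\<exists>w\<in>?B. Q w"
  proof (rule ccontr)
    assume "\<not> (\<exists>w\<in>?B. Q w)"
    with assms(1) have "AE w in torus_measure n. w \<notin> ?B"
      by (auto elim!: eventually_mono)
    then have "emeasure (torus_measure n) ?B = 0"
      using B by (subst (asm) AE_iff_measurable[of ?B]) (auto simp: space_torus PiE_def)
    with pos show False by simp
  qed
  then obtain w where w: "w \<in> ?B" "Q w" by blast
  show thesis
  proof (rule that[of w])
    show "\<forall>j<n. dist (w j) 1 < \<delta>" using w(1) by (auto simp: PiE_def Pi_def dist_commute)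
  qed (rule w(2))
qed

section \<open>Rotations of trigonometric polynomials\<close>

lemma trig_poly_scale:
  assumes "p \<in> trig_poly n S" shows "(\<lambda>z. p (\<lambda>j. w j * z j)) \<in> trig_poly n S"
proof -
  obtain m :: nat and c \<kappa> where p: "\<forall>i<m. \<kappa> i \<in> S" "p = (\<lambda>z. \<Sum>i<m. c i * monom_T n (\<kappa> i) z)"
    by (rule trig_polyE[OF assms])
  have "(\<lambda>z. p (\<lambda>j. w j * z j)) = (\<lambda>z. \<Sum>i<m. (c i * monom_T n (\<kappa> i) w) * monom_T n (\<kappa> i) z)"
    unfolding p monom_T_scale by (simp add: mult.assoc)
  with p(1) show ?thesis unfolding trig_poly_def mem_Collect_eq by (intro exI conjI)
qed

lemma inner2_sum_right:
  fixes m :: nat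
  assumes "\<And>i. i < m \<Longrightarrow> f i \<in> L2 n" "g \<in> L2 n"
  shows "inner2 n g (\<lambda>z. \<Sum>i<m. c i * f i z) = (\<Sum>i<m. cnj (c i) * inner2 n g (f i))"
proof -
  have "inner2 n g (\<lambda>z. \<Sum>i<m. c i * f i z) = cnj (\<Sum>i<m. c i * inner2 n (f i) g)"
    by (subst inner2_commute) (simp add: inner2_sum_left[OF assms])
  also have "\<dots> = (\<Sum>i<m. cnj (c i) * inner2 n g (f i))"
    by (simp add: inner2_commute[of n g])
  finally show ?thesis .
qed

text \<open>Rotation multiplies each coefficient by the value of its monomial at \<open>w\<close>.
  Terms with different exponents are orthogonal, and for equal exponents this unimodular factor
  meets its own conjugate and cancels.\<close>

lemma norm2_scale:
  assumes "p \<in> trig_poly n S" and w: "\<forall>j<n. cmod (w j) = 1"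
  shows "norm2 n (\<lambda>z. p (\<lambda>j. w j * z j)) = norm2 n p"
proof -
  obtain m :: nat and c \<kappa> where p: "\<forall>i<m. \<kappa> i \<in> S" "p = (\<lambda>z. \<Sum>i<m. c i * monom_T n (\<kappa> i) z)"
    by (rule trig_polyE[OF assms(1)])
  have self: "inner2 n (\<lambda>z. \<Sum>i<m. a i * monom_T n (\<kappa> i) z) (\<lambda>z. \<Sum>i<m. a i * monom_T n (\<kappa> i) z)
      = (\<Sum>i<m. \<Sum>l<m. (a i * cnj (a l)) * inner2 n (monom_T n (\<kappa> i)) (monom_T n (\<kappa> l)))" for a
  proof -
    have L: "(\<lambda>z. \<Sum>i<m. a i * monom_T n (\<kappa> i) z) \<in> L2 n" by (intro L2_sum L2_cmult L2_monom_T)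
    show ?thesis
      by (subst inner2_sum_left[OF L2_monom_T L], subst inner2_sum_right[OF L2_monom_T L2_monom_T])
         (simp add: sum_distrib_left mult.assoc)
  qed
  have eq: "(\<lambda>z. p (\<lambda>j. w j * z j)) = (\<lambda>z. \<Sum>i<m. (c i * monom_T n (\<kappa> i) w) * monom_T n (\<kappa> i) z)"
    unfolding p monom_T_scale by (simp add: mult.assoc)
  have "inner2 n (\<lambda>z. p (\<lambda>j. w j * z j)) (\<lambda>z. p (\<lambda>j. w j * z j)) = inner2 n p p"
    unfolding eq unfolding p(2) self
  proof (intro sum.cong refl)
    fix i l
    show "c i * monom_T n (\<kappa> i) w * cnj (c l * monom_T n (\<kappa> l) w) * inner2 n (monom_T n (\<kappa> i)) (monom_T n (\<kappa> l))
        = c i * cnj (c l) * inner2 n (monom_T n (\<kappa> i)) (monom_T n (\<kappa> l))"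
    proof (cases "\<forall>j<n. \<kappa> i j = \<kappa> l j")
      case True
      then have "monom_T n (\<kappa> l) = monom_T n (\<kappa> i)" by (intro monom_T_cong) simp
      moreover have "monom_T n (\<kappa> i) w * cnj (monom_T n (\<kappa> i) w) = 1"
        by (simp add: complex_norm_square[symmetric] cmod_monom_T[OF w])
      ultimately show ?thesis by (simp add: mult_ac)
    next
      case False
      then have "inner2 n (monom_T n (\<kappa> i)) (monom_T n (\<kappa> l)) = 0"
        unfolding inner2_monom_T by (simp only: if_False)
      then show ?thesis by simp
    qed
  qed
  then have "complex_of_real ((norm2 n (\<lambda>z. p (\<lambda>j. w j * z j)))\<^sup>2) = complex_of_real ((norm2 n p)\<^sup>2)"
    by (simp only: inner2_self)
  then have "(norm2 n (\<lambda>z. p (\<lambda>j. w j * z j)))\<^sup>2 = (norm2 n p)\<^sup>2" by (simp only: of_real_eq_iff)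
  then show ?thesis by (simp add: power2_eq_iff_nonneg)
qed

text \<open>Under rotation the product of one monomial and the conjugate of another picks up the
  monomial in \<open>w\<close> whose exponent is the difference \<open>\<delta>\<close>, so the
  pairing is a polynomial in \<open>w\<close>. Its coefficient at \<open>k\<close> collects the
  pairs with difference \<open>k\<close>, and all of these involve the same Fourier coefficient of
  \<open>\<phi>\<close>, the one at \<open>- k\<close>. Hence the factorisation on which the
  vanishing argument rests.\<close>

lemma rotated_form_trig_poly:
  assumes p: "p \<in> trig_poly n UNIV" and q: "q \<in> trig_poly n UNIV"
    and \<phi>: "\<phi> \<in> borel_measurable (torus_measure n)" "AE z in torus_measure n. cmod (\<phi> z) \<le> 1"
  obtains P where "P \<in> trig_poly n UNIV"
    "\<forall>w. (\<forall>j<n. cmod (w j) = 1) \<longrightarrow>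
       P w = inner2 n (\<lambda>z. \<phi> z * p (\<lambda>j. w j * z j)) (\<lambda>z. q (\<lambda>j. w j * z j))"
    "\<forall>k. inner2 n P (monom_T n k) =
       fourier n \<phi> (\<lambda>j. - k j) * inner2 n (\<lambda>z. monom_T n (\<lambda>j. - k j) z * p z) q"
proof -
  have [measurable]: "\<phi> \<in> borel_measurable (torus_measure n)" by fact
  obtain m :: nat and c \<kappa> where p: "p = (\<lambda>z. \<Sum>i<m. c i * monom_T n (\<kappa> i) z)"
    by (rule trig_polyE[OF assms(1)])
  obtain m' :: nat and d \<kappa>' where q: "q = (\<lambda>z. \<Sum>i<m'. d i * monom_T n (\<kappa>' i) z)"
    by (rule trig_polyE[OF assms(2)])
  define A where "A i l = inner2 n (\<lambda>z. \<phi> z * monom_T n (\<kappa> i) z) (monom_T n (\<kappa>' l))" for i l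
  define \<delta> where "\<delta> i l = (\<lambda>j. \<kappa> i j + - \<kappa>' l j)" for i l
  define P where "P w = (\<Sum>i<m. \<Sum>l<m'. (c i * cnj (d l) * A i l) * monom_T n (\<delta> i l) w)" for w
  have L: "(\<lambda>z. \<phi> z * monom_T n k z) \<in> L2 n" for k by (intro L2_mult_bounded \<phi> L2_monom_T)
  have A_eq: "A i l = fourier n \<phi> (\<lambda>j. - \<delta> i l j)" for i l
    unfolding A_def inner2_def
  proof (subst fourier_monom_neg[OF \<phi>(1), symmetric], rule integral_cong_AE)
    show "AE z in torus_measure n. \<phi> z * monom_T n (\<kappa> i) z * cnj (monom_T n (\<kappa>' l) z) = \<phi> z * monom_T n (\<delta> i l) z"
      using AE_torus[of n]
    proof eventually_elim
      case (elim z)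
      then show ?case unfolding \<delta>_def by (simp only: cnj_monom_T mult.assoc monom_T_mult)
    qed
  qed measurable
  show thesis
  proof (rule that[of P])
    have sub: "L2_subspace n (trig_poly n UNIV)" by (rule L2_subspace_trig_poly)
    have sum_in: "(\<lambda>w. \<Sum>i<(M::nat). f i w) \<in> trig_poly n UNIV" if "\<And>i. f i \<in> trig_poly n UNIV" for M f
    proof (induction M)
      case 0 show ?case using L2_subspaceD(2)[OF sub] by simp
    next
      case (Suc M)
      have "(\<lambda>w. (\<Sum>i<M. f i w) + f M w) \<in> trig_poly n UNIV" by (rule L2_subspaceD(3)[OF sub Suc that])
      then show ?case by simp
    qed
    have "(\<lambda>w. \<Sum>i<m. \<Sum>l<m'. (c i * cnj (d l) * A i l) * monom_T n (\<delta> i l) w) \<in> trig_poly n UNIV"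
      by (intro sum_in L2_subspaceD(4)[OF sub] monom_T_in_trig_poly UNIV_I)
    then show "P \<in> trig_poly n UNIV" unfolding P_def[abs_def] .
    show "\<forall>w. (\<forall>j<n. cmod (w j) = 1) \<longrightarrow>
       P w = inner2 n (\<lambda>z. \<phi> z * p (\<lambda>j. w j * z j)) (\<lambda>z. q (\<lambda>j. w j * z j))"
    proof (intro allI impI)
      fix w assume w: "\<forall>j<n. cmod (w j) = 1"
      have e1: "(\<lambda>z. \<phi> z * p (\<lambda>j. w j * z j)) = (\<lambda>z. \<Sum>i<m. (c i * monom_T n (\<kappa> i) w) * (\<phi> z * monom_T n (\<kappa> i) z))"
        unfolding p monom_T_scale by (simp add: sum_distrib_left mult_ac)
      have e2: "(\<lambda>z. q (\<lambda>j. w j * z j)) = (\<lambda>z. \<Sum>l<m'. (d l * monom_T n (\<kappa>' l) w) * monom_T n (\<kappa>' l) z)"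
        unfolding q monom_T_scale by (simp add: mult_ac)
      have Lq: "(\<lambda>z. \<Sum>l<m'. (d l * monom_T n (\<kappa>' l) w) * monom_T n (\<kappa>' l) z) \<in> L2 n"
        by (intro L2_sum L2_cmult L2_monom_T)
      have "inner2 n (\<lambda>z. \<phi> z * p (\<lambda>j. w j * z j)) (\<lambda>z. q (\<lambda>j. w j * z j))
          = (\<Sum>i<m. (c i * monom_T n (\<kappa> i) w) * (\<Sum>l<m'. cnj (d l * monom_T n (\<kappa>' l) w) * A i l))"
        unfolding e1 e2 A_def
        by (subst inner2_sum_left[OF L Lq], subst inner2_sum_right[OF L2_monom_T L]) simp
      also have "\<dots> = P w"
        unfolding P_def sum_distrib_left
      proof (intro sum.cong refl)
        fix i l
        have "monom_T n (\<kappa> i) w * cnj (monom_T n (\<kappa>' l) w) = monom_T n (\<delta> i l) w"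
          unfolding \<delta>_def using w by (simp only: cnj_monom_T monom_T_mult)
        then show "c i * monom_T n (\<kappa> i) w * (cnj (d l * monom_T n (\<kappa>' l) w) * A i l)
            = c i * cnj (d l) * A i l * monom_T n (\<delta> i l) w" by (simp add: mult_ac)
      qed
      finally show "P w = inner2 n (\<lambda>z. \<phi> z * p (\<lambda>j. w j * z j)) (\<lambda>z. q (\<lambda>j. w j * z j))" by simp
    qed
    show "\<forall>k. inner2 n P (monom_T n k) =
       fourier n \<phi> (\<lambda>j. - k j) * inner2 n (\<lambda>z. monom_T n (\<lambda>j. - k j) z * p z) q"
    proof
      fix k
      have LP: "(\<lambda>w. \<Sum>l<m'. (c i * cnj (d l) * A i l) * monom_T n (\<delta> i l) w) \<in> L2 n" for i
        by (intro L2_sum L2_cmult L2_monom_T)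
      have "inner2 n P (monom_T n k) = (\<Sum>i<m. 1 * inner2 n (\<lambda>w. \<Sum>l<m'. (c i * cnj (d l) * A i l) * monom_T n (\<delta> i l) w) (monom_T n k))"
        unfolding P_def[abs_def] using inner2_sum_left[OF LP L2_monom_T, where c="\<lambda>_. 1"] by simp
      also have "\<dots> = (\<Sum>i<m. \<Sum>l<m'. (c i * cnj (d l) * A i l) * inner2 n (monom_T n (\<delta> i l)) (monom_T n k))"
        by (subst inner2_sum_left[OF L2_monom_T L2_monom_T]) simp
      also have "\<dots> = (\<Sum>i<m. \<Sum>l<m'. fourier n \<phi> (\<lambda>j. - k j) *
            (c i * (cnj (d l) * inner2 n (\<lambda>z. monom_T n (\<lambda>j. - k j) z * monom_T n (\<kappa> i) z) (monom_T n (\<kappa>' l)))))"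
      proof (intro sum.cong refl)
        fix i l
        have "inner2 n (\<lambda>z. monom_T n (\<lambda>j. - k j) z * monom_T n (\<kappa> i) z) (monom_T n (\<kappa>' l))
            = inner2 n (monom_T n (\<lambda>j. - k j + \<kappa> i j)) (monom_T n (\<kappa>' l))"
        proof (rule inner2_cong_AE)
          show "AE z in torus_measure n. monom_T n (\<lambda>j. - k j) z * monom_T n (\<kappa> i) z = monom_T n (\<lambda>j. - k j + \<kappa> i j) z"
            using AE_torus[of n] by eventually_elim (rule monom_T_mult)
        qed (auto intro: L2_monom_T L2_monom_T_mult)
        also have "\<dots> = inner2 n (monom_T n (\<delta> i l)) (monom_T n k)"
          unfolding inner2_monom_T \<delta>_def by (intro if_cong) (auto simp: algebra_simps)
        finally have e: "inner2 n (\<lambda>z. monom_T n (\<lambda>j. - k j) z * monom_T n (\<kappa> i) z) (monom_T n (\<kappa>' l))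
            = inner2 n (monom_T n (\<delta> i l)) (monom_T n k)" .
        show "(c i * cnj (d l) * A i l) * inner2 n (monom_T n (\<delta> i l)) (monom_T n k)
          = fourier n \<phi> (\<lambda>j. - k j) *
            (c i * (cnj (d l) * inner2 n (\<lambda>z. monom_T n (\<lambda>j. - k j) z * monom_T n (\<kappa> i) z) (monom_T n (\<kappa>' l))))"
        proof (cases "\<forall>j<n. \<delta> i l j = k j")
          case True
          then have "monom_T n (\<lambda>j. - \<delta> i l j) = monom_T n (\<lambda>j. - k j)" by (intro monom_T_cong) simp
          then have "A i l = fourier n \<phi> (\<lambda>j. - k j)" unfolding A_eq fourier_monom by simp
          then show ?thesis unfolding e by (simp add: mult_ac)
        next
          case False
          then have "inner2 n (monom_T n (\<delta> i l)) (monom_T n k) = 0"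
            unfolding inner2_monom_T by (simp only: if_False)
          then show ?thesis unfolding e by simp
        qed
      qed
      also have "\<dots> = fourier n \<phi> (\<lambda>j. - k j) * (\<Sum>i<m. c i * (\<Sum>l<m'. cnj (d l) *
          inner2 n (\<lambda>z. monom_T n (\<lambda>j. - k j) z * monom_T n (\<kappa> i) z) (monom_T n (\<kappa>' l))))"
        by (simp only: sum_distrib_left)
      also have "(\<Sum>i<m. c i * (\<Sum>l<m'. cnj (d l) *
          inner2 n (\<lambda>z. monom_T n (\<lambda>j. - k j) z * monom_T n (\<kappa> i) z) (monom_T n (\<kappa>' l))))
          = inner2 n (\<lambda>z. monom_T n (\<lambda>j. - k j) z * p z) q"
      proof -
        have L': "(\<lambda>z. monom_T n (\<lambda>j. - k j) z * monom_T n (\<kappa> i) z) \<in> L2 n" for i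
          by (intro L2_monom_T_mult L2_monom_T)
        have Lq: "q \<in> L2 n" unfolding q by (intro L2_sum L2_cmult L2_monom_T)
        have "(\<lambda>z. monom_T n (\<lambda>j. - k j) z * p z) = (\<lambda>z. \<Sum>i<m. c i * (monom_T n (\<lambda>j. - k j) z * monom_T n (\<kappa> i) z))"
          unfolding p by (simp add: sum_distrib_left mult_ac)
        then have "inner2 n (\<lambda>z. monom_T n (\<lambda>j. - k j) z * p z) q
            = (\<Sum>i<m. c i * inner2 n (\<lambda>z. monom_T n (\<lambda>j. - k j) z * monom_T n (\<kappa> i) z) q)"
          by (simp only: inner2_sum_left[OF L' Lq])
        then show ?thesis unfolding q by (simp only: inner2_sum_right[OF L2_monom_T L'])
      qed
      finally show "inner2 n P (monom_T n k) =
       fourier n \<phi> (\<lambda>j. - k j) * inner2 n (\<lambda>z. monom_T n (\<lambda>j. - k j) z * p z) q" .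
    qed
  qed
qed

text \<open>Weak-* density of trigonometric polynomials in disguise: \<open>w \<mapsto> \<integral> \<phi>(z) h(wz) \<bar>f(wz)\<close>
  is a uniform limit of trigonometric polynomials all of whose Fourier coefficients tend to \<open>0\<close>.\<close>

theorem inner2_bounded_mult_eq_0:
  assumes \<phi>: "\<phi> \<in> borel_measurable (torus_measure n)" "AE z in torus_measure n. cmod (\<phi> z) \<le> 1"
    and h: "h \<in> L2 n" and f: "f \<in> L2 n"
    and van: "\<And>k. fourier n \<phi> k = 0 \<or> inner2 n (\<lambda>z. monom_T n k z * h z) f = 0"
  shows "inner2 n (\<lambda>z. \<phi> z * h z) f = 0"
proof -
  have sub: "L2_subspace n (trig_poly n UNIV)" by (rule L2_subspace_trig_poly)
  obtain H where H: "\<forall>j::nat. H j \<in> trig_poly n UNIV" and Hlim: "(\<lambda>j. norm2 n (\<lambda>z. H j z - h z)) \<longlonglongrightarrow> 0"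
    by (rule trig_poly_dense[OF h, of UNIV]) auto
  obtain F where F: "\<forall>j::nat. F j \<in> trig_poly n UNIV" and Flim: "(\<lambda>j. norm2 n (\<lambda>z. F j z - f z)) \<longlonglongrightarrow> 0"
    by (rule trig_poly_dense[OF f, of UNIV]) auto
  note H = spec[OF H] and F = spec[OF F]
  have HL: "H j \<in> L2 n" and FL: "F j \<in> L2 n" for j using L2_subspaceD(1)[OF sub] H F by auto
  define T where "T = {w::nat \<Rightarrow> complex. \<forall>j<n. cmod (w j) = 1}"
  let ?s = "\<lambda>w z j. w j * z j"
  let ?G = "\<lambda>p q w. inner2 n (\<lambda>z. \<phi> z * p (?s w z)) (\<lambda>z. q (?s w z))"
  define R where "R N P \<longleftrightarrow> P \<in> trig_poly n UNIV \<and> (\<forall>w. (\<forall>j<n. cmod (w j) = 1) \<longrightarrow> P w = ?G (H N) (F N) w) \<and>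
    (\<forall>k. inner2 n P (monom_T n k) =
       fourier n \<phi> (\<lambda>j. - k j) * inner2 n (\<lambda>z. monom_T n (\<lambda>j. - k j) z * H N z) (F N))" for N P
  have "\<forall>N. \<exists>P. R N P"
    unfolding R_def
    by (rule allI, rule rotated_form_trig_poly[OF H F \<phi>]) (intro exI conjI)
  from choice[OF this] obtain P where "\<forall>N. R N (P N)" ..
  then have R: "R N (P N)" for N by (rule spec)
  have P: "P N \<in> trig_poly n UNIV" for N
    using R[of N] unfolding R_def by (rule conjunct1)
  have PG: "P N w = ?G (H N) (F N) w" if "w \<in> T" for N w
    using conjunct1[OF conjunct2[OF R[of N, unfolded R_def]]] that unfolding T_def by blast
  have Pf: "inner2 n (P N) (monom_T n k) =
       fourier n \<phi> (\<lambda>j. - k j) * inner2 n (\<lambda>z. monom_T n (\<lambda>j. - k j) z * H N z) (F N)" for N k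
    by (rule spec[OF conjunct2[OF conjunct2[OF R[of N, unfolded R_def]]]])
  have PL: "P N \<in> L2 n" for N using L2_subspaceD(1)[OF sub P] .
  obtain B where B: "\<And>j. norm2 n (H j) \<le> B" "\<And>j. norm2 n (F j) \<le> B" "0 \<le> B"
  proof -
    have "Bseq (\<lambda>j. norm2 n (H j))" "Bseq (\<lambda>j. norm2 n (F j))"
      using tendsto_norm2[OF HL h Hlim] tendsto_norm2[OF FL f Flim] by (auto intro!: convergent_imp_Bseq convergentI)
    then obtain B1 B2 where "\<And>j. norm2 n (H j) \<le> B1" "\<And>j. norm2 n (F j) \<le> B2"
      by (auto simp: Bseq_def)
    moreover have "0 \<le> B1" using calculation(1)[of 0] norm2_nonneg[of n "H 0"] by linarith
    ultimately show thesis by (intro that[of "max B1 B2"]) (auto simp: max.coboundedI1 max.coboundedI2)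
  qed
  \<comment> \<open>\<open>t N\<close> will bound the distance of \<open>P N\<close> from its limit
    at every point of \<open>T\<close>. It is independent of \<open>w\<close> because rotations
    preserve the norms of polynomials.\<close>
  define t where "t N = B * (norm2 n (\<lambda>z. H N z - h z) + norm2 n (\<lambda>z. F N z - f z))" for N
  have t0: "t \<longlonglongrightarrow> 0"
    unfolding t_def using tendsto_mult[OF tendsto_const[of B] tendsto_add[OF Hlim Flim]] by simp
  have scaleL2: "(\<lambda>z. p (?s w z)) \<in> L2 n" if "p \<in> trig_poly n UNIV" for p w
    using L2_subspaceD(1)[OF sub trig_poly_scale[OF that]] .
  have unif: "cmod (P N w - P M w) \<le> t N + t M" if w: "w \<in> T" for N M w
  proof -
    have wT: "\<forall>j<n. cmod (w j) = 1" using w by (simp add: T_def)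
    define a where "a j z = H j (?s w z)" for j z
    define b where "b j z = F j (?s w z)" for j z
    have aL: "a j \<in> L2 n" and bL: "b j \<in> L2 n" for j
      using scaleL2[OF H] scaleL2[OF F] by (simp_all add: a_def[abs_def] b_def[abs_def])
    have aB: "norm2 n (a j) \<le> B" and bB: "norm2 n (b j) \<le> B" for j
      using B norm2_scale[OF H wT] norm2_scale[OF F wT] by (simp_all add: a_def[abs_def] b_def[abs_def])
    have ad: "norm2 n (\<lambda>z. a N z - a M z) = norm2 n (\<lambda>z. H N z - H M z)"
      unfolding a_def using norm2_scale[OF L2_subspaceD(5)[OF sub H H] wT, of N M] by simp
    have bd: "norm2 n (\<lambda>z. b N z - b M z) = norm2 n (\<lambda>z. F N z - F M z)"
      unfolding b_def using norm2_scale[OF L2_subspaceD(5)[OF sub F F] wT, of N M] by simp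
    have \<phi>a: "(\<lambda>z. \<phi> z * a j z) \<in> L2 n" for j by (intro L2_mult_bounded \<phi> aL)
    have \<phi>d: "(\<lambda>z. \<phi> z * (a N z - a M z)) \<in> L2 n" by (intro L2_mult_bounded \<phi> aL L2_diff)
    \<comment> \<open>The difference of two values of a sesquilinear form is split into a change of
      the first argument followed by a change of the second.\<close>
    have eq: "P N w - P M w = inner2 n (\<lambda>z. \<phi> z * (a N z - a M z)) (b N)
        + inner2 n (\<lambda>z. \<phi> z * a M z) (\<lambda>z. b N z - b M z)"
    proof -
      have "inner2 n (\<lambda>z. \<phi> z * (a N z - a M z)) (b N)
          = inner2 n (\<lambda>z. \<phi> z * a N z) (b N) - inner2 n (\<lambda>z. \<phi> z * a M z) (b N)"
        unfolding right_diff_distrib by (rule inner2_diff_left[OF \<phi>a \<phi>a bL])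
      moreover have "inner2 n (\<lambda>z. \<phi> z * a M z) (\<lambda>z. b N z - b M z)
          = inner2 n (\<lambda>z. \<phi> z * a M z) (b N) - inner2 n (\<lambda>z. \<phi> z * a M z) (b M)"
        by (rule inner2_diff_right[OF bL bL \<phi>a])
      moreover have "P j w = inner2 n (\<lambda>z. \<phi> z * a j z) (b j)" for j
        using PG[OF w, of j] by (simp add: a_def[abs_def] b_def[abs_def])
      ultimately show ?thesis by simp
    qed
    have tri: "norm2 n (\<lambda>z. u N z - u M z) \<le> norm2 n (\<lambda>z. u N z - v z) + norm2 n (\<lambda>z. u M z - v z)"
      if "\<And>j. u j \<in> L2 n" "v \<in> L2 n" for u :: "nat \<Rightarrow> tfun" and v
      using norm2_triangle_diff[OF that(1)[of N] that(2) that(1)[of M]] norm2_minus_commute[of n v "u M"] by linarith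
    have "cmod (P N w - P M w) \<le> cmod (inner2 n (\<lambda>z. \<phi> z * (a N z - a M z)) (b N))
        + cmod (inner2 n (\<lambda>z. \<phi> z * a M z) (\<lambda>z. b N z - b M z))"
      unfolding eq by (rule norm_triangle_ineq)
    also have "\<dots> \<le> norm2 n (\<lambda>z. \<phi> z * (a N z - a M z)) * norm2 n (b N)
        + norm2 n (\<lambda>z. \<phi> z * a M z) * norm2 n (\<lambda>z. b N z - b M z)"
      by (intro add_mono cmod_inner2_le \<phi>d \<phi>a bL L2_diff)
    also have "\<dots> \<le> norm2 n (\<lambda>z. H N z - H M z) * B + B * norm2 n (\<lambda>z. F N z - F M z)"
    proof (intro add_mono mult_mono)
      show "norm2 n (\<lambda>z. \<phi> z * (a N z - a M z)) \<le> norm2 n (\<lambda>z. H N z - H M z)"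
        using norm2_mult_bounded_le[OF \<phi> L2_diff[OF aL aL, of N M]] ad by simp
      show "norm2 n (\<lambda>z. \<phi> z * a M z) \<le> B"
        using norm2_mult_bounded_le[OF \<phi> aL[of M]] aB[of M] by linarith
    qed (use B bB bd in auto)
    also have "\<dots> \<le> (norm2 n (\<lambda>z. H N z - h z) + norm2 n (\<lambda>z. H M z - h z)) * B
        + B * (norm2 n (\<lambda>z. F N z - f z) + norm2 n (\<lambda>z. F M z - f z))"
      by (intro add_mono mult_right_mono mult_left_mono tri HL FL h f B(3))
    also have "\<dots> = t N + t M" by (simp add: t_def algebra_simps)
    finally show ?thesis .
  qed
  define L where "L w = lim (\<lambda>N. P N w)" for w
  have Plim: "(\<lambda>N. P N w) \<longlonglongrightarrow> L w" if w: "w \<in> T" for w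
  proof -
    have "Cauchy (\<lambda>N. P N w)"
    proof (rule metric_CauchyI)
      fix e :: real assume "e > 0"
      then obtain M where M: "\<And>N. N \<ge> M \<Longrightarrow> \<bar>t N\<bar> < e/2" using LIMSEQ_D[OF t0, of "e/2"] by auto
      have "dist (P i w) (P j w) < e" if "i \<ge> M" "j \<ge> M" for i j
        using unif[OF w, of i j] M[OF that(1)] M[OF that(2)] by (simp add: dist_norm)
      then show "\<exists>M. \<forall>i\<ge>M. \<forall>j\<ge>M. dist (P i w) (P j w) < e" by blast
    qed
    then show ?thesis unfolding L_def by (simp add: Cauchy_convergent_iff convergent_LIMSEQ_iff)
  qed
  have PL_le: "cmod (P N w - L w) \<le> t N" if w: "w \<in> T" for N w
  proof (rule LIMSEQ_le)
    show "(\<lambda>M. cmod (P N w - P M w)) \<longlonglongrightarrow> cmod (P N w - L w)" by (intro tendsto_intros Plim w)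
    show "(\<lambda>M. t N + t M) \<longlonglongrightarrow> t N" using tendsto_add[OF tendsto_const t0, of "t N"] by simp
  qed (use unif[OF w] in auto)
  have [measurable]: "P N \<in> borel_measurable (torus_measure n)" for N using PL by auto
  have [measurable]: "L \<in> borel_measurable (torus_measure n)"
    unfolding L_def by (intro borel_measurable_lim_metric) measurable
  have AE_T: "AE w in torus_measure n. w \<in> T" using AE_torus[of n] by (simp add: T_def)
  have AE_le: "AE w in torus_measure n. cmod (P N w - L w) \<le> t N" for N
    using AE_T by eventually_elim (rule PL_le)
  have dL2: "(\<lambda>w. P N w - L w) \<in> L2 n" for N
    by (rule L2_bounded[OF _ AE_le]) measurable
  have LL2: "L \<in> L2 n" using L2_diff[OF PL[of 0] dL2[of 0]] by simp
  have "norm2 n (\<lambda>w. P N w - L w) \<le> t N" for N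
  proof -
    have "0 \<le> t N" unfolding t_def using B(3) by simp
    have "(norm2 n (\<lambda>w. P N w - L w))\<^sup>2 \<le> (\<integral>w. (t N)\<^sup>2 \<partial>torus_measure n)"
      unfolding norm2_sq
    proof (intro integral_mono_AE L2_integrable_sq dL2)
      show "AE w in torus_measure n. (cmod (P N w - L w))\<^sup>2 \<le> (t N)\<^sup>2"
        using AE_le[of N] by eventually_elim (intro power_mono norm_ge_zero)
    qed simp
    then have "(norm2 n (\<lambda>w. P N w - L w))\<^sup>2 \<le> (t N)\<^sup>2" by (simp add: torus.prob_space)
    then show ?thesis using \<open>0 \<le> t N\<close> by (rule power2_le_imp_le)
  qed
  then have "\<forall>N. norm (norm2 n (\<lambda>w. P N w - L w)) \<le> t N" by simp
  then have L_lim: "(\<lambda>N. norm2 n (\<lambda>w. P N w - L w)) \<longlonglongrightarrow> 0"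
    by (rule Lim_null_comparison[OF always_eventually t0])
  \<comment> \<open>Each coefficient of \<open>P N\<close> is a product that converges to the
    product of the two quantities in \<open>van\<close> at \<open>- k\<close>, one of which is
    zero.\<close>
  have "fourier n L k = 0" for k
  proof -
    have "(\<lambda>N. inner2 n (P N) (monom_T n k)) \<longlonglongrightarrow> inner2 n L (monom_T n k)"
      by (rule tendsto_inner2[OF PL LL2 L_lim L2_monom_T])
    moreover have "(\<lambda>N. inner2 n (P N) (monom_T n k)) \<longlonglongrightarrow>
        fourier n \<phi> (\<lambda>j. - k j) * inner2 n (\<lambda>z. monom_T n (\<lambda>j. - k j) z * h z) f"
      unfolding Pf
    proof (intro tendsto_mult tendsto_const tendsto_inner2_both L2_monom_T_mult HL FL h f Flim)
      have "norm2 n (\<lambda>z. monom_T n (\<lambda>j. - k j) z * H N z - monom_T n (\<lambda>j. - k j) z * h z)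
          \<le> norm2 n (\<lambda>z. H N z - h z)" for N
        unfolding right_diff_distrib[symmetric]
        by (intro norm2_mult_bounded_le measurable_monom_T AE_cmod_monom_T_le L2_diff HL h)
      then have "\<forall>N. norm (norm2 n (\<lambda>z. monom_T n (\<lambda>j. - k j) z * H N z - monom_T n (\<lambda>j. - k j) z * h z))
          \<le> norm2 n (\<lambda>z. H N z - h z)" by simp
      then show "(\<lambda>N. norm2 n (\<lambda>z. monom_T n (\<lambda>j. - k j) z * H N z - monom_T n (\<lambda>j. - k j) z * h z)) \<longlonglongrightarrow> 0"
        by (rule Lim_null_comparison[OF always_eventually Hlim])
    qed
    moreover have "fourier n \<phi> (\<lambda>j. - k j) * inner2 n (\<lambda>z. monom_T n (\<lambda>j. - k j) z * h z) f = 0"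
      using van[of "\<lambda>j. - k j"] by auto
    ultimately show ?thesis unfolding fourier_inner2 using LIMSEQ_unique by fastforce
  qed
  then have "AE w in torus_measure n. L w = 0"
    by (intro fourier_unique L2_integrable LL2)
  with AE_T have AE_L: "AE w in torus_measure n. w \<in> T \<and> L w = 0" by eventually_elim simp
  \<comment> \<open>Rotation by the identity \<open>o1\<close> gives back the original pairing. That
    \<open>L\<close> vanishes almost everywhere does not by itself cover this one point. So the
    continuous function \<open>P N\<close> is evaluated at nearby points where \<open>L\<close>
    vanishes, and there it is bounded by \<open>t N\<close>.\<close>
  define o1 where "o1 = (\<lambda>j::nat. 1::complex)"
  have P1_le: "cmod (P N o1) \<le> t N" for N
  proof -
    have "\<exists>w. (w \<in> T \<and> L w = 0) \<and> (\<forall>j<n. dist (w j) 1 < inverse (real (Suc m)))" for m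
      by (rule AE_torus_near_1[OF AE_L, of "inverse (real (Suc m))"]) auto
    then obtain w where w: "\<And>m. w m \<in> T" "\<And>m. L (w m) = 0"
      and near: "\<And>m j. j < n \<Longrightarrow> dist (w m j) 1 < inverse (real (Suc m))" by metis
    have wlim: "(\<lambda>m. w m j) \<longlonglongrightarrow> 1" if "j < n" for j
    proof -
      have "\<forall>m. norm (w m j - 1) \<le> inverse (real (Suc m))"
        using near[OF that] by (simp add: dist_norm less_imp_le)
      then have "(\<lambda>m. w m j - 1) \<longlonglongrightarrow> 0"
        by (rule Lim_null_comparison[OF always_eventually LIMSEQ_inverse_real_of_nat])
      then show ?thesis by (rule LIM_zero_cancel)
    qed
    have mlim: "(\<lambda>m. monom_T n k (w m)) \<longlonglongrightarrow> monom_T n k o1" for k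
      unfolding monom_T_def o1_def by (intro tendsto_prod tendsto_power_int wlim) auto
    obtain m :: nat and c \<kappa> where PN: "P N = (\<lambda>z. \<Sum>i<m. c i * monom_T n (\<kappa> i) z)"
      by (rule trig_polyE[OF P[of N]])
    have "(\<lambda>m. P N (w m)) \<longlonglongrightarrow> P N o1"
      unfolding PN by (intro tendsto_sum tendsto_mult tendsto_const mlim)
    then have "(\<lambda>m. cmod (P N (w m))) \<longlonglongrightarrow> cmod (P N o1)" by (rule tendsto_norm)
    then show ?thesis
      by (rule LIMSEQ_le_const2) (use PL_le[OF w(1), of N] w(2) in auto)
  qed
  have "\<forall>N. norm (P N o1) \<le> t N" using P1_le by simp
  then have "(\<lambda>N. P N o1) \<longlonglongrightarrow> 0"
    by (rule Lim_null_comparison[OF always_eventually t0])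
  moreover have "P N o1 = inner2 n (\<lambda>z. \<phi> z * H N z) (F N)" for N
    using PG[of o1 N] by (simp add: T_def o1_def)
  moreover have "(\<lambda>N. inner2 n (\<lambda>z. \<phi> z * H N z) (F N)) \<longlonglongrightarrow> inner2 n (\<lambda>z. \<phi> z * h z) f"
  proof (intro tendsto_inner2_both L2_mult_bounded \<phi> HL FL h f Flim)
    have "norm2 n (\<lambda>z. \<phi> z * H N z - \<phi> z * h z) \<le> norm2 n (\<lambda>z. H N z - h z)" for N
      unfolding right_diff_distrib[symmetric] by (intro norm2_mult_bounded_le \<phi> L2_diff HL h)
    then have "\<forall>N. norm (norm2 n (\<lambda>z. \<phi> z * H N z - \<phi> z * h z)) \<le> norm2 n (\<lambda>z. H N z - h z)" by simp
    then show "(\<lambda>N. norm2 n (\<lambda>z. \<phi> z * H N z - \<phi> z * h z)) \<longlonglongrightarrow> 0"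
      by (rule Lim_null_comparison[OF always_eventually Hlim])
  qed
  ultimately show ?thesis using LIMSEQ_unique by fastforce
qed

section \<open>Hardy space\<close>

lemma H2_L2: "f \<in> H2 n \<Longrightarrow> f \<in> L2 n"
  by (simp add: H2_def)

lemma H2_fourier: "f \<in> H2 n \<Longrightarrow> j < n \<Longrightarrow> k j < 0 \<Longrightarrow> fourier n f k = 0"
  by (auto simp: H2_def)

lemma H2I: "f \<in> L2 n \<Longrightarrow> (\<And>k j. j < n \<Longrightarrow> k j < 0 \<Longrightarrow> fourier n f k = 0) \<Longrightarrow> f \<in> H2 n"
  by (auto simp: H2_def)

lemma H2_diff:
  assumes "f \<in> H2 n" "g \<in> H2 n" shows "(\<lambda>z. f z - g z) \<in> H2 n"
proof (rule H2I)
  show "(\<lambda>z. f z - g z) \<in> L2 n" using assms by (intro L2_diff H2_L2)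
  show "fourier n (\<lambda>z. f z - g z) k = 0" if "j < n" "k j < 0" for k j
    using H2_fourier[of f n j k, OF assms(1) that] H2_fourier[of g n j k, OF assms(2) that]
    by (simp add: fourier_inner2 inner2_diff_left H2_L2 assms L2_monom_T)
qed

lemma H2_add:
  assumes "f \<in> H2 n" "g \<in> H2 n" shows "(\<lambda>z. f z + g z) \<in> H2 n"
proof (rule H2I)
  show "(\<lambda>z. f z + g z) \<in> L2 n" using assms by (intro L2_add H2_L2)
  show "fourier n (\<lambda>z. f z + g z) k = 0" if "j < n" "k j < 0" for k j
    using H2_fourier[of f n j k, OF assms(1) that] H2_fourier[of g n j k, OF assms(2) that]
    by (simp add: fourier_inner2 inner2_add_left H2_L2 assms L2_monom_T)
qed

lemma H2_cmult:
  assumes f: "f \<in> H2 n" shows "(\<lambda>z. c * f z) \<in> H2 n"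
proof (rule H2I)
  show "(\<lambda>z. c * f z) \<in> L2 n" using assms by (intro L2_cmult H2_L2)
  show "fourier n (\<lambda>z. c * f z) k = 0" if "j < n" "k j < 0" for k j
    using H2_fourier[of f n j k, OF f that] by (simp add: fourier_inner2 inner2_cmult_left)
qed

lemma H2_monom_T_mult:
  assumes h: "h \<in> H2 n" and k: "k \<in> nonneg_exp n"
  shows "(\<lambda>z. monom_T n k z * h z) \<in> H2 n"
proof (rule H2I)
  show "(\<lambda>z. monom_T n k z * h z) \<in> L2 n" using h by (intro L2_monom_T_mult H2_L2)
  fix l :: "nat \<Rightarrow> int" and j assume j: "j < n" "l j < 0"
  have [measurable]: "h \<in> borel_measurable (torus_measure n)" using H2_L2[OF h] by auto
  have "fourier n (\<lambda>z. monom_T n k z * h z) l = fourier n h (\<lambda>j. l j + - k j)"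
    unfolding fourier_monom
  proof (rule integral_cong_AE)
    show "AE z in torus_measure n. monom_T n k z * h z * cnj (monom_T n l z) = h z * cnj (monom_T n (\<lambda>j. l j + - k j) z)"
      using AE_torus[of n]
    proof eventually_elim
      case (elim z)
      have "cnj (monom_T n (\<lambda>j. l j + - k j) z) = cnj (monom_T n l z * cnj (monom_T n k z))"
        by (simp only: cnj_monom_T[OF elim, of k] monom_T_mult[OF elim])
      then show ?case by (simp add: mult_ac)
    qed
  qed measurable
  also have "\<dots> = 0"
    using j k by (intro H2_fourier[of h n j, OF h j(1)]) (auto simp: nonneg_exp_def)
  finally show "fourier n (\<lambda>z. monom_T n k z * h z) l = 0" .
qed

lemma H2_coord_mult:
  assumes "h \<in> H2 n" "i < n" shows "(\<lambda>z. z i * h z) \<in> H2 n"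
  using H2_monom_T_mult[OF assms(1), of "\<lambda>j. if j = i then 1 else 0"] monom_T_single[OF assms(2)]
  by (simp add: nonneg_exp_def)

lemma H2_1: "(\<lambda>z. 1) \<in> H2 n"
proof (rule H2I[OF L2_const])
  fix k :: "nat \<Rightarrow> int" and j assume "j < n" "k j < 0"
  then have "\<not> (\<forall>j<n. 0 = k j)" by auto
  then have "inner2 n (monom_T n (\<lambda>_. 0)) (monom_T n k) = 0"
    unfolding inner2_monom_T by (simp only: if_False)
  moreover have "monom_T n (\<lambda>_. 0) = (\<lambda>z. 1)" by (simp add: monom_T_0 fun_eq_iff)
  ultimately show "fourier n (\<lambda>z. 1) k = 0" by (simp add: fourier_inner2)
qed

lemma H2_monom_T: "k \<in> nonneg_exp n \<Longrightarrow> monom_T n k \<in> H2 n"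
  using H2_monom_T_mult[OF H2_1, of k] by simp

lemma H2_dense:
  assumes "f \<in> H2 n"
  obtains h where "\<forall>j::nat. h j \<in> trig_poly n (nonneg_exp n)" "(\<lambda>j. norm2 n (\<lambda>z. h j z - f z)) \<longlonglongrightarrow> 0"
proof (rule trig_poly_dense[OF H2_L2[OF assms], of "nonneg_exp n"])
  show "l \<in> nonneg_exp n" if "\<forall>j<n. k j = l j" "k \<in> nonneg_exp n" for k l
    using that by (auto simp: nonneg_exp_def)
  show "fourier n f k = 0" if "k \<notin> nonneg_exp n" for k
    using that H2_fourier[OF assms] by (force simp: nonneg_exp_def)
qed (rule that)

text \<open>Monomials with nonnegative exponents arise from \<open>1\<close> by multiplying with one
  coordinate at a time, which is the form in which the properties of \<open>Q\<close> and
  \<open>X\<close> are given. The induction is on the total degree.\<close>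

lemma monom_T_induct [consumes 1, case_names one mult]:
  assumes "k \<in> nonneg_exp n" and "P (\<lambda>z. 1)"
    and "\<And>i k. i < n \<Longrightarrow> k \<in> nonneg_exp n \<Longrightarrow> P (monom_T n k) \<Longrightarrow> P (\<lambda>z. z i * monom_T n k z)"
  shows "P (monom_T n k)"
  using assms(1)
proof (induction "\<Sum>j<n. nat (k j)" arbitrary: k rule: less_induct)
  case less
  show ?case
  proof (cases "\<forall>j<n. k j = 0")
    case True
    then have "monom_T n k = (\<lambda>z. 1)" by (simp add: monom_T_0 fun_eq_iff)
    with assms(2) show ?thesis by simp
  next
    case False
    then obtain i where i: "i < n" "0 < k i" using less.prems by (force simp: nonneg_exp_def order_le_less)
    define k' where "k' = k(i := k i - 1)"
    have k': "k' \<in> nonneg_exp n" using less.prems i by (auto simp: nonneg_exp_def k'_def)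
    have "(\<Sum>j<n. nat (k' j)) < (\<Sum>j<n. nat (k j))"
      by (rule sum_strict_mono_ex1) (use i in \<open>auto simp: k'_def intro!: bexI[of _ i]\<close>)
    then have "P (monom_T n k')" using less.hyps k' by blast
    then have "P (\<lambda>z. z i * monom_T n k' z)" by (rule assms(3)[OF i(1) k'])
    moreover have "(\<lambda>z. z i * monom_T n k' z) = monom_T n k"
    proof
      fix z :: "nat \<Rightarrow> complex"
      have "monom_T n k z = z i powi k i * (\<Prod>j\<in>{..<n} - {i}. z j powi k j)"
        unfolding monom_T_def using i by (intro prod.remove) auto
      moreover have "monom_T n k' z = z i powi (k i - 1) * (\<Prod>j\<in>{..<n} - {i}. z j powi k j)"
        unfolding monom_T_def using i by (subst prod.remove[of _ i]) (auto simp: k'_def intro!: prod.cong)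
      \<comment> \<open>The recursion has to hold at every \<open>z\<close>, also where
        \<open>z i = 0\<close>, since functions are equated here and not classes modulo null sets.
        Positivity of \<open>k i\<close> ensures this.\<close>
      moreover have "z i powi k i = z i * z i powi (k i - 1)"
        using i(2) by (cases "k i = 1") (auto simp: power_int_def nat_diff_distrib simp flip: power_Suc)
      ultimately show "z i * monom_T n k' z = monom_T n k z" by simp
    qed
    ultimately show ?thesis by simp
  qed
qed

text \<open>On a monomial with exponent \<open>k\<close> the integral is the Fourier coefficient of
  \<open>c\<close> at \<open>- k\<close>. It vanishes for \<open>k = 0\<close> because
  \<open>c\<close> has mean zero, and otherwise because \<open>- k\<close> has a negative entry.
  Density of polynomials extends this to \<open>f\<close>.\<close>

lemma H2_integral_H2_0:
  assumes f: "f \<in> H2 n" and c: "c \<in> H2_0 n"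
  shows "(\<integral>z. f z * c z \<partial>torus_measure n) = 0"
proof -
  have cH: "c \<in> H2 n" and c0: "fourier n c (\<lambda>_. 0) = 0" using c by (auto simp: H2_0_def)
  have cL: "(\<lambda>z. cnj (c z)) \<in> L2 n" by (intro L2_cnj H2_L2 cH)
  have cm: "c \<in> borel_measurable (torus_measure n)" using H2_L2[OF cH] by auto
  obtain h where h: "\<forall>j::nat. h j \<in> trig_poly n (nonneg_exp n)"
    and lim: "(\<lambda>j. norm2 n (\<lambda>z. h j z - f z)) \<longlonglongrightarrow> 0" by (rule H2_dense[OF f])
  have hL: "h j \<in> L2 n" for j using L2_subspaceD(1)[OF L2_subspace_trig_poly spec[OF h]] .
  have mono: "inner2 n (monom_T n k) (\<lambda>z. cnj (c z)) = 0" if k: "k \<in> nonneg_exp n" for k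
  proof -
    have "inner2 n (monom_T n k) (\<lambda>z. cnj (c z)) = fourier n c (\<lambda>j. - k j)"
      unfolding inner2_def fourier_monom_neg[OF cm, symmetric] by (simp add: mult.commute)
    also have "\<dots> = 0"
    proof (cases "\<forall>j<n. k j = 0")
      case True
      then have "monom_T n (\<lambda>j. - k j) = monom_T n (\<lambda>_. 0)" by (intro monom_T_cong) simp
      then show ?thesis using c0 by (simp add: fourier_monom)
    next
      case False
      then obtain j where "j < n" "0 < k j" using k by (force simp: nonneg_exp_def order_le_less)
      then show ?thesis by (intro H2_fourier[of c n j, OF cH]) auto
    qed
    finally show ?thesis .
  qed
  have "inner2 n (h j) (\<lambda>z. cnj (c z)) = 0" for j
  proof -
    obtain m :: nat and a \<kappa> where hj: "\<forall>i<m. \<kappa> i \<in> nonneg_exp n" "h j = (\<lambda>z. \<Sum>i<m. a i * monom_T n (\<kappa> i) z)"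
      by (rule trig_polyE[OF spec[OF h, of j]])
    have "inner2 n (h j) (\<lambda>z. cnj (c z)) = (\<Sum>i<m. a i * inner2 n (monom_T n (\<kappa> i)) (\<lambda>z. cnj (c z)))"
      unfolding hj(2) by (intro inner2_sum_left L2_monom_T cL)
    also have "\<dots> = 0" using hj(1) mono by (intro sum.neutral) auto
    finally show ?thesis .
  qed
  then have "inner2 n f (\<lambda>z. cnj (c z)) = 0"
    using tendsto_inner2[OF hL H2_L2[OF f] lim cL] by (simp add: LIMSEQ_const_iff)
  then show ?thesis by (simp add: inner2_def)
qed

lemma H2_integral_M_space:
  assumes f: "f \<in> H2 n" and b: "b \<in> M_space n"
  shows "(\<integral>z. f z * b z \<partial>torus_measure n) = 0"
proof -
  have "(\<lambda>z. cnj (f z)) \<in> conj_set (H2 n)" using f by (auto simp: conj_set_def)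
  then have "inner2 n b (\<lambda>z. cnj (f z)) = 0" using b by (simp add: M_space_def)
  then show ?thesis by (simp add: inner2_def mult.commute)
qed

section \<open>Orthogonal projections\<close>

text \<open>Projections are determined only up to null sets, and \<open>projQ\<close> picks an
  arbitrary representative. The relation lets other representatives, notably values of
  \<open>X\<close>, serve as projections.\<close>

definition is_proj :: "nat \<Rightarrow> tfun set \<Rightarrow> tfun \<Rightarrow> tfun \<Rightarrow> bool" where
  "is_proj n Q f g \<longleftrightarrow> g \<in> Q \<and> (\<forall>h\<in>Q. inner2 n (\<lambda>z. f z - g z) h = 0)"

lemma L2_closed_subspaceD:
  assumes "L2_closed_subspace n Q"
  shows "L2_subspace n Q" "f \<in> Q \<Longrightarrow> g \<in> L2 n \<Longrightarrow> ae_eq n f g \<Longrightarrow> g \<in> Q"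
    "\<forall>k. F k \<in> Q \<Longrightarrow> g \<in> L2 n \<Longrightarrow> (\<lambda>k. norm2 n (\<lambda>z. F k z - g z)) \<longlonglongrightarrow> 0 \<Longrightarrow> g \<in> Q"
proof -
  note Q = assms[unfolded L2_closed_subspace_def]
  show "L2_subspace n Q"
    unfolding L2_subspace_def using Q by (elim conjE) (intro conjI; assumption)
  have "\<forall>f\<in>Q. \<forall>g\<in>L2 n. ae_eq n f g \<longrightarrow> g \<in> Q" using Q by (elim conjE)
  then show "f \<in> Q \<Longrightarrow> g \<in> L2 n \<Longrightarrow> ae_eq n f g \<Longrightarrow> g \<in> Q" by blast
  have "\<forall>F g. (\<forall>k. F k \<in> Q) \<longrightarrow> g \<in> L2 n \<longrightarrow>
        (\<lambda>k. norm2 n (\<lambda>z. F k z - g z)) \<longlonglongrightarrow> 0 \<longrightarrow> g \<in> Q" using Q by (elim conjE)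
  note * = mp[OF mp[OF mp[OF spec[OF spec[OF this]]]]]
  show "\<forall>k. F k \<in> Q \<Longrightarrow> g \<in> L2 n \<Longrightarrow> (\<lambda>k. norm2 n (\<lambda>z. F k z - g z)) \<longlonglongrightarrow> 0 \<Longrightarrow> g \<in> Q"
    by (rule *)
qed

context
  fixes n :: nat and Q :: "tfun set"
  assumes Q: "L2_closed_subspace n Q"
begin

lemma Q_L2: "f \<in> Q \<Longrightarrow> f \<in> L2 n"
  by (rule L2_subspaceD(1)[OF L2_closed_subspaceD(1)[OF Q]])

text \<open>Closedness of \<open>Q\<close> puts the limit \<open>p\<close> into \<open>Q\<close>, so
  the choice in \<open>projQ\<close> has a witness.\<close>

lemma is_proj_projQ:
  assumes f: "f \<in> L2 n" shows "is_proj n Q f (projQ n Q f)"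
proof -
  obtain h p where h: "\<forall>j::nat. h j \<in> Q" and p: "p \<in> L2 n"
    and lim: "(\<lambda>j. norm2 n (\<lambda>z. h j z - p z)) \<longlonglongrightarrow> 0"
    and orth: "\<forall>v\<in>Q. inner2 n (\<lambda>z. f z - p z) v = 0"
  proof -
    show thesis by (rule projection_closure[OF L2_closed_subspaceD(1)[OF Q] f]) (rule that)
  qed
  have "p \<in> Q" by (rule L2_closed_subspaceD(3)[OF Q h p lim])
  with orth have "p \<in> Q \<and> (\<forall>h\<in>Q. inner2 n (\<lambda>z. f z - p z) h = 0)" by blast
  then show ?thesis unfolding is_proj_def projQ_def by (rule someI[of "\<lambda>g. g \<in> Q \<and> (\<forall>h\<in>Q. inner2 n (\<lambda>z. f z - g z) h = 0)"])
qed

lemma is_proj_inner2: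
  assumes "is_proj n Q f g" "f \<in> L2 n" "q \<in> Q" shows "inner2 n f q = inner2 n g q"
proof -
  have "g \<in> L2 n" using assms(1) by (simp add: is_proj_def Q_L2)
  then show ?thesis
    using assms inner2_diff_left[OF assms(2) _ Q_L2[OF assms(3)], of g] by (simp add: is_proj_def)
qed

lemma is_projI:
  assumes "f \<in> L2 n" "g \<in> Q" "\<And>q. q \<in> Q \<Longrightarrow> inner2 n f q = inner2 n g q"
  shows "is_proj n Q f g"
  unfolding is_proj_def
  using assms inner2_diff_left[OF assms(1) Q_L2[OF assms(2)] Q_L2] by simp

lemma is_proj_in: "is_proj n Q f g \<Longrightarrow> g \<in> Q"
  by (simp add: is_proj_def)

lemma is_proj_unique:
  assumes "is_proj n Q f g" "is_proj n Q f g'" "f \<in> L2 n" shows "ae_eq n g g'"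
proof -
  have gQ: "g \<in> Q" "g' \<in> Q" using assms is_proj_in by auto
  have dQ: "(\<lambda>z. g z - g' z) \<in> Q" by (rule L2_subspaceD(5)[OF L2_closed_subspaceD(1)[OF Q] gQ])
  have "inner2 n (\<lambda>z. g z - g' z) (\<lambda>z. g z - g' z) = inner2 n g (\<lambda>z. g z - g' z) - inner2 n g' (\<lambda>z. g z - g' z)"
    by (rule inner2_diff_left[OF Q_L2[OF gQ(1)] Q_L2[OF gQ(2)] Q_L2[OF dQ]])
  also have "\<dots> = 0"
    using is_proj_inner2[OF assms(1,3) dQ] is_proj_inner2[OF assms(2,3) dQ] by simp
  finally have "norm2 n (\<lambda>z. g z - g' z) = 0" by (simp add: inner2_self)
  then show ?thesis by (simp add: norm2_eq_0_iff[OF Q_L2[OF dQ]] ae_eq_def)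
qed

lemma is_proj_cong_AE:
  assumes "is_proj n Q f g" "f \<in> L2 n" "g' \<in> Q" "ae_eq n g g'"
  shows "is_proj n Q f g'"
proof (rule is_projI[OF assms(2,3)])
  fix q assume q: "q \<in> Q"
  have "inner2 n g q = inner2 n g' q"
    using assms(4) is_proj_in[OF assms(1)] by (intro inner2_cong_AE Q_L2 q assms(3)) (auto simp: ae_eq_def)
  then show "inner2 n f q = inner2 n g' q" using is_proj_inner2[OF assms(1,2) q] by simp
qed

lemma is_proj_linear:
  assumes "is_proj n Q f g" "is_proj n Q f' g'" "f \<in> L2 n" "f' \<in> L2 n"
  shows "is_proj n Q (\<lambda>z. a * f z + b * f' z) (\<lambda>z. a * g z + b * g' z)"
proof (rule is_projI)
  note V = L2_closed_subspaceD(1)[OF Q]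
  have g: "g \<in> Q" "g' \<in> Q" using assms is_proj_in by auto
  show "(\<lambda>z. a * f z + b * f' z) \<in> L2 n" by (intro L2_add L2_cmult assms)
  show "(\<lambda>z. a * g z + b * g' z) \<in> Q" by (rule L2_subspaceD(3)[OF V L2_subspaceD(4)[OF V g(1)] L2_subspaceD(4)[OF V g(2)]])
  fix q assume q: "q \<in> Q"
  have "inner2 n (\<lambda>z. a * f z + b * f' z) q = a * inner2 n f q + b * inner2 n f' q"
    by (subst inner2_add_left) (simp_all add: L2_cmult assms Q_L2 q inner2_cmult_left)
  moreover have "inner2 n (\<lambda>z. a * g z + b * g' z) q = a * inner2 n g q + b * inner2 n g' q"
    by (subst inner2_add_left) (simp_all add: L2_cmult g Q_L2 q inner2_cmult_left)
  ultimately show "inner2 n (\<lambda>z. a * f z + b * f' z) q = inner2 n (\<lambda>z. a * g z + b * g' z) q"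
    using is_proj_inner2[OF assms(1,3) q] is_proj_inner2[OF assms(2,4) q] by simp
qed

lemma is_proj_norm2_le:
  assumes "is_proj n Q f g" "f \<in> L2 n" shows "norm2 n g \<le> norm2 n f"
proof (cases "norm2 n g = 0")
  case False
  have g: "g \<in> Q" using assms is_proj_in by auto
  have "complex_of_real ((norm2 n g)\<^sup>2) = inner2 n f g"
    using is_proj_inner2[OF assms g] by (simp only: inner2_self)
  then have "cmod (complex_of_real ((norm2 n g)\<^sup>2)) \<le> norm2 n f * norm2 n g"
    using cmod_inner2_le[OF assms(2) Q_L2[OF g]] by simp
  then have "norm2 n g * norm2 n g \<le> norm2 n f * norm2 n g"
    unfolding norm_of_real by (simp add: power2_eq_square)
  then show ?thesis using False norm2_nonneg[of n g] by (simp add: mult_le_cancel_right)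
qed simp

lemma is_proj_self: "f \<in> Q \<Longrightarrow> is_proj n Q f f"
  by (rule is_projI[OF Q_L2 _ refl])

end

section \<open>Quotient modules and lifting\<close>

lemma quotient_moduleD:
  assumes "quotient_module n Q"
  shows "L2_closed_subspace n Q" "f \<in> Q \<Longrightarrow> f \<in> H2 n"
  using assms by (auto simp: quotient_module_def)

text \<open>Invariance of \<open>Q\<close> under the adjoint of a coordinate multiplication is
  invariance of its complement under the multiplication itself.\<close>

lemma quotient_module_orth_coord:
  assumes "quotient_module n Q" "i < n" "h \<in> H2 n" and orth: "\<And>q. q \<in> Q \<Longrightarrow> inner2 n h q = 0" and "q \<in> Q"
  shows "inner2 n (\<lambda>z. z i * h z) q = 0"
proof -
  have "\<exists>g\<in>Q. \<forall>h\<in>H2 n. inner2 n (\<lambda>z. z i * h z) q = inner2 n h g"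
    using assms unfolding quotient_module_def by blast
  then obtain g where "g \<in> Q" "inner2 n (\<lambda>z. z i * h z) q = inner2 n h g" using assms(3) by blast
  then show ?thesis using orth by simp
qed

lemma quotient_module_orth_monom:
  assumes Q: "quotient_module n Q" and h: "h \<in> H2 n" and orth: "\<And>q. q \<in> Q \<Longrightarrow> inner2 n h q = 0"
    and k: "k \<in> nonneg_exp n"
  shows "\<forall>q\<in>Q. inner2 n (\<lambda>z. monom_T n k z * h z) q = 0"
  using k
proof (induction rule: monom_T_induct)
  case one then show ?case using orth by simp
next
  case (mult i k)
  show ?case
  proof
    fix q assume q: "q \<in> Q"
    have "inner2 n (\<lambda>z. z i * (monom_T n k z * h z)) q = 0"
      by (rule quotient_module_orth_coord[OF Q mult(1) H2_monom_T_mult[OF h mult(2)] bspec[OF mult(3)] q])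
    then show "inner2 n (\<lambda>z. z i * monom_T n k z * h z) q = 0" by (simp add: mult.assoc)
  qed
qed

text \<open>At every exponent one of two factors vanishes: nonnegative exponents preserve the
  complement of \<open>Q\<close>, and all others are absent from the Fourier series of
  \<open>\<phi>\<close>.\<close>

lemma quotient_module_orth_bounded:
  assumes Q: "quotient_module n Q" and h: "h \<in> H2 n" and orth: "\<And>q. q \<in> Q \<Longrightarrow> inner2 n h q = 0"
    and \<phi>: "\<phi> \<in> schur_ball n" and q: "q \<in> Q"
  shows "inner2 n (\<lambda>z. \<phi> z * h z) q = 0"
proof (rule inner2_bounded_mult_eq_0)
  have \<phi>H: "\<phi> \<in> H2 n" using \<phi> by (simp add: schur_ball_def)
  show "\<phi> \<in> borel_measurable (torus_measure n)" using H2_L2[OF \<phi>H] by auto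
  show "AE z in torus_measure n. cmod (\<phi> z) \<le> 1" using \<phi> by (simp add: schur_ball_def)
  show "h \<in> L2 n" "q \<in> L2 n" using h quotient_moduleD(2)[OF Q q] by (auto intro: H2_L2)
  fix k show "fourier n \<phi> k = 0 \<or> inner2 n (\<lambda>z. monom_T n k z * h z) q = 0"
  proof (cases "k \<in> nonneg_exp n")
    case True
    then show ?thesis using bspec[OF quotient_module_orth_monom[OF Q h orth True] q] by simp
  next
    case False
    then obtain j where "j < n" "k j < 0" by (auto simp: nonneg_exp_def)
    then show ?thesis using H2_fourier[of \<phi> n j k, OF \<phi>H] by simp
  qed
qed

section \<open>The space \<open>M_tilde\<close> and the distance condition\<close>

lemma M_tildeI:
  assumes "q \<in> Q" "inner2 n \<psi> q = 0" "b \<in> M_space n" "c \<in> H2_0 n"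
  shows "(\<lambda>z. cnj (q z) + b z + c z) \<in> M_tilde n Q \<psi>"
proof -
  have "(\<lambda>z. cnj (q z)) \<in> conj_set Q" using assms(1) by (auto simp: conj_set_def)
  moreover have "inner2 n (\<lambda>z. cnj (q z)) (\<lambda>z. cnj (\<psi> z)) = 0"
    using assms(2) by (simp add: inner2_def mult.commute)
  ultimately show ?thesis unfolding M_tilde_def mem_Collect_eq using assms(3,4)
    by (intro exI[of _ "\<lambda>z. cnj (q z)"] exI[of _ b] exI[of _ c] conjI refl)
qed

lemma M_tildeE:
  assumes "m \<in> M_tilde n Q \<psi>"
  obtains q b c where "q \<in> Q" "inner2 n \<psi> q = 0" "b \<in> M_space n" "c \<in> H2_0 n"
    "m = (\<lambda>z. cnj (q z) + b z + c z)"
proof -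
  obtain a b c where abc: "m = (\<lambda>z. a z + b z + c z)" "a \<in> conj_set Q"
    "inner2 n a (\<lambda>z. cnj (\<psi> z)) = 0" "b \<in> M_space n" "c \<in> H2_0 n"
    using assms unfolding M_tilde_def mem_Collect_eq by (elim exE conjE) (rule that)
  obtain q where q: "q \<in> Q" "a = (\<lambda>z. cnj (q z))"
    using abc(2) unfolding conj_set_def mem_Collect_eq by (elim exE conjE) (rule that)
  have "inner2 n \<psi> q = 0" using abc(3) unfolding q(2) by (simp add: inner2_def mult.commute)
  with q abc show thesis by (intro that[of q b c]) auto
qed

lemma M_space_L2: "b \<in> M_space n \<Longrightarrow> b \<in> L2 n"
  by (simp add: M_space_def)

lemma H2_0_L2: "c \<in> H2_0 n \<Longrightarrow> c \<in> L2 n"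
  by (simp add: H2_0_def H2_def)

lemma M_space_linear:
  assumes "f \<in> M_space n" "g \<in> M_space n" shows "(\<lambda>z. a * f z + b * g z) \<in> M_space n"
proof -
  have L: "f \<in> L2 n" "g \<in> L2 n" using assms by (auto simp: M_space_def)
  have "inner2 n (\<lambda>z. a * f z + b * g z) h = 0" if h: "h \<in> H2 n \<union> conj_set (H2 n)" for h
  proof -
    have hL: "h \<in> L2 n" using h by (auto simp: conj_set_def intro: H2_L2 L2_cnj)
    have "inner2 n (\<lambda>z. a * f z + b * g z) h = a * inner2 n f h + b * inner2 n g h"
      by (subst inner2_add_left) (simp_all add: L2_cmult L hL inner2_cmult_left)
    also have "\<dots> = 0" using assms h by (simp add: M_space_def)
    finally show ?thesis .
  qed
  moreover have "(\<lambda>z. a * f z + b * g z) \<in> L2 n" by (intro L2_add L2_cmult L)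
  ultimately show ?thesis by (simp add: M_space_def)
qed

lemma H2_0_linear:
  assumes "f \<in> H2_0 n" "g \<in> H2_0 n" shows "(\<lambda>z. a * f z + b * g z) \<in> H2_0 n"
proof -
  have H: "f \<in> H2 n" "g \<in> H2 n" using assms by (auto simp: H2_0_def)
  have "fourier n (\<lambda>z. a * f z + b * g z) (\<lambda>_. 0) = a * fourier n f (\<lambda>_. 0) + b * fourier n g (\<lambda>_. 0)"
    unfolding fourier_inner2
    by (subst inner2_add_left) (simp_all add: L2_cmult H2_L2 H L2_monom_T inner2_cmult_left)
  with assms H2_add[OF H2_cmult[OF H(1)] H2_cmult[OF H(2)]] show ?thesis by (simp add: H2_0_def)
qed

lemma M_tilde_linear:
  assumes V: "L2_subspace n Q" and \<psi>: "\<psi> \<in> L2 n" and m: "m \<in> M_tilde n Q \<psi>" "m' \<in> M_tilde n Q \<psi>"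
  shows "(\<lambda>z. a * m z + a' * m' z) \<in> M_tilde n Q \<psi>"
proof -
  obtain q b c where q: "q \<in> Q" "inner2 n \<psi> q = 0" "b \<in> M_space n" "c \<in> H2_0 n"
    and m_eq: "m = (\<lambda>z. cnj (q z) + b z + c z)" by (rule M_tildeE[OF m(1)])
  obtain q' b' c' where q': "q' \<in> Q" "inner2 n \<psi> q' = 0" "b' \<in> M_space n" "c' \<in> H2_0 n"
    and m'_eq: "m' = (\<lambda>z. cnj (q' z) + b' z + c' z)" by (rule M_tildeE[OF m(2)])
  have qL: "q \<in> L2 n" "q' \<in> L2 n" using L2_subspaceD(1)[OF V] q q' by auto
  \<comment> \<open>The coefficients reach \<open>Q\<close> conjugated because its elements enter
    the sum as conjugates.\<close>
  have "(\<lambda>z. cnj (cnj a * q z + cnj a' * q' z) + (a * b z + a' * b' z) + (a * c z + a' * c' z)) \<in> M_tilde n Q \<psi>"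
  proof (rule M_tildeI)
    show "(\<lambda>z. cnj a * q z + cnj a' * q' z) \<in> Q"
      by (rule L2_subspaceD(3)[OF V L2_subspaceD(4)[OF V q(1)] L2_subspaceD(4)[OF V q'(1)]])
    show "inner2 n \<psi> (\<lambda>z. cnj a * q z + cnj a' * q' z) = 0"
      by (subst inner2_add_right) (simp_all add: L2_cmult qL \<psi> inner2_cmult_right q q')
  qed (intro M_space_linear H2_0_linear q q')+
  then show ?thesis by (simp add: m_eq m'_eq algebra_simps)
qed

lemma H2_0_zero: "(\<lambda>z. 0) \<in> H2_0 n"
  using L2_zero by (auto simp: H2_0_def H2_def fourier_def)

lemma M_space_zero: "(\<lambda>z. 0) \<in> M_space n"
  using L2_zero by (auto simp: M_space_def inner2_def)

lemma M_tilde_0: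
  assumes "L2_subspace n Q" shows "(\<lambda>z. 0) \<in> M_tilde n Q \<psi>"
  using M_tildeI[OF L2_subspaceD(2)[OF assms] _ M_space_zero H2_0_zero, where \<psi>=\<psi>] by (simp add: inner2_def)

lemma M_tilde_L2:
  assumes "L2_subspace n Q" "m \<in> M_tilde n Q \<psi>" shows "m \<in> L2 n"
proof -
  obtain q b c where q: "q \<in> Q" "inner2 n \<psi> q = 0" "b \<in> M_space n" "c \<in> H2_0 n"
    and m_eq: "m = (\<lambda>z. cnj (q z) + b z + c z)" by (rule M_tildeE[OF assms(2)])
  show ?thesis
    unfolding m_eq
    by (intro L2_add L2_cnj L2_subspaceD(1)[OF assms(1) q(1)] M_space_L2[OF q(3)] H2_0_L2[OF q(4)])
qed

text \<open>Both \<open>\<psi>\<close> itself and a symbol \<open>\<phi>\<close> with \<open>P\<^sub>Q \<phi> = \<psi>\<close> annihilate the space.\<close>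

lemma M_tilde_annihilate:
  assumes V: "L2_subspace n Q" and f: "f \<in> H2 n" and eq: "\<And>q. q \<in> Q \<Longrightarrow> inner2 n f q = inner2 n \<psi> q"
    and m: "m \<in> M_tilde n Q \<psi>"
  shows "(\<integral>z. f z * m z \<partial>torus_measure n) = 0"
proof -
  obtain q b c where q: "q \<in> Q" "inner2 n \<psi> q = 0" "b \<in> M_space n" "c \<in> H2_0 n"
    and m_eq: "m = (\<lambda>z. cnj (q z) + b z + c z)" by (rule M_tildeE[OF m])
  have L: "(\<lambda>z. cnj (q z)) \<in> L2 n" "b \<in> L2 n" "c \<in> L2 n"
    using L2_subspaceD(1)[OF V q(1)] q by (auto intro: L2_cnj M_space_L2 H2_0_L2)
  have "(\<integral>z. f z * m z \<partial>torus_measure n) = (\<integral>z. (f z * cnj (q z) + f z * b z) + f z * c z \<partial>torus_measure n)"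
    unfolding m_eq by (simp add: algebra_simps)
  also have "\<dots> = (\<integral>z. f z * cnj (q z) \<partial>torus_measure n) + (\<integral>z. f z * b z \<partial>torus_measure n)
      + (\<integral>z. f z * c z \<partial>torus_measure n)"
    by (subst Bochner_Integration.integral_add; (subst Bochner_Integration.integral_add)?)
       (auto intro!: L2_mult_integrable Bochner_Integration.integrable_add H2_L2[OF f] L)
  also have "(\<integral>z. f z * cnj (q z) \<partial>torus_measure n) = 0"
    using eq[OF q(1)] q(2) by (simp add: inner2_def)
  finally show ?thesis using H2_integral_M_space[OF f q(3)] H2_integral_H2_0[OF f q(4)] by simp
qed

lemma schur_ball_dist_ge_1:
  assumes V: "L2_subspace n Q" and \<psi>: "\<psi> \<in> Q" "norm2 n \<psi> \<noteq> 0"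
    and \<phi>: "\<phi> \<in> schur_ball n" and eq: "\<And>q. q \<in> Q \<Longrightarrow> inner2 n \<phi> q = inner2 n \<psi> q"
  shows "1 \<le> dist_L1 n (\<lambda>z. cnj (\<psi> z) / complex_of_real ((norm2 n \<psi>)\<^sup>2)) (M_tilde n Q \<psi>)"
  unfolding dist_L1_def
proof (rule cINF_greatest)
  show "M_tilde n Q \<psi> \<noteq> {}" using M_tilde_0[OF V] by blast
  fix m assume m: "m \<in> M_tilde n Q \<psi>"
  have \<phi>H: "\<phi> \<in> H2 n" and \<phi>1: "AE z in torus_measure n. cmod (\<phi> z) \<le> 1" using \<phi> by (auto simp: schur_ball_def)
  define r where "r = complex_of_real ((norm2 n \<psi>)\<^sup>2)"
  have r: "r \<noteq> 0" using \<psi>(2) by (simp add: r_def)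
  have \<psi>L: "\<psi> \<in> L2 n" using L2_subspaceD(1)[OF V \<psi>(1)] .
  have mL: "m \<in> L2 n" by (rule M_tilde_L2[OF V m])
  have gL: "(\<lambda>z. cnj (\<psi> z) / r) \<in> L2 n" using L2_cmult[OF L2_cnj[OF \<psi>L], of "1/r"] by simp
  have \<phi>L: "\<phi> \<in> L2 n" by (rule H2_L2[OF \<phi>H])
  have dL: "(\<lambda>z. cnj (\<psi> z) / r - m z) \<in> L2 n" by (rule L2_diff[OF gL mL])
  have "(\<integral>z. \<phi> z * (cnj (\<psi> z) / r - m z) \<partial>torus_measure n)
      = (\<integral>z. \<phi> z * (cnj (\<psi> z) / r) \<partial>torus_measure n) - (\<integral>z. \<phi> z * m z \<partial>torus_measure n)"
    unfolding right_diff_distrib by (intro Bochner_Integration.integral_diff L2_mult_integrable \<phi>L gL mL)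
  also have "(\<integral>z. \<phi> z * m z \<partial>torus_measure n) = 0" by (rule M_tilde_annihilate[OF V \<phi>H eq m])
  also have "(\<integral>z. \<phi> z * (cnj (\<psi> z) / r) \<partial>torus_measure n) = inner2 n \<phi> \<psi> / r"
    by (simp add: inner2_def)
  also have "inner2 n \<phi> \<psi> = r" unfolding eq[OF \<psi>(1)] r_def by (rule inner2_self)
  finally have "1 = cmod (\<integral>z. \<phi> z * (cnj (\<psi> z) / r - m z) \<partial>torus_measure n)" using r by simp
  also have "\<dots> \<le> (\<integral>z. cmod (\<phi> z * (cnj (\<psi> z) / r - m z)) \<partial>torus_measure n)"
    by (rule integral_norm_bound)
  also have "\<dots> \<le> norm1 n (\<lambda>z. cnj (\<psi> z) / r - m z)"
    unfolding norm1_def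
  proof (rule integral_mono_AE)
    show "integrable (torus_measure n) (\<lambda>z. cmod (\<phi> z * (cnj (\<psi> z) / r - m z)))"
      by (intro integrable_norm L2_mult_integrable \<phi>L dL)
    show "integrable (torus_measure n) (\<lambda>z. cmod (cnj (\<psi> z) / r - m z))"
      by (intro integrable_norm L2_integrable dL)
    show "AE z in torus_measure n. cmod (\<phi> z * (cnj (\<psi> z) / r - m z)) \<le> cmod (cnj (\<psi> z) / r - m z)"
      using \<phi>1 by eventually_elim (simp add: norm_mult mult_left_le_one_le)
  qed
  finally show "1 \<le> norm1 n (\<lambda>z. cnj (\<psi> z) / complex_of_real ((norm2 n \<psi>)\<^sup>2) - m z)" unfolding r_def .
qed

text \<open>The exponent has a negative entry. If it also has a positive one, neither the monomial
  nor its conjugate is analytic, and the conjugate lies in \<open>M_space\<close>. Otherwise the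
  conjugate is the monomial with exponent \<open>- k\<close>, analytic and without constant term, so
  it lies in \<open>H2_0\<close>. Testing against these elements forces the symbol into
  \<open>H2\<close>.\<close>

lemma cnj_monom_T_in_M_tilde:
  assumes V: "L2_subspace n Q" and j: "j < n" "k j < 0"
  shows "(\<lambda>z. cnj (monom_T n k z)) \<in> M_tilde n Q \<psi>"
proof -
  have L: "(\<lambda>z. cnj (monom_T n k z)) \<in> L2 n" by (intro L2_cnj L2_monom_T)
  have Z: "(\<lambda>z. 0) \<in> Q" "inner2 n \<psi> (\<lambda>z. 0) = 0" using L2_subspaceD(2)[OF V] by (auto simp: inner2_def)
  show ?thesis
  proof (cases "\<exists>i<n. 0 < k i")
    case True
    then obtain i where i: "i < n" "0 < k i" by blast
    have "inner2 n (\<lambda>z. cnj (monom_T n k z)) g = 0" if "g \<in> H2 n \<union> conj_set (H2 n)" for g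
      using that
    proof
      assume g: "g \<in> H2 n"
      have gm: "g \<in> borel_measurable (torus_measure n)" using H2_L2[OF g] by auto
      have "inner2 n (\<lambda>z. cnj (monom_T n k z)) g = cnj (\<integral>z. g z * monom_T n k z \<partial>torus_measure n)"
        unfolding inner2_def Bochner_Integration.integral_cnj[symmetric] by (simp add: mult.commute)
      also have "\<dots> = 0"
        unfolding fourier_monom_neg[OF gm] using H2_fourier[of g n i "\<lambda>j. - k j", OF g i(1)] i by simp
      finally show ?thesis .
    next
      assume "g \<in> conj_set (H2 n)"
      then obtain f where f: "f \<in> H2 n" "g = (\<lambda>z. cnj (f z))" by (auto simp: conj_set_def)
      have "inner2 n (\<lambda>z. cnj (monom_T n k z)) g = fourier n f k"
        unfolding f inner2_def fourier_monom by (simp add: mult.commute)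
      then show ?thesis using H2_fourier[of f n j k, OF f(1) j] by simp
    qed
    then have "(\<lambda>z. cnj (monom_T n k z)) \<in> M_space n" using L by (simp add: M_space_def)
    from M_tildeI[OF Z this H2_0_zero] show ?thesis by simp
  next
    case False
    have f: "fourier n (\<lambda>z. cnj (monom_T n k z)) l = 0" if l: "\<exists>i<n. l i + k i < 0" for l
    proof -
      have ne: "\<not> (\<forall>j<n. k j + l j = 0)" using l by force
      have "fourier n (\<lambda>z. cnj (monom_T n k z)) l = cnj (\<integral>z. monom_T n k z * monom_T n l z \<partial>torus_measure n)"
        unfolding fourier_monom Bochner_Integration.integral_cnj[symmetric] by simp
      also have "(\<integral>z. monom_T n k z * monom_T n l z \<partial>torus_measure n)
          = (\<integral>z. monom_T n (\<lambda>j. k j + l j) z \<partial>torus_measure n)"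
      proof (rule integral_cong_AE)
        show "AE z in torus_measure n. monom_T n k z * monom_T n l z = monom_T n (\<lambda>j. k j + l j) z"
          using AE_torus[of n] by eventually_elim (rule monom_T_mult)
      qed measurable
      also have "\<dots> = 0" unfolding integral_monom_T using ne by (simp only: if_False)
      finally show ?thesis by simp
    qed
    have "(\<lambda>z. cnj (monom_T n k z)) \<in> H2 n"
    proof (rule H2I[OF L])
      fix l :: "nat \<Rightarrow> int" and i assume i: "i < n" "l i < 0"
      show "fourier n (\<lambda>z. cnj (monom_T n k z)) l = 0"
        by (rule f, rule exI[of _ i]) (use i False in force)
    qed
    moreover have "fourier n (\<lambda>z. cnj (monom_T n k z)) (\<lambda>_. 0) = 0" using j by (intro f) auto
    ultimately have "(\<lambda>z. cnj (monom_T n k z)) \<in> H2_0 n" by (simp add: H2_0_def)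
    from M_tildeI[OF Z M_space_zero this] show ?thesis by simp
  qed
qed

lemma dist_ge_1_schur_ball:
  assumes V: "L2_subspace n Q" and \<psi>: "\<psi> \<in> Q" "\<psi> \<in> H2 n" "norm2 n \<psi> \<noteq> 0"
    and dist: "1 \<le> dist_L1 n (\<lambda>z. cnj (\<psi> z) / complex_of_real ((norm2 n \<psi>)\<^sup>2)) (M_tilde n Q \<psi>)"
  obtains \<phi> where "\<phi> \<in> schur_ball n" "\<forall>q\<in>Q. inner2 n \<phi> q = inner2 n \<psi> q"
proof -
  define r where "r = complex_of_real ((norm2 n \<psi>)\<^sup>2)"
  have r: "r \<noteq> 0" "cnj r = r" using \<psi>(3) by (simp_all add: r_def)
  have \<psi>L: "\<psi> \<in> L2 n" by (rule H2_L2[OF \<psi>(2)])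
  have \<psi>\<psi>: "inner2 n \<psi> \<psi> = r" unfolding r_def by (rule inner2_self)
  have ge: "1 \<le> norm1 n (\<lambda>z. cnj (\<psi> z) / r - m z)" if m: "m \<in> M_tilde n Q \<psi>" for m
  proof -
    have "dist_L1 n (\<lambda>z. cnj (\<psi> z) / r) (M_tilde n Q \<psi>) \<le> norm1 n (\<lambda>z. cnj (\<psi> z) / r - m z)"
      unfolding dist_L1_def by (rule cINF_lower[OF _ m]) (auto intro!: bdd_belowI[of _ 0] simp: norm1_def)
    with dist show ?thesis unfolding r_def by simp
  qed
  \<comment> \<open>\<open>inner2\<close> is conjugate linear in its second argument, so the span of
    \<open>M_tilde\<close> and \<open>cnj \<psi>\<close> appears here conjugated.\<close>
  define W where "W = {h. \<exists>m c. m \<in> M_tilde n Q \<psi> \<and> h = (\<lambda>z. cnj (m z) + c * \<psi> z)}"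
  have WI: "h \<in> W" if "m \<in> M_tilde n Q \<psi>" "h = (\<lambda>z. cnj (m z) + c * \<psi> z)" for h m c
    using that unfolding W_def mem_Collect_eq by (intro exI conjI)
  have WE: thesis if "h \<in> W" "\<And>m c. m \<in> M_tilde n Q \<psi> \<Longrightarrow> h = (\<lambda>z. cnj (m z) + c * \<psi> z) \<Longrightarrow> thesis" for h thesis
    using that(1) unfolding W_def mem_Collect_eq by (elim exE conjE) (rule that(2))
  have WL: "L2_subspace n W"
    unfolding L2_subspace_def
  proof (intro conjI ballI allI subsetI)
    fix h assume "h \<in> W"
    then obtain m c where m: "m \<in> M_tilde n Q \<psi>" "h = (\<lambda>z. cnj (m z) + c * \<psi> z)" by (rule WE)
    show "h \<in> L2 n" unfolding m(2) by (intro L2_add L2_cnj L2_cmult \<psi>L M_tilde_L2[OF V m(1)])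
  next
    show "(\<lambda>z. 0) \<in> W" by (rule WI[OF M_tilde_0[OF V], of _ 0]) simp
  next
    fix h h' assume hh: "h \<in> W" "h' \<in> W"
    obtain m c where m: "m \<in> M_tilde n Q \<psi>" "h = (\<lambda>z. cnj (m z) + c * \<psi> z)" by (rule WE[OF hh(1)])
    obtain m' c' where m': "m' \<in> M_tilde n Q \<psi>" "h' = (\<lambda>z. cnj (m' z) + c' * \<psi> z)" by (rule WE[OF hh(2)])
    show "(\<lambda>z. h z + h' z) \<in> W"
      by (rule WI[OF M_tilde_linear[OF V \<psi>L m(1) m'(1), of 1 1], of _ "c + c'"])
         (simp add: m m' algebra_simps)
  next
    fix a h assume "h \<in> W"
    then obtain m c where m: "m \<in> M_tilde n Q \<psi>" "h = (\<lambda>z. cnj (m z) + c * \<psi> z)" by (rule WE)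
    show "(\<lambda>z. a * h z) \<in> W"
      by (rule WI[OF M_tilde_linear[OF V \<psi>L m(1) m(1), of "cnj a" 0], of _ "a * c"])
         (simp add: m algebra_simps)
  qed
  have le: "cmod (inner2 n \<psi> h) \<le> norm1 n h" if h: "h \<in> W" for h
  proof -
    obtain m c where m: "m \<in> M_tilde n Q \<psi>" and h_eq: "h = (\<lambda>z. cnj (m z) + c * \<psi> z)" by (rule WE[OF h])
    have mL: "(\<lambda>z. cnj (m z)) \<in> L2 n" by (intro L2_cnj M_tilde_L2[OF V m])
    have "inner2 n \<psi> (\<lambda>z. cnj (m z)) = 0"
      using M_tilde_annihilate[OF V \<psi>(2) refl m] by (simp add: inner2_def)
    then have ip: "inner2 n \<psi> h = cnj c * r"
      unfolding h_eq inner2_add_right[OF mL L2_cmult[OF \<psi>L] \<psi>L] inner2_cmult_right \<psi>\<psi> by simp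
    show ?thesis
    proof (cases "c = 0")
      case True then show ?thesis using ip by (simp add: norm1_def)
    next
      case False
      \<comment> \<open>This is the value \<open>inner2 n \<psi> h\<close>. Pulling it out of
        \<open>cnj h\<close> leaves the difference of \<open>cnj \<psi> / r\<close> and an element
        of \<open>M_tilde\<close>, to which the distance hypothesis applies. The term with factor
        \<open>0\<close> below only matches the two-term combination in
        \<open>M_tilde_linear\<close>.\<close>
      define a where "a = cnj c * r"
      have a: "a \<noteq> 0" using False r by (simp add: a_def)
      have "cmod (h z) = cmod a * cmod (cnj (\<psi> z) / r - ((- 1 / a) * m z + 0 * m z))" for z
      proof -
        have "cmod (h z) = cmod (cnj (h z))" by simp
        also have "cnj (h z) = a * (cnj (\<psi> z) / r - ((- 1 / a) * m z + 0 * m z))"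
          using a r by (simp add: h_eq a_def field_simps)
        finally show ?thesis by (simp add: norm_mult)
      qed
      then have "norm1 n h = cmod a * norm1 n (\<lambda>z. cnj (\<psi> z) / r - ((- 1 / a) * m z + 0 * m z))"
        unfolding norm1_def by simp
      moreover have "1 \<le> norm1 n (\<lambda>z. cnj (\<psi> z) / r - ((- 1 / a) * m z + 0 * m z))"
        by (rule ge[OF M_tilde_linear[OF V \<psi>L m m]])
      ultimately have "cmod a * 1 \<le> norm1 n h" by (simp only:) (rule mult_left_mono, auto)
      then show ?thesis using ip by (simp add: a_def)
    qed
  qed
  obtain \<phi> where \<phi>L: "\<phi> \<in> L2 n" and \<phi>1: "AE z in torus_measure n. cmod (\<phi> z) \<le> 1"
    and \<phi>W: "\<forall>h\<in>W. inner2 n \<phi> h = inner2 n \<psi> h"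
    by (rule L1_bounded_functional_representation[OF WL \<psi>L le])
  have "\<phi> \<in> H2 n"
  proof (rule H2I[OF \<phi>L])
    fix k :: "nat \<Rightarrow> int" and j assume j: "j < n" "k j < 0"
    have "monom_T n k \<in> W"
      by (rule WI[OF cnj_monom_T_in_M_tilde[of n Q j k, OF V j], of _ 0]) simp
    then have "fourier n \<phi> k = fourier n \<psi> k" using \<phi>W unfolding fourier_inner2 by blast
    then show "fourier n \<phi> k = 0" using H2_fourier[of \<psi> n j k, OF \<psi>(2) j] by simp
  qed
  then have "\<phi> \<in> schur_ball n" using \<phi>1 by (simp add: schur_ball_def)
  moreover have "\<forall>q\<in>Q. inner2 n \<phi> q = inner2 n \<psi> q"
  proof
    fix q assume q: "q \<in> Q"
    \<comment> \<open>The coefficient of the projection of \<open>q\<close> onto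
      \<open>\<psi>\<close>. What remains is orthogonal to \<open>\<psi>\<close>, so its conjugate
      lies in \<open>M_tilde\<close>, and hence \<open>q\<close> in \<open>W\<close>.\<close>
    define c where "c = inner2 n q \<psi> / r"
    define q0 where "q0 z = q z - c * \<psi> z" for z
    have qL: "q \<in> L2 n" by (rule L2_subspaceD(1)[OF V q])
    have q0Q: "q0 \<in> Q" unfolding q0_def by (rule L2_subspaceD(5)[OF V q L2_subspaceD(4)[OF V \<psi>(1)]])
    have "inner2 n q0 \<psi> = inner2 n q \<psi> - c * r"
      unfolding q0_def inner2_diff_left[OF qL L2_cmult[OF \<psi>L] \<psi>L] inner2_cmult_left \<psi>\<psi> ..
    then have "inner2 n q0 \<psi> = 0" using r by (simp add: c_def)
    then have orth: "inner2 n \<psi> q0 = 0" by (subst inner2_commute) simp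
    have "q \<in> W" by (rule WI[OF M_tildeI[OF q0Q orth M_space_zero H2_0_zero], of _ c]) (simp add: q0_def)
    then show "inner2 n \<phi> q = inner2 n \<psi> q" using \<phi>W by blast
  qed
  ultimately show thesis by (rule that)
qed

section \<open>The operator \<open>X\<close> and its symbol\<close>

lemma contraction_onD:
  assumes "contraction_on n Q X"
  shows "f \<in> Q \<Longrightarrow> X f \<in> Q"
    "f \<in> Q \<Longrightarrow> g \<in> Q \<Longrightarrow> ae_eq n (X (\<lambda>z. a * f z + b * g z)) (\<lambda>z. a * X f z + b * X g z)"
    "f \<in> Q \<Longrightarrow> norm2 n (X f) \<le> norm2 n f"
  using assms unfolding contraction_on_def by blast+

lemma ae_eq_trans: "ae_eq n f g \<Longrightarrow> ae_eq n g h \<Longrightarrow> ae_eq n f h"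
  unfolding ae_eq_def by (erule (1) eventually_elim2) simp

lemma ae_eq_sym: "ae_eq n f g \<Longrightarrow> ae_eq n g f"
  unfolding ae_eq_def by (erule eventually_mono) simp

context
  fixes n :: nat and Q :: "tfun set" and X :: "tfun \<Rightarrow> tfun"
  assumes Qm: "quotient_module n Q" and X: "contraction_on n Q X"
begin

private lemma Qc: "L2_closed_subspace n Q" by (rule quotient_moduleD(1)[OF Qm])
private lemma V: "L2_subspace n Q" by (rule L2_closed_subspaceD(1)[OF Qc])
private lemma QL: "f \<in> Q \<Longrightarrow> f \<in> L2 n" by (rule L2_subspaceD(1)[OF V])

lemma contraction_norm2_diff_le:
  assumes f: "f \<in> Q" and g: "g \<in> Q"
  shows "norm2 n (\<lambda>z. X f z - X g z) \<le> norm2 n (\<lambda>z. f z - g z)"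
proof -
  have eq: "(\<lambda>z. 1 * f z + (- 1) * g z) = (\<lambda>z. f z - g z)" by simp
  have d: "(\<lambda>z. f z - g z) \<in> Q" by (rule L2_subspaceD(5)[OF V f g])
  have "ae_eq n (X (\<lambda>z. f z - g z)) (\<lambda>z. X f z - X g z)"
    using contraction_onD(2)[OF X f g, of 1 "-1"] unfolding eq by simp
  then have "norm2 n (\<lambda>z. X f z - X g z) = norm2 n (X (\<lambda>z. f z - g z))"
    by (intro norm2_cong_AE L2_diff QL contraction_onD(1)[OF X] f g d) (auto simp: ae_eq_def elim: eventually_mono)
  then show ?thesis using contraction_onD(3)[OF X d] by simp
qed

text \<open>\<open>X\<close> acts on representatives and might distinguish functions that agree
  almost everywhere; the norm bound rules this out, so \<open>X\<close> descends to classes.\<close>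

lemma contraction_cong_AE:
  assumes f: "f \<in> Q" and g: "g \<in> Q" and "ae_eq n f g"
  shows "ae_eq n (X f) (X g)"
proof -
  have d: "(\<lambda>z. f z - g z) \<in> Q" by (rule L2_subspaceD(5)[OF V f g])
  have d': "(\<lambda>z. X f z - X g z) \<in> L2 n" by (intro L2_diff QL contraction_onD(1)[OF X] f g)
  have "norm2 n (\<lambda>z. f z - g z) = 0"
    using assms(3) unfolding norm2_eq_0_iff[OF QL[OF d]] ae_eq_def by simp
  then have "norm2 n (\<lambda>z. X f z - X g z) = 0"
    using contraction_norm2_diff_le[OF f g] norm2_nonneg[of n "\<lambda>z. X f z - X g z"] by linarith
  then show ?thesis unfolding norm2_eq_0_iff[OF d'] ae_eq_def by simp
qed

text \<open>\<open>f\<close> and its projection differ by an element of the complement, which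
  multiplication by a coordinate preserves. So \<open>f\<close> may be replaced by its projection
  before multiplying.\<close>

lemma is_proj_coord_mult:
  assumes i: "i < n" and f: "f \<in> H2 n" and g: "is_proj n Q f g"
  shows "is_proj n Q (\<lambda>z. z i * f z) (projQ n Q (\<lambda>z. z i * g z))"
proof -
  have gQ: "g \<in> Q" by (rule is_proj_in[OF Qc g])
  have gH: "g \<in> H2 n" by (rule quotient_moduleD(2)[OF Qm gQ])
  have L: "(\<lambda>z. z i * f z) \<in> L2 n" "(\<lambda>z. z i * g z) \<in> L2 n"
    by (intro H2_L2 H2_coord_mult f gH i)+
  have p: "is_proj n Q (\<lambda>z. z i * g z) (projQ n Q (\<lambda>z. z i * g z))" by (rule is_proj_projQ[OF Qc L(2)])
  show ?thesis
  proof (rule is_projI[OF Qc L(1) is_proj_in[OF Qc p]])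
    fix q assume q: "q \<in> Q"
    have "inner2 n (\<lambda>z. z i * (f z - g z)) q = 0"
      using g by (intro quotient_module_orth_coord[OF Qm i H2_diff[OF f gH] _ q]) (simp add: is_proj_def)
    then have "inner2 n (\<lambda>z. z i * f z) q - inner2 n (\<lambda>z. z i * g z) q = 0"
      unfolding right_diff_distrib inner2_diff_left[OF L QL[OF q]] .
    then show "inner2 n (\<lambda>z. z i * f z) q = inner2 n (projQ n Q (\<lambda>z. z i * g z)) q"
      using is_proj_inner2[OF Qc p L(2) q] by simp
  qed
qed

text \<open>\<open>X\<close> commutes with the compressed shifts, and projecting turns
  multiplication by a coordinate into such a shift. By induction, the value of \<open>X\<close> at
  the projection of \<open>1\<close> determines it on all projected monomials.\<close>

lemma module_map_monom:
  assumes Xm: "module_map n Q X" and k: "k \<in> nonneg_exp n"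
  shows "is_proj n Q (\<lambda>z. monom_T n k z * X (projQ n Q (\<lambda>z. 1)) z) (X (projQ n Q (monom_T n k)))"
  using k
proof (induction rule: monom_T_induct)
  case one
  have "X (projQ n Q (\<lambda>z. 1)) \<in> Q"
    by (intro contraction_onD(1)[OF X] is_proj_in[OF Qc is_proj_projQ[OF Qc L2_const]])
  then show ?case using is_proj_self[OF Qc] by simp
next
  case (mult i k)
  define \<psi> where "\<psi> = X (projQ n Q (\<lambda>z. 1))"
  define u where "u = monom_T n k"
  have \<psi>Q: "\<psi> \<in> Q"
    unfolding \<psi>_def by (intro contraction_onD(1)[OF X] is_proj_in[OF Qc is_proj_projQ[OF Qc L2_const]])
  have \<psi>H: "\<psi> \<in> H2 n" by (rule quotient_moduleD(2)[OF Qm \<psi>Q])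
  have IH: "is_proj n Q (\<lambda>z. u z * \<psi> z) (X (projQ n Q u))" using mult(3) unfolding u_def \<psi>_def .
  have uH: "u \<in> H2 n" unfolding u_def by (rule H2_monom_T[OF mult(2)])
  have u\<psi>H: "(\<lambda>z. u z * \<psi> z) \<in> H2 n" unfolding u_def by (rule H2_monom_T_mult[OF \<psi>H mult(2)])
  have zuL: "(\<lambda>z. z i * u z) \<in> L2 n" by (intro H2_L2 H2_coord_mult uH mult(1))
  have pu: "is_proj n Q u (projQ n Q u)" by (rule is_proj_projQ[OF Qc H2_L2[OF uH]])
  have puQ: "projQ n Q u \<in> Q" by (rule is_proj_in[OF Qc pu])
  have pz: "is_proj n Q (\<lambda>z. z i * u z) (projQ n Q (\<lambda>z. z i * u z))" by (rule is_proj_projQ[OF Qc zuL])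
  have pz': "is_proj n Q (\<lambda>z. z i * u z) (S_op n Q (\<lambda>z. z i) (projQ n Q u))"
    unfolding S_op_def by (rule is_proj_coord_mult[OF mult(1) uH pu])
  have e1: "ae_eq n (X (projQ n Q (\<lambda>z. z i * u z))) (X (S_op n Q (\<lambda>z. z i) (projQ n Q u)))"
    by (rule contraction_cong_AE[OF is_proj_in[OF Qc pz] is_proj_in[OF Qc pz'] is_proj_unique[OF Qc pz pz' zuL]])
  have e2: "ae_eq n (X (S_op n Q (\<lambda>z. z i) (projQ n Q u))) (S_op n Q (\<lambda>z. z i) (X (projQ n Q u)))"
    using Xm mult(1) puQ unfolding module_map_def by blast
  have p2: "is_proj n Q (\<lambda>z. z i * (u z * \<psi> z)) (S_op n Q (\<lambda>z. z i) (X (projQ n Q u)))"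
    unfolding S_op_def by (rule is_proj_coord_mult[OF mult(1) u\<psi>H IH])
  have "is_proj n Q (\<lambda>z. z i * (u z * \<psi> z)) (X (projQ n Q (\<lambda>z. z i * u z)))"
    by (rule is_proj_cong_AE[OF Qc p2 _ contraction_onD(1)[OF X is_proj_in[OF Qc pz]]
          ae_eq_sym[OF ae_eq_trans[OF e1 e2]]])
       (intro H2_L2 H2_coord_mult u\<psi>H mult(1))
  then show ?case unfolding u_def \<psi>_def by (simp only: mult.assoc)
qed

text \<open>Since \<open>\<phi> - \<psi>\<close> is orthogonal to \<open>Q\<close> and stays so
  after multiplication by monomials, replacing \<open>\<psi>\<close> by \<open>\<phi>\<close> does
  not change the projections that give \<open>X\<close> on projected monomials. Linearity and the
  norm bounds for \<open>X\<close> and for multiplication by \<open>\<phi>\<close> extend this to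
  \<open>Q\<close>.\<close>

lemma liftable_if_symbol:
  assumes Xm: "module_map n Q X" and \<phi>: "\<phi> \<in> schur_ball n"
    and eq: "\<And>q. q \<in> Q \<Longrightarrow> inner2 n \<phi> q = inner2 n (X (projQ n Q (\<lambda>z. 1))) q"
  shows "liftable n Q X"
  unfolding liftable_def
proof (intro bexI[OF _ \<phi>] ballI)
  fix f assume f: "f \<in> Q"
  define \<psi> where "\<psi> = X (projQ n Q (\<lambda>z. 1))"
  have \<phi>H: "\<phi> \<in> H2 n" and \<phi>1: "AE z in torus_measure n. cmod (\<phi> z) \<le> 1" using \<phi> by (auto simp: schur_ball_def)
  have \<phi>m: "\<phi> \<in> borel_measurable (torus_measure n)" using H2_L2[OF \<phi>H] by auto
  have \<psi>Q: "\<psi> \<in> Q"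
    unfolding \<psi>_def by (intro contraction_onD(1)[OF X] is_proj_in[OF Qc is_proj_projQ[OF Qc L2_const]])
  have \<psi>H: "\<psi> \<in> H2 n" by (rule quotient_moduleD(2)[OF Qm \<psi>Q])
  have \<phi>L: "(\<lambda>z. \<phi> z * u z) \<in> L2 n" if "u \<in> L2 n" for u by (rule L2_mult_bounded[OF \<phi>m \<phi>1 that])
  have mono: "is_proj n Q (\<lambda>z. \<phi> z * monom_T n k z) (X (projQ n Q (monom_T n k)))" if k: "k \<in> nonneg_exp n" for k
  proof -
    have m: "is_proj n Q (\<lambda>z. monom_T n k z * \<psi> z) (X (projQ n Q (monom_T n k)))"
      unfolding \<psi>_def by (rule module_map_monom[OF Xm k])
    have L: "(\<lambda>z. monom_T n k z * \<phi> z) \<in> L2 n" "(\<lambda>z. monom_T n k z * \<psi> z) \<in> L2 n"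
      by (intro L2_monom_T_mult H2_L2 \<phi>H \<psi>H)+
    have dH: "(\<lambda>z. \<phi> z - \<psi> z) \<in> H2 n" by (rule H2_diff[OF \<phi>H \<psi>H])
    have d0: "inner2 n (\<lambda>z. \<phi> z - \<psi> z) q = 0" if "q \<in> Q" for q
      unfolding inner2_diff_left[OF H2_L2[OF \<phi>H] H2_L2[OF \<psi>H] QL[OF that]] using eq[OF that] by (simp add: \<psi>_def)
    have "is_proj n Q (\<lambda>z. monom_T n k z * \<phi> z) (X (projQ n Q (monom_T n k)))"
    proof (rule is_projI[OF Qc L(1) is_proj_in[OF Qc m]])
      fix q assume q: "q \<in> Q"
      have "inner2 n (\<lambda>z. monom_T n k z * (\<phi> z - \<psi> z)) q = 0"
        by (rule bspec[OF quotient_module_orth_monom[OF Qm dH d0 k] q])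
      then have "inner2 n (\<lambda>z. monom_T n k z * \<phi> z) q - inner2 n (\<lambda>z. monom_T n k z * \<psi> z) q = 0"
        unfolding right_diff_distrib inner2_diff_left[OF L QL[OF q]] .
      then show "inner2 n (\<lambda>z. monom_T n k z * \<phi> z) q = inner2 n (X (projQ n Q (monom_T n k))) q"
        using is_proj_inner2[OF Qc m L(2) q] by simp
    qed
    then show ?thesis by (simp only: mult.commute)
  qed
  have sums: "is_proj n Q (\<lambda>z. \<phi> z * (\<Sum>i<m. c i * monom_T n (\<kappa> i) z))
      (X (projQ n Q (\<lambda>z. \<Sum>i<m. c i * monom_T n (\<kappa> i) z)))"
    if "\<forall>i<m. \<kappa> i \<in> nonneg_exp n" for m :: nat and c \<kappa>
    using that
  proof (induction m)
    case 0
    \<comment> \<open>Even the projection of \<open>0\<close> is known only up to a null set, so the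
      empty sum takes an argument by norms.\<close>
    define p where "p = projQ n Q (\<lambda>z. 0)"
    have p: "is_proj n Q (\<lambda>z. 0) p" unfolding p_def by (rule is_proj_projQ[OF Qc L2_zero])
    have pQ: "p \<in> Q" by (rule is_proj_in[OF Qc p])
    have "norm2 n (X p) \<le> 0"
      using contraction_onD(3)[OF X pQ] is_proj_norm2_le[OF Qc p L2_zero] by (simp add: norm2_def)
    then have z: "norm2 n (X p) = 0" using norm2_nonneg[of n "X p"] by linarith
    have "is_proj n Q (\<lambda>z. 0) (X p)"
    proof (rule is_projI[OF Qc L2_zero contraction_onD(1)[OF X pQ]])
      fix q assume "q \<in> Q"
      then have "cmod (inner2 n (X p) q) \<le> 0"
        using cmod_inner2_le[OF QL[OF contraction_onD(1)[OF X pQ]] QL, of q] z by simp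
      then show "inner2 n (\<lambda>z. 0) q = inner2 n (X p) q" by (simp add: inner2_def)
    qed
    then show ?case by (simp add: p_def)
  next
    case (Suc m)
    define s where "s z = (\<Sum>i<m. c i * monom_T n (\<kappa> i) z)" for z
    define u where "u = monom_T n (\<kappa> m)"
    have sL: "s \<in> L2 n" unfolding s_def by (intro L2_sum L2_cmult L2_monom_T)
    have uL: "u \<in> L2 n" unfolding u_def by (rule L2_monom_T)
    have s: "is_proj n Q (\<lambda>z. \<phi> z * s z) (X (projQ n Q s))" using Suc unfolding s_def[abs_def] by simp
    have u: "is_proj n Q (\<lambda>z. \<phi> z * u z) (X (projQ n Q u))" unfolding u_def using Suc by (intro mono) simp
    have ps: "is_proj n Q s (projQ n Q s)" and pu: "is_proj n Q u (projQ n Q u)"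
      by (rule is_proj_projQ[OF Qc sL], rule is_proj_projQ[OF Qc uL])
    let ?w = "\<lambda>z. 1 * s z + c m * u z"
    have wL: "?w \<in> L2 n" by (intro L2_add L2_cmult sL uL)
    have pw: "is_proj n Q ?w (projQ n Q ?w)" by (rule is_proj_projQ[OF Qc wL])
    have pw': "is_proj n Q ?w (\<lambda>z. 1 * projQ n Q s z + c m * projQ n Q u z)"
      by (rule is_proj_linear[OF Qc ps pu sL uL])
    have e1: "ae_eq n (X (projQ n Q ?w)) (X (\<lambda>z. 1 * projQ n Q s z + c m * projQ n Q u z))"
      by (rule contraction_cong_AE[OF is_proj_in[OF Qc pw] is_proj_in[OF Qc pw'] is_proj_unique[OF Qc pw pw' wL]])
    have e2: "ae_eq n (X (\<lambda>z. 1 * projQ n Q s z + c m * projQ n Q u z))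
        (\<lambda>z. 1 * X (projQ n Q s) z + c m * X (projQ n Q u) z)"
      by (rule contraction_onD(2)[OF X is_proj_in[OF Qc ps] is_proj_in[OF Qc pu]])
    have "is_proj n Q (\<lambda>z. 1 * (\<phi> z * s z) + c m * (\<phi> z * u z)) (\<lambda>z. 1 * X (projQ n Q s) z + c m * X (projQ n Q u) z)"
      by (rule is_proj_linear[OF Qc s u \<phi>L[OF sL] \<phi>L[OF uL]])
    then have "is_proj n Q (\<lambda>z. 1 * (\<phi> z * s z) + c m * (\<phi> z * u z)) (X (projQ n Q ?w))"
      by (rule is_proj_cong_AE[OF Qc _ L2_add[OF L2_cmult[OF \<phi>L[OF sL]] L2_cmult[OF \<phi>L[OF uL]]]
            contraction_onD(1)[OF X is_proj_in[OF Qc pw]] ae_eq_sym[OF ae_eq_trans[OF e1 e2]]])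
    moreover have "(\<lambda>z. \<phi> z * (\<Sum>i<Suc m. c i * monom_T n (\<kappa> i) z)) = (\<lambda>z. 1 * (\<phi> z * s z) + c m * (\<phi> z * u z))"
      by (simp add: s_def u_def algebra_simps)
    moreover have "(\<lambda>z. \<Sum>i<Suc m. c i * monom_T n (\<kappa> i) z) = ?w"
      by (simp add: s_def u_def)
    ultimately show ?case by (simp only:)
  qed
  \<comment> \<open>The polynomials approximating \<open>f\<close> need not lie in \<open>Q\<close>.
    Their projections do, and these still converge to \<open>f\<close>, which is its own projection,
    because projecting does not increase norms.\<close>
  obtain h where h: "\<forall>j::nat. h j \<in> trig_poly n (nonneg_exp n)"
    and lim: "(\<lambda>j. norm2 n (\<lambda>z. h j z - f z)) \<longlonglongrightarrow> 0"
    by (rule H2_dense[OF quotient_moduleD(2)[OF Qm f]])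
  have hL: "h j \<in> L2 n" for j using L2_subspaceD(1)[OF L2_subspace_trig_poly spec[OF h]] .
  have fL: "f \<in> L2 n" by (rule QL[OF f])
  have hp: "is_proj n Q (\<lambda>z. \<phi> z * h j z) (X (projQ n Q (h j)))" for j
  proof -
    obtain m :: nat and c \<kappa> where hj: "\<forall>i<m. \<kappa> i \<in> nonneg_exp n" "h j = (\<lambda>z. \<Sum>i<m. c i * monom_T n (\<kappa> i) z)"
      by (rule trig_polyE[OF spec[OF h, of j]])
    show ?thesis unfolding hj(2) by (rule sums[OF hj(1)])
  qed
  have ph: "is_proj n Q (h j) (projQ n Q (h j))" for j by (rule is_proj_projQ[OF Qc hL])
  have phQ: "projQ n Q (h j) \<in> Q" for j by (rule is_proj_in[OF Qc ph])
  have XphQ: "X (projQ n Q (h j)) \<in> Q" for j by (rule contraction_onD(1)[OF X phQ])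
  have XfQ: "X f \<in> Q" by (rule contraction_onD(1)[OF X f])
  have "norm2 n (\<lambda>z. X (projQ n Q (h j)) z - X f z) \<le> norm2 n (\<lambda>z. h j z - f z)" for j
  proof -
    have "is_proj n Q (\<lambda>z. 1 * h j z + (- 1) * f z) (\<lambda>z. 1 * projQ n Q (h j) z + (- 1) * f z)"
      by (rule is_proj_linear[OF Qc ph is_proj_self[OF Qc f] hL fL])
    then have "is_proj n Q (\<lambda>z. h j z - f z) (\<lambda>z. projQ n Q (h j) z - f z)" by simp
    from is_proj_norm2_le[OF Qc this L2_diff[OF hL fL]] contraction_norm2_diff_le[OF phQ[of j] f]
    show ?thesis by linarith
  qed
  then have "\<forall>j. norm (norm2 n (\<lambda>z. X (projQ n Q (h j)) z - X f z)) \<le> norm2 n (\<lambda>z. h j z - f z)" by simp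
  then have Xlim: "(\<lambda>j. norm2 n (\<lambda>z. X (projQ n Q (h j)) z - X f z)) \<longlonglongrightarrow> 0"
    by (rule Lim_null_comparison[OF always_eventually lim])
  have "norm2 n (\<lambda>z. \<phi> z * h j z - \<phi> z * f z) \<le> norm2 n (\<lambda>z. h j z - f z)" for j
    unfolding right_diff_distrib[symmetric] by (rule norm2_mult_bounded_le[OF \<phi>m \<phi>1 L2_diff[OF hL fL]])
  then have "\<forall>j. norm (norm2 n (\<lambda>z. \<phi> z * h j z - \<phi> z * f z)) \<le> norm2 n (\<lambda>z. h j z - f z)" by simp
  then have \<phi>lim: "(\<lambda>j. norm2 n (\<lambda>z. \<phi> z * h j z - \<phi> z * f z)) \<longlonglongrightarrow> 0"
    by (rule Lim_null_comparison[OF always_eventually lim])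
  have p: "is_proj n Q (\<lambda>z. \<phi> z * f z) (X f)"
  proof (rule is_projI[OF Qc \<phi>L[OF fL] XfQ])
    fix q assume q: "q \<in> Q"
    have "(\<lambda>j. inner2 n (\<lambda>z. \<phi> z * h j z) q) \<longlonglongrightarrow> inner2 n (\<lambda>z. \<phi> z * f z) q"
      by (rule tendsto_inner2[OF \<phi>L[OF hL] \<phi>L[OF fL] \<phi>lim QL[OF q]])
    moreover have "(\<lambda>j. inner2 n (\<lambda>z. \<phi> z * h j z) q) = (\<lambda>j. inner2 n (X (projQ n Q (h j))) q)"
      using is_proj_inner2[OF Qc hp \<phi>L[OF hL] q] by (intro ext)
    ultimately have "(\<lambda>j. inner2 n (X (projQ n Q (h j))) q) \<longlonglongrightarrow> inner2 n (\<lambda>z. \<phi> z * f z) q" by (simp only:)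
    then show "inner2 n (\<lambda>z. \<phi> z * f z) q = inner2 n (X f) q"
      by (rule LIMSEQ_unique[OF _ tendsto_inner2[OF QL[OF XphQ] QL[OF XfQ] Xlim QL[OF q]]])
  qed
  show "ae_eq n (X f) (S_op n Q \<phi> f)"
    unfolding S_op_def by (rule is_proj_unique[OF Qc p is_proj_projQ[OF Qc \<phi>L[OF fL]] \<phi>L[OF fL]])
qed

text \<open>With \<open>p\<close> the projection of \<open>1\<close>, the function
  \<open>1 - p\<close> is orthogonal to \<open>Q\<close>, and so is its product with
  \<open>\<phi>\<close>. Hence \<open>\<phi>\<close> and \<open>\<phi> * p\<close> have the same
  projection, which is \<open>X p\<close> by lifting. Only here does a bounded symbol, rather than a
  polynomial, multiply an element of the complement.\<close>

lemma symbol_if_liftable: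
  assumes \<phi>: "\<phi> \<in> schur_ball n" and lift: "\<forall>f\<in>Q. ae_eq n (X f) (S_op n Q \<phi> f)" and q: "q \<in> Q"
  shows "inner2 n \<phi> q = inner2 n (X (projQ n Q (\<lambda>z. 1))) q"
proof -
  define p where "p = projQ n Q (\<lambda>z. 1)"
  have \<phi>H: "\<phi> \<in> H2 n" and \<phi>1: "AE z in torus_measure n. cmod (\<phi> z) \<le> 1" using \<phi> by (auto simp: schur_ball_def)
  have \<phi>m: "\<phi> \<in> borel_measurable (torus_measure n)" using H2_L2[OF \<phi>H] by auto
  have pp: "is_proj n Q (\<lambda>z. 1) p" unfolding p_def by (rule is_proj_projQ[OF Qc L2_const])
  have pQ: "p \<in> Q" by (rule is_proj_in[OF Qc pp])
  have \<phi>p: "(\<lambda>z. \<phi> z * p z) \<in> L2 n" by (rule L2_mult_bounded[OF \<phi>m \<phi>1 QL[OF pQ]])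
  have S: "is_proj n Q (\<lambda>z. \<phi> z * p z) (S_op n Q \<phi> p)" unfolding S_op_def by (rule is_proj_projQ[OF Qc \<phi>p])
  have h: "(\<lambda>z. 1 - p z) \<in> H2 n" by (rule H2_diff[OF H2_1 quotient_moduleD(2)[OF Qm pQ]])
  have h0: "inner2 n (\<lambda>z. 1 - p z) q = 0" if "q \<in> Q" for q using pp that by (simp add: is_proj_def)
  have "inner2 n (\<lambda>z. \<phi> z * (1 - p z)) q = 0"
    by (rule quotient_module_orth_bounded[OF Qm h h0 \<phi> q])
  moreover have "(\<lambda>z. \<phi> z * (1 - p z)) = (\<lambda>z. \<phi> z - \<phi> z * p z)" by (simp add: algebra_simps)
  ultimately have "inner2 n \<phi> q = inner2 n (\<lambda>z. \<phi> z * p z) q"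
    using inner2_diff_left[OF H2_L2[OF \<phi>H] \<phi>p QL[OF q]] by simp
  also have "\<dots> = inner2 n (S_op n Q \<phi> p) q" by (rule is_proj_inner2[OF Qc S \<phi>p q])
  also have "\<dots> = inner2 n (X p) q"
  proof (rule inner2_cong_AE)
    show "AE z in torus_measure n. S_op n Q \<phi> p z = X p z"
      using ae_eq_sym[OF bspec[OF lift pQ]] by (simp add: ae_eq_def)
  qed (auto intro: QL q is_proj_in[OF Qc S] contraction_onD(1)[OF X pQ])
  finally show ?thesis unfolding p_def .
qed

end

text \<open>Nonvanishing of \<open>\<psi>\<close> gives meaning to the normalised function. In the
  excluded case the quotient would be the zero function by the convention \<open>x / 0 = 0\<close>,
  at distance \<open>0\<close> from a space containing \<open>0\<close>, whereas \<open>X\<close>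
  would vanish almost everywhere and be lifted by \<open>0\<close>.\<close>

theorem theorem4p3:
  fixes n :: nat and Q :: "tfun set" and X :: "tfun \<Rightarrow> tfun"
  assumes "n \<ge> 1"
    and "quotient_module n Q"
    and "contraction_on n Q X"
    and "module_map n Q X"
    and "norm2 n (X (projQ n Q (\<lambda>z. 1))) \<noteq> 0"
  shows "liftable n Q X \<longleftrightarrow>
    (let \<psi> = X (projQ n Q (\<lambda>z. 1)) in
       dist_L1 n (\<lambda>z. cnj (\<psi> z) / complex_of_real ((norm2 n \<psi>)\<^sup>2)) (M_tilde n Q \<psi>) \<ge> 1)"
proof -
  define \<psi> where "\<psi> = X (projQ n Q (\<lambda>z. 1))"
  have Qc: "L2_closed_subspace n Q" by (rule quotient_moduleD(1)[OF assms(2)])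
  have V: "L2_subspace n Q" by (rule L2_closed_subspaceD(1)[OF Qc])
  have \<psi>Q: "\<psi> \<in> Q"
    unfolding \<psi>_def by (intro contraction_onD(1)[OF assms(3)] is_proj_in[OF Qc is_proj_projQ[OF Qc L2_const]])
  have \<psi>H: "\<psi> \<in> H2 n" by (rule quotient_moduleD(2)[OF assms(2) \<psi>Q])
  have \<psi>0: "norm2 n \<psi> \<noteq> 0" using assms(5) by (simp add: \<psi>_def)
  have "liftable n Q X \<longleftrightarrow>
    1 \<le> dist_L1 n (\<lambda>z. cnj (\<psi> z) / complex_of_real ((norm2 n \<psi>)\<^sup>2)) (M_tilde n Q \<psi>)"
  proof
    assume "liftable n Q X"
    then obtain \<phi> where \<phi>: "\<phi> \<in> schur_ball n" and lift: "\<forall>f\<in>Q. ae_eq n (X f) (S_op n Q \<phi> f)"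
      unfolding liftable_def by blast
    show "1 \<le> dist_L1 n (\<lambda>z. cnj (\<psi> z) / complex_of_real ((norm2 n \<psi>)\<^sup>2)) (M_tilde n Q \<psi>)"
      by (rule schur_ball_dist_ge_1[OF V \<psi>Q \<psi>0 \<phi>])
         (unfold \<psi>_def, rule symbol_if_liftable[OF assms(2,3) \<phi> lift])
  next
    assume dist: "1 \<le> dist_L1 n (\<lambda>z. cnj (\<psi> z) / complex_of_real ((norm2 n \<psi>)\<^sup>2)) (M_tilde n Q \<psi>)"
    obtain \<phi> where \<phi>: "\<phi> \<in> schur_ball n" and eq: "\<forall>q\<in>Q. inner2 n \<phi> q = inner2 n \<psi> q"
      by (rule dist_ge_1_schur_ball[OF V \<psi>Q \<psi>H \<psi>0 dist])
    show "liftable n Q X"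
      by (rule liftable_if_symbol[OF assms(2-4) \<phi>]) (rule bspec[OF eq[unfolded \<psi>_def]])
  qed
  then show ?thesis unfolding \<psi>_def Let_def .
qed

end
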